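(* Let $n\in\mathbb N$. For any $d\in[0,1]^n$ with $d_1\ge\dots\ge d_n$ there is a unique Bernoulli Gibbs measure $\mu_d$ on ordered $n$-tuples of Bernoulli paths on $[0,\infty)$ such that for $X\sim\mu_d$, $$\lim_{t\to\infty}X(t)/t=d\quad\text{almost surely.}$$
   Context: A Bernoulli path is a continuous function $f$ on $[0,t]$ ($t\in\mathbb N$) or $[0,\infty)$ with $f(0)=0$ that is linear with slope in $\{0,1\}$ on every interval $[j,j+1]$, $j\in\{0,1,2,\dots\}$. For $t\in\mathbb N$ and $x=(x_1\ge\dots\ge x_n)\in\{0,1,\dots\}^n$, $\nu_t(x)$ is the uniform measure on the (finite) set of $n$-tuples of ordered Bernoulli paths $f=(f_1\ge\dots\ge f_n)$ on $[0,t]$ with $f(0)=0$, $f(t)=x$. A probability measure $\mu$ on $n$-tuples of ordered Bernoulli paths $X=(X_1\ge\dots\ge X_n)$, $X_i:[0,\infty)\to\mathbb R$, is a Bernoulli Gibbs measure if for every integer $t>0$ the conditional distribution under $\mu$ of $X|_{[0,t]}$ given $X|_{[t,\infty)}$ is $\nu_t(X(t))$. *)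

theory Defs
  imports "HOL-Probability.Probability"
begin

(* Paths live on a time domain T, used with T = {0..t} and T = {0..}; they are undefined
   outside T, so that a path is determined by its values on T. *)
definition bernoulli_paths :: "real set \<Rightarrow> (real \<Rightarrow> real) set" where
  "bernoulli_paths T = {f \<in> extensional T. continuous_on T f \<and> f 0 = 0 \<and>
     (\<forall>j::nat. {real j..real j + 1} \<subseteq> T \<longrightarrow>
        (\<exists>c\<in>{0, 1}. \<forall>s\<in>{real j..real j + 1}. f s = f (real j) + c * (s - real j)))}"

definition ordered_paths :: "nat \<Rightarrow> real set \<Rightarrow> (nat \<Rightarrow> real \<Rightarrow> real) set" where
  "ordered_paths n T =
     {f \<in> {1..n} \<rightarrow>\<^sub>E bernoulli_paths T. \<forall>s\<in>T. antimono_on {1..n} (\<lambda>i. f i s)}"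

definition eval_algebra :: "nat \<Rightarrow> real set \<Rightarrow> (nat \<Rightarrow> real \<Rightarrow> real) measure" where
  "eval_algebra n T = PiM {1..n} (\<lambda>i. PiM T (\<lambda>s. borel))"

(* The trace of the evaluation sigma-algebra on ordered n-tuples of Bernoulli paths. *)
definition path_space :: "nat \<Rightarrow> real set \<Rightarrow> (nat \<Rightarrow> real \<Rightarrow> real) measure" where
  "path_space n T = restrict_space (eval_algebra n T) (ordered_paths n T)"

definition restrict_paths ::
    "nat \<Rightarrow> real set \<Rightarrow> (nat \<Rightarrow> real \<Rightarrow> real) \<Rightarrow> (nat \<Rightarrow> real \<Rightarrow> real)" where
  "restrict_paths n T X = (\<lambda>i\<in>{1..n}. restrict (X i) T)"

(* There are only finitely many Bernoulli paths on {0..t}, so every set of them is measurable.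
   The endpoint x is real-valued so that it can be X(t); if no ordered tuple ends at x
   then nu is the zero measure. *)
definition nu :: "nat \<Rightarrow> nat \<Rightarrow> (nat \<Rightarrow> real) \<Rightarrow> (nat \<Rightarrow> real \<Rightarrow> real) measure" where
  "nu n t x = uniform_measure (count_space (ordered_paths n {0..real t}))
     {f \<in> ordered_paths n {0..real t}. \<forall>i\<in>{1..n}. f i (real t) = x i}"

(* The conditional distribution under M of Y, valued in N, given Z, valued in P, is the
   random measure K: a version of the conditional probability of the event that Y lies in A,
   given the sigma-algebra generated by Z, is K(A), for every measurable A. *)
definition cond_distr_given ::
    "'a measure \<Rightarrow> 'b measure \<Rightarrow> ('a \<Rightarrow> 'b) \<Rightarrow> 'c measure \<Rightarrow> ('a \<Rightarrow> 'c) \<Rightarrow> ('a \<Rightarrow> 'b measure) \<Rightarrow> bool" where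
  "cond_distr_given M N Y P Z K \<longleftrightarrow>
     Y \<in> measurable M N \<and> Z \<in> measurable M P \<and>
     (\<forall>A\<in>sets N. AE \<omega> in M.
        real_cond_exp M (vimage_algebra (space M) Z P) (indicator (Y -` A \<inter> space M)) \<omega>
          = measure (K \<omega>) A)"

definition bernoulli_gibbs :: "nat \<Rightarrow> (nat \<Rightarrow> real \<Rightarrow> real) measure \<Rightarrow> bool" where
  "bernoulli_gibbs n M \<longleftrightarrow>
     prob_space M \<and> sets M = sets (path_space n {0..}) \<and>
     (\<forall>t::nat. t > 0 \<longrightarrow>
        cond_distr_given M
          (path_space n {0..real t}) (restrict_paths n {0..real t})
          (eval_algebra n {real t..}) (restrict_paths n {real t..})
          (\<lambda>X. nu n t (\<lambda>i. X i (real t))))"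

end

theory Submission
  imports Defs "HOL-Real_Asymp.Real_Asymp"
begin

text \<open>
  At integer times an ordered tuple of Bernoulli paths is a sequence of partitions with at most
  \<open>n\<close> rows, started at the empty one, in which each step adds at most one box to every row.
  The Gibbs property says that, given the partition at time \<open>t\<close> and the future, every way
  of reaching that partition is equally likely. Hence a Gibbs measure is known as soon as the law of
  the partition at every time is known (\<open>gibbs_eqI\<close>), and conversely a measure under
  which the probability of a prefix depends only on its length and its endpoint is Gibbs
  (\<open>gibbs_of_law\<close>).

  Existence. Give a prefix of length \<open>t\<close> that ends at the partition \<open>l\<close> the
  weight \<open>s_l(y) * prod (1 - d_i)^t\<close>, where \<open>s_l\<close> is the Schur polynomial in
  the variables \<open>y_i = d_i / (1 - d_i)\<close>. The branching rule writes this weight as a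
  polynomial in \<open>d\<close> with nonnegative values, which makes sense also when some
  \<open>d_i\<close> is 1 or when several of them agree. The Pieri rule
  \<open>prod (1 + y_i) * s_l(y) = sum s_l'(y)\<close>, where \<open>l'\<close> runs over the possible
  next partitions, says that the weights of the continuations of a prefix add up to the weight of
  the prefix (\<open>weight_harmonic\<close>), so that they are the prefix probabilities of a Markov
  chain (\<open>harmonic_measure_exists\<close>). The number of prefixes that end at \<open>l\<close>
  is at most \<open>prod (t choose l_i)\<close>, and because \<open>d\<close> is decreasing the weight
  is at most a power of \<open>t + 1\<close> times
  \<open>prod d_i^(l_i) * (1 - d_i)^(t - l_i)\<close> (\<open>weight_le_prod_bern\<close>). So the law
  of the partition at time \<open>t\<close> is dominated, up to a polynomial factor, by independent
  binomial laws, and Hoeffding's inequality with the Borel-Cantelli lemma gives the slopes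
  \<open>d_i\<close>.

  Uniqueness. The uniform law on the ordered paths with endpoint \<open>x\<close> is stochastically
  increasing in \<open>x\<close>: the ordered paths form a distributive lattice, and this is Daykin's
  inequality \<open>|A| |B| \<le> |A \<or> B| |A \<and> B|\<close>, a case of the four functions theorem
  (\<open>paths_stochastically_increasing\<close>). Let \<open>M\<close> be a Gibbs measure with slopes
  \<open>d\<close>, and compare it with the measures constructed above for slopes slightly larger and
  slightly smaller than \<open>d\<close>. At a late time the endpoints are ordered with probability
  close to 1, so at any fixed time the partition under \<open>M\<close> is stochastically between
  those under the two constructed measures. The constructed probabilities are polynomials in the
  slopes, and letting the slopes tend to \<open>d\<close> leaves only one possible value for each
  probability that the partition at a fixed time contains a given one. These probabilities determine
  the law of that partition.
\<close>

section \<open>The four functions theorem and lattices\<close>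

text \<open>
  This is the four functions theorem on a one-element ground set. With \<open>m = c1 * d0\<close>,
  \<open>u = a0 * b1\<close> and \<open>v = a1 * b0\<close>, everything rests on
  \<open>u + v \<le> m + u * v / m\<close>, that is on \<open>(m - u) * (m - v) \<ge> 0\<close>.
\<close>
lemma four_numbers:
  fixes a0 a1 b0 b1 c0 c1 d0 d1 :: real
  assumes nn: "0 \<le> a0" "0 \<le> a1" "0 \<le> b0" "0 \<le> b1" "0 \<le> c0" "0 \<le> c1" "0 \<le> d0" "0 \<le> d1"
    and h: "a0 * b0 \<le> c0 * d0" "a0 * b1 \<le> c1 * d0" "a1 * b0 \<le> c1 * d0" "a1 * b1 \<le> c1 * d1"
  shows "(a0 + a1) * (b0 + b1) \<le> (c0 + c1) * (d0 + d1)"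
proof (cases "c1 * d0 = 0")
  case True
  then have "a0 * b1 = 0" "a1 * b0 = 0"
    using h nn by (metis mult_nonneg_nonneg order_antisym)+
  moreover have "0 \<le> c0 * d1"
    using nn by simp
  ultimately show ?thesis
    using h(1,4) True by (simp only: distrib_left distrib_right)
next
  case False
  define m u v where "m = c1 * d0" and "u = a0 * b1" and "v = a1 * b0"
  have m: "m > 0"
    using False nn unfolding m_def by (metis less_eq_real_def mult_nonneg_nonneg)
  have uv: "u \<le> m" "v \<le> m"
    using h by (auto simp: m_def u_def v_def)
  have "u * v = (a0 * b0) * (a1 * b1)"
    by (simp add: u_def v_def)
  also have "\<dots> \<le> (c0 * d0) * (c1 * d1)"
    using nn by (intro mult_mono h(1) h(4) mult_nonneg_nonneg)
  also have "\<dots> = m * (c0 * d1)"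
    by (simp add: m_def)
  finally have 1: "u * v \<le> m * (c0 * d1)" .
  have "0 \<le> (m - u) * (m - v)"
    using uv by simp
  then have "m * (u + v) \<le> m * m + u * v"
    by (simp add: algebra_simps)
  also have "\<dots> \<le> m * (m + c0 * d1)"
    using 1 by (simp add: algebra_simps)
  finally have "u + v \<le> m + c0 * d1"
    using m by simp
  then show ?thesis
    using h by (simp add: algebra_simps m_def u_def v_def)
qed

lemma sum_Pow_insert:
  fixes f :: "'a set \<Rightarrow> real"
  assumes "finite F" "x \<notin> F"
  shows "(\<Sum>A\<in>Pow (insert x F). f A) = (\<Sum>A\<in>Pow F. f A + f (insert x A))"
proof -
  have inj: "inj_on (insert x) (Pow F)"
    using assms(2) by (auto simp: inj_on_def insert_ident)
  have "(\<Sum>A\<in>Pow (insert x F). f A) = sum f (Pow F) + sum f (insert x ` Pow F)"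
    unfolding Pow_insert using assms by (intro sum.union_disjoint) auto
  then show ?thesis
    by (simp add: sum.reindex[OF inj] sum.distrib)
qed

text \<open>
  The Ahlswede-Daykin inequality. Removing a point from the ground set replaces each function by
  the sum of its values with and without that point; the hypothesis survives this by
  \<open>four_numbers\<close>.
\<close>
theorem four_functions:
  fixes \<alpha> \<beta> \<gamma> \<delta> :: "'a set \<Rightarrow> real"
  assumes "finite S"
    and "\<And>A. 0 \<le> \<alpha> A" "\<And>A. 0 \<le> \<beta> A" "\<And>A. 0 \<le> \<gamma> A" "\<And>A. 0 \<le> \<delta> A"
    and "\<And>A B. A \<subseteq> S \<Longrightarrow> B \<subseteq> S \<Longrightarrow> \<alpha> A * \<beta> B \<le> \<gamma> (A \<union> B) * \<delta> (A \<inter> B)"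
  shows "(\<Sum>A\<in>Pow S. \<alpha> A) * (\<Sum>A\<in>Pow S. \<beta> A) \<le> (\<Sum>A\<in>Pow S. \<gamma> A) * (\<Sum>A\<in>Pow S. \<delta> A)"
  using assms
proof (induction S arbitrary: \<alpha> \<beta> \<gamma> \<delta> rule: finite_induct)
  case empty
  then show ?case
    using empty.prems(5)[of "{}" "{}"] by simp
next
  case (insert x F)
  show ?case
    unfolding sum_Pow_insert[OF insert.hyps]
  proof (rule insert.IH)
    fix A B assume AB: "A \<subseteq> F" "B \<subseteq> F"
    then have x: "x \<notin> A" "x \<notin> B"
      using insert.hyps by auto
    note h = insert.prems(5)
    show "(\<alpha> A + \<alpha> (insert x A)) * (\<beta> B + \<beta> (insert x B))
        \<le> (\<gamma> (A \<union> B) + \<gamma> (insert x (A \<union> B))) * (\<delta> (A \<inter> B) + \<delta> (insert x (A \<inter> B)))"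
    proof (rule four_numbers)
      show "\<alpha> A * \<beta> B \<le> \<gamma> (A \<union> B) * \<delta> (A \<inter> B)"
        using h[of A B] AB by blast
      show "\<alpha> A * \<beta> (insert x B) \<le> \<gamma> (insert x (A \<union> B)) * \<delta> (A \<inter> B)"
        using h[of A "insert x B"] AB x by (simp add: subset_insertI2)
      show "\<alpha> (insert x A) * \<beta> B \<le> \<gamma> (insert x (A \<union> B)) * \<delta> (A \<inter> B)"
        using h[of "insert x A" B] AB x by (simp add: subset_insertI2)
      show "\<alpha> (insert x A) * \<beta> (insert x B) \<le> \<gamma> (insert x (A \<union> B)) * \<delta> (insert x (A \<inter> B))"
        using h[of "insert x A" "insert x B"] AB x
        by (simp add: subset_insertI2 insert_mono)
    qed (use insert.prems in auto)
  qed (use insert.prems in \<open>auto intro: add_nonneg_nonneg\<close>)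
qed

lemma sum_Pow_of_bool:
  assumes "finite S" "\<A> \<subseteq> Pow S"
  shows "(\<Sum>X\<in>Pow S. of_bool (X \<in> \<A>)) = real (card \<A>)"
  using assms by (simp add: Int_absorb1)

text \<open>
  Daykin's inequality for a finite part of a lattice that is represented by finite sets, obtained by
  applying the four functions theorem to indicator functions. The conclusion is about
  sets \<open>C\<close> and \<open>D\<close> that merely contain all joins and meets, which is the
  form in which it is used.
\<close>
lemma daykin:
  fixes \<phi> :: "'a::lattice \<Rightarrow> 'b set"
  assumes fin: "finite A" "finite B" "finite C" "finite D"
    and inj: "inj_on \<phi> A" "inj_on \<phi> B"
    and \<phi>: "\<And>a. finite (\<phi> a)" "\<And>a b. \<phi> (sup a b) = \<phi> a \<union> \<phi> b" "\<And>a b. \<phi> (inf a b) = \<phi> a \<inter> \<phi> b"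
    and sup: "\<And>a b. a \<in> A \<Longrightarrow> b \<in> B \<Longrightarrow> sup a b \<in> C"
    and inf: "\<And>a b. a \<in> A \<Longrightarrow> b \<in> B \<Longrightarrow> inf a b \<in> D"
  shows "card A * card B \<le> card C * card D"
proof -
  define S where "S = \<Union>(\<phi> ` (A \<union> B \<union> C \<union> D))"
  have S: "finite S" "\<phi> ` A \<subseteq> Pow S" "\<phi> ` B \<subseteq> Pow S" "\<phi> ` C \<subseteq> Pow S" "\<phi> ` D \<subseteq> Pow S"
    using fin \<phi>(1) by (auto simp: S_def)
  have "(\<Sum>X\<in>Pow S. of_bool (X \<in> \<phi> ` A)) * (\<Sum>X\<in>Pow S. of_bool (X \<in> \<phi> ` B))
     \<le> (\<Sum>X\<in>Pow S. of_bool (X \<in> \<phi> ` C) :: real) * (\<Sum>X\<in>Pow S. of_bool (X \<in> \<phi> ` D))"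
  proof (rule four_functions[OF S(1)])
    fix X Y
    have "X \<union> Y \<in> \<phi> ` C \<and> X \<inter> Y \<in> \<phi> ` D" if XY: "X \<in> \<phi> ` A" "Y \<in> \<phi> ` B"
    proof -
      obtain a b where "a \<in> A" "X = \<phi> a" "b \<in> B" "Y = \<phi> b"
        using XY by auto
      then show ?thesis
        using sup[of a b] inf[of a b] \<phi>(2)[of a b] \<phi>(3)[of a b] by (metis image_eqI)
    qed
    then show "of_bool (X \<in> \<phi> ` A) * of_bool (Y \<in> \<phi> ` B)
        \<le> (of_bool (X \<union> Y \<in> \<phi> ` C) * of_bool (X \<inter> Y \<in> \<phi> ` D) :: real)"
      by auto
  qed auto
  then have "real (card (\<phi> ` A)) * real (card (\<phi> ` B)) \<le> real (card (\<phi> ` C)) * real (card (\<phi> ` D))"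
    using S by (simp only: sum_Pow_of_bool)
  then have "card (\<phi> ` A) * card (\<phi> ` B) \<le> card (\<phi> ` C) * card (\<phi> ` D)"
    by (metis of_nat_le_iff of_nat_mult)
  also have "\<dots> \<le> card C * card D"
    using fin by (intro mult_mono card_image_le) auto
  finally show ?thesis
    using inj by (simp add: card_image)
qed

section \<open>Ordered paths at integer times\<close>

text \<open>
  Partitions with at most \<open>n\<close> rows, indexed from 1 and extended by zero. The
  extension makes the monotonicity condition uniform in \<open>i\<close> and makes a partition
  determined by its rows, so that equality of functions is equality of partitions.
\<close>
definition shapes :: "nat \<Rightarrow> (nat \<Rightarrow> nat) set" where
  "shapes n = {l. (\<forall>i. i \<notin> {1..n} \<longrightarrow> l i = 0) \<and> (\<forall>i\<ge>1. l (Suc i) \<le> l i)}"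

text \<open>
  The partitions that can follow \<open>l\<close>, by the addition of a vertical strip.
\<close>
definition up :: "nat \<Rightarrow> (nat \<Rightarrow> nat) \<Rightarrow> (nat \<Rightarrow> nat) set" where
  "up n l = {l' \<in> shapes n. \<forall>i. l' i = l i \<or> l' i = Suc (l i)}"

definition dtraj :: "nat \<Rightarrow> (nat \<Rightarrow> nat \<Rightarrow> nat) set" where
  "dtraj n = {p. p 0 = (\<lambda>_. 0) \<and> (\<forall>j. p (Suc j) \<in> up n (p j))}"

text \<open>
  A prefix of length \<open>t\<close> is encoded as an infinite sequence that is constant from time
  \<open>t\<close> on. This keeps pointwise maxima and minima of prefixes inside the set, so that the
  lattice operations of the function type can be used.
\<close>
definition dpaths :: "nat \<Rightarrow> nat \<Rightarrow> (nat \<Rightarrow> nat \<Rightarrow> nat) set" where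
  "dpaths n t = {p \<in> dtraj n. \<forall>j\<ge>t. p j = p t}"

definition npaths :: "nat \<Rightarrow> nat \<Rightarrow> (nat \<Rightarrow> nat) \<Rightarrow> nat" where
  "npaths n t l = card {p \<in> dpaths n t. p t = l}"

lemma shapes_zero: "l \<in> shapes n \<Longrightarrow> i \<notin> {1..n} \<Longrightarrow> l i = 0"
  by (simp add: shapes_def)

lemma shapes_Suc_le: "l \<in> shapes n \<Longrightarrow> 1 \<le> i \<Longrightarrow> l (Suc i) \<le> l i"
  by (simp add: shapes_def)

lemma shapes_antimono:
  assumes "l \<in> shapes n" "1 \<le> i" "i \<le> k"
  shows "l k \<le> l i"
  using assms(3)
proof (induction k rule: dec_induct)
  case (step k)
  then show ?case
    using shapes_Suc_le[OF assms(1), of k] assms(2) by simp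
qed simp

lemma dtraj_shapes: "p \<in> dtraj n \<Longrightarrow> p j \<in> shapes n"
  by (cases j) (simp_all add: dtraj_def up_def, simp add: shapes_def)

lemma dtraj_0: "p \<in> dtraj n \<Longrightarrow> p 0 = (\<lambda>_. 0)"
  by (simp add: dtraj_def)

lemma dtraj_up: "p \<in> dtraj n \<Longrightarrow> p (Suc j) \<in> up n (p j)"
  by (simp add: dtraj_def)

lemma dtraj_step: "p \<in> dtraj n \<Longrightarrow> p (Suc j) i = p j i \<or> p (Suc j) i = Suc (p j i)"
  by (simp add: dtraj_def up_def)

lemma dtraj_le: "p \<in> dtraj n \<Longrightarrow> p j i \<le> j"
proof (induction j)
  case (Suc j)
  then show ?case using dtraj_step[of p n j i] by auto
qed (simp add: dtraj_0)

lemma dpaths_dtraj: "p \<in> dpaths n t \<Longrightarrow> p \<in> dtraj n"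
  by (simp add: dpaths_def)

lemma dpaths_frozen: "p \<in> dpaths n t \<Longrightarrow> t \<le> j \<Longrightarrow> p j = p t"
  unfolding dpaths_def by blast

lemma dpathsI:
  "p 0 = (\<lambda>_. 0) \<Longrightarrow> (\<And>j. p (Suc j) \<in> up n (p j)) \<Longrightarrow> (\<And>j. t \<le> j \<Longrightarrow> p j = p t) \<Longrightarrow> p \<in> dpaths n t"
  unfolding dpaths_def dtraj_def by blast

lemma up_refl: "l \<in> shapes n \<Longrightarrow> l \<in> up n l"
  by (simp add: up_def)

lemma dtraj_stop:
  assumes "p \<in> dtraj n"
  shows "(\<lambda>j. p (min j t)) \<in> dpaths n t"
proof -
  have "p (min (Suc j) t) \<in> up n (p (min j t))" for j
    using dtraj_up[OF assms, of j] up_refl[OF dtraj_shapes[OF assms, of t]]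
    by (cases "j < t") (simp_all add: min_def not_less less_Suc_eq_le Suc_le_eq)
  then show ?thesis
    using assms by (simp add: dpaths_def dtraj_def)
qed

lemma dpaths_eqI:
  assumes "p \<in> dpaths n t" "q \<in> dpaths n t" "\<And>j i. j \<le> t \<Longrightarrow> i \<in> {1..n} \<Longrightarrow> p j i = q j i"
  shows "p = q"
proof (intro ext)
  fix j i
  show "p j i = q j i"
    using assms dpaths_frozen[of p n t j] dpaths_frozen[of q n t j]
      shapes_zero[OF dtraj_shapes[OF dpaths_dtraj[OF assms(1)]], of i j]
      shapes_zero[OF dtraj_shapes[OF dpaths_dtraj[OF assms(2)]], of i j]
    by (cases "j \<le> t"; cases "i \<in> {1..n}") auto
qed

text \<open>
  The set of points below the graphs. It turns pointwise maxima into unions and pointwise minima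
  into intersections.
\<close>
definition diagram :: "nat \<Rightarrow> nat \<Rightarrow> (nat \<Rightarrow> nat \<Rightarrow> nat) \<Rightarrow> (nat \<times> nat \<times> nat) set" where
  "diagram n t p = {(j, i, k). j \<le> t \<and> i \<in> {1..n} \<and> k < p j i}"

lemma finite_diagram: "finite (diagram n t p)"
proof -
  have "diagram n t p = (SIGMA j:{..t}. SIGMA i:{1..n}. {..<p j i})"
    by (auto simp: diagram_def)
  then show ?thesis by simp
qed

lemma inj_on_diagram: "inj_on (diagram n t) (dpaths n t)"
proof (rule inj_onI)
  fix p q assume pq: "p \<in> dpaths n t" "q \<in> dpaths n t" and eq: "diagram n t p = diagram n t q"
  show "p = q"
  proof (rule dpaths_eqI[OF pq])
    fix j i assume "j \<le> t" "i \<in> {1..n}"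
    then have "{..<p j i} = {..<q j i}"
      using eq by (auto simp: diagram_def set_eq_iff)
    then show "p j i = q j i" by simp
  qed
qed

lemma finite_dpaths: "finite (dpaths n t)"
proof (rule finite_imageD[OF _ inj_on_diagram])
  have "diagram n t ` dpaths n t \<subseteq> Pow ({..t} \<times> {1..n} \<times> {..<t})"
    by (auto simp: diagram_def dest!: dpaths_dtraj intro: order.strict_trans2 dtraj_le order.trans)
  then show "finite (diagram n t ` dpaths n t)"
    by (rule finite_subset) auto
qed

lemma shapes_sup: "a \<in> shapes n \<Longrightarrow> b \<in> shapes n \<Longrightarrow> sup a b \<in> shapes n"
  unfolding shapes_def by (auto simp: sup_nat_def intro!: max.mono)

lemma shapes_inf: "a \<in> shapes n \<Longrightarrow> b \<in> shapes n \<Longrightarrow> inf a b \<in> shapes n"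
  unfolding shapes_def by (auto simp: inf_nat_def intro!: min.mono)

text \<open>
  If both arguments take a step in \<open>{0, 1}\<close>, then so does their maximum: when the
  larger one stays, the smaller one can reach it but not pass it. The minimum behaves in the same
  way.
\<close>
lemma up_sup:
  assumes "a' \<in> up n a" "b' \<in> up n b"
  shows "sup a' b' \<in> up n (sup a b)"
proof -
  have "max (a' i) (b' i) = max (a i) (b i) \<or> max (a' i) (b' i) = Suc (max (a i) (b i))" for i
  proof -
    have "a' i = a i \<or> a' i = Suc (a i)" "b' i = b i \<or> b' i = Suc (b i)"
      using assms by (auto simp: up_def)
    then show ?thesis by linarith
  qed
  then show ?thesis
    using shapes_sup[of a' n b'] assms by (simp add: up_def sup_nat_def)
qed

lemma up_inf:
  assumes "a' \<in> up n a" "b' \<in> up n b"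
  shows "inf a' b' \<in> up n (inf a b)"
proof -
  have "min (a' i) (b' i) = min (a i) (b i) \<or> min (a' i) (b' i) = Suc (min (a i) (b i))" for i
  proof -
    have "a' i = a i \<or> a' i = Suc (a i)" "b' i = b i \<or> b' i = Suc (b i)"
      using assms by (auto simp: up_def)
    then show ?thesis by linarith
  qed
  then show ?thesis
    using shapes_inf[of a' n b'] assms by (simp add: up_def inf_nat_def)
qed

lemma dpaths_sup:
  assumes p: "p \<in> dpaths n t" and q: "q \<in> dpaths n t"
  shows "sup p q \<in> dpaths n t"
proof (rule dpathsI)
  show "sup p q 0 = (\<lambda>_. 0)"
    by (simp add: dtraj_0[OF dpaths_dtraj[OF p]] dtraj_0[OF dpaths_dtraj[OF q]])
  show "sup p q (Suc j) \<in> up n (sup p q j)" for j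
    using up_sup[OF dtraj_up[OF dpaths_dtraj[OF p]] dtraj_up[OF dpaths_dtraj[OF q]]] by simp
  show "sup p q j = sup p q t" if "t \<le> j" for j
    using dpaths_frozen[OF p that] dpaths_frozen[OF q that] by simp
qed

lemma dpaths_inf:
  assumes p: "p \<in> dpaths n t" and q: "q \<in> dpaths n t"
  shows "inf p q \<in> dpaths n t"
proof (rule dpathsI)
  show "inf p q 0 = (\<lambda>_. 0)"
    by (simp add: dtraj_0[OF dpaths_dtraj[OF p]] dtraj_0[OF dpaths_dtraj[OF q]])
  show "inf p q (Suc j) \<in> up n (inf p q j)" for j
    using up_inf[OF dtraj_up[OF dpaths_dtraj[OF p]] dtraj_up[OF dpaths_dtraj[OF q]]] by simp
  show "inf p q j = inf p q t" if "t \<le> j" for j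
    using dpaths_frozen[OF p that] dpaths_frozen[OF q that] by simp
qed

text \<open>
  Divided by the two numbers of paths, this says that under the uniform law the event
  \<open>l \<le> p s\<close> has larger probability for the endpoint \<open>y\<close> than for the
  endpoint \<open>x\<close>. Take \<open>A\<close> to be the paths to \<open>x\<close> in the event
  and \<open>B\<close> all paths to \<open>y\<close>: a join is a path to \<open>y\<close> in the
  event, a meet is a path to \<open>x\<close>.
\<close>
lemma paths_stochastically_increasing:
  assumes "x \<le> y"
  shows "card {p \<in> dpaths n t. p t = x \<and> l \<le> p s} * npaths n t y
       \<le> card {p \<in> dpaths n t. p t = y \<and> l \<le> p s} * npaths n t x"
  unfolding npaths_def
proof (rule daykin[where \<phi> = "diagram n t"])
  show "inj_on (diagram n t) {p \<in> dpaths n t. p t = x \<and> l \<le> p s}"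
    "inj_on (diagram n t) {p \<in> dpaths n t. p t = y}"
    by (rule inj_on_subset[OF inj_on_diagram]; blast)+
  show "diagram n t (sup a b) = diagram n t a \<union> diagram n t b" for a b
    by (auto simp: diagram_def sup_nat_def)
  show "diagram n t (inf a b) = diagram n t a \<inter> diagram n t b" for a b
    by (auto simp: diagram_def inf_nat_def)
  fix p q assume p: "p \<in> {p \<in> dpaths n t. p t = x \<and> l \<le> p s}" and q: "q \<in> {p \<in> dpaths n t. p t = y}"
  show "sup p q \<in> {p \<in> dpaths n t. p t = y \<and> l \<le> p s}"
    using p q assms by (auto simp: dpaths_sup sup_absorb2 le_supI1)
  show "inf p q \<in> {p \<in> dpaths n t. p t = x}"
    using p q assms by (auto simp: dpaths_inf inf_absorb1)
qed (auto simp: finite_dpaths finite_diagram)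

lemma dtraj_count_steps:
  "p \<in> dtraj n \<Longrightarrow> card {j. j < t \<and> p (Suc j) i = Suc (p j i)} = p t i"
proof (induction t)
  case 0
  then show ?case by (simp add: dtraj_0)
next
  case (Suc t)
  have *: "{j. j < Suc t \<and> p (Suc j) i = Suc (p j i)} =
    (if p (Suc t) i = Suc (p t i) then insert t {j. j < t \<and> p (Suc j) i = Suc (p j i)}
     else {j. j < t \<and> p (Suc j) i = Suc (p j i)})"
    by (auto simp: less_Suc_eq)
  show ?case
    unfolding * using Suc dtraj_step[OF Suc.prems, of t i] by auto
qed

text \<open>
  A path is determined by the sets of times at which its components step. Dropping the
  requirement that the components be ordered leaves the product of binomial coefficients.
\<close>
lemma npaths_le_prod_binomial: "npaths n t l \<le> (\<Prod>i\<in>{1..n}. t choose l i)"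
proof -
  define \<psi> where "\<psi> = (\<lambda>p::nat \<Rightarrow> nat \<Rightarrow> nat. \<lambda>i\<in>{1..n}. {j. j < t \<and> p (Suc j) i = Suc (p j i)})"
  have inj: "inj_on \<psi> {p \<in> dpaths n t. p t = l}"
  proof (rule inj_onI, rule dpaths_eqI)
    fix p q j i
    assume p: "p \<in> {p \<in> dpaths n t. p t = l}" and q: "q \<in> {p \<in> dpaths n t. p t = l}"
      and eq: "\<psi> p = \<psi> q" and j: "j \<le> t" and i: "i \<in> {1..n}"
    have "{j. j < t \<and> p (Suc j) i = Suc (p j i)} = {j. j < t \<and> q (Suc j) i = Suc (q j i)}"
      using fun_cong[OF eq, of i] i by (simp add: \<psi>_def)
    then have "{k. k < j \<and> p (Suc k) i = Suc (p k i)} = {k. k < j \<and> q (Suc k) i = Suc (q k i)}"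
      using j by (simp add: set_eq_iff) (meson order.strict_trans2)
    then show "p j i = q j i"
      using p q dtraj_count_steps[OF dpaths_dtraj, of p n t j i] dtraj_count_steps[OF dpaths_dtraj, of q n t j i]
      by simp
  qed auto
  have sub: "\<psi> ` {p \<in> dpaths n t. p t = l} \<subseteq> (\<Pi>\<^sub>E i\<in>{1..n}. {S. S \<subseteq> {..<t} \<and> card S = l i})"
    using dtraj_count_steps[OF dpaths_dtraj] by (auto simp: \<psi>_def)
  have fin: "finite (\<Pi>\<^sub>E i\<in>{1..n}. {S. S \<subseteq> {..<t} \<and> card S = l i})"
    by (intro finite_PiE) auto
  show ?thesis
    using card_mono[OF fin sub] unfolding card_image[OF inj] by (simp add: npaths_def card_PiE n_subsets)
qed

section \<open>Schur weights\<close>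

text \<open>
  The partitions \<open>m\<close> with \<open>n\<close> rows that interlace with \<open>l\<close>:
  these are the possible predecessors of \<open>l\<close> in the branching of Schur polynomials from
  \<open>n + 1\<close> to \<open>n\<close> variables.
\<close>
definition interlacing :: "nat \<Rightarrow> (nat \<Rightarrow> nat) \<Rightarrow> (nat \<Rightarrow> nat) set" where
  "interlacing n l = {m. (\<forall>i. i \<notin> {1..n} \<longrightarrow> m i = 0) \<and> (\<forall>i\<in>{1..n}. l (Suc i) \<le> m i \<and> m i \<le> l i)}"

definition boxes :: "nat \<Rightarrow> (nat \<Rightarrow> nat) \<Rightarrow> nat" where
  "boxes n l = (\<Sum>i=1..n. l i)"

text \<open>
  For \<open>r \<le> t\<close>, the probability of a given word with \<open>r\<close> ones under \<open>t\<close> independent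
  Bernoulli trials. If \<open>x < 1\<close>, this is \<open>y^r * (1 - x)^t\<close> with
  \<open>y = x / (1 - x)\<close>.
\<close>
definition bern :: "real \<Rightarrow> nat \<Rightarrow> nat \<Rightarrow> real" where
  "bern x t r = x ^ r * (1 - x) ^ (t - r)"

text \<open>
  For \<open>l 1 \<le> t\<close>, the Schur polynomial of \<open>l\<close> at \<open>y_i = d_i / (1 - d_i)\<close>, multiplied by
  \<open>prod (1 - d_i)^t\<close>, expanded by the branching rule: the last variable occurs with
  exponent \<open>|l| - |m|\<close>, and its share of the prefactor turns the power of
  \<open>y_i\<close> into a Bernoulli word probability. No division by \<open>1 - d_i\<close> is left.
\<close>
fun weight :: "(nat \<Rightarrow> real) \<Rightarrow> nat \<Rightarrow> nat \<Rightarrow> (nat \<Rightarrow> nat) \<Rightarrow> real" where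
  "weight d 0 t l = 1"
| "weight d (Suc n) t l =
     (\<Sum>m\<in>interlacing n l. weight d n t m * bern (d (Suc n)) t (boxes (Suc n) l - boxes n m))"

lemma bern_split: "r \<le> t \<Longrightarrow> bern x t r = bern x (Suc t) r + bern x (Suc t) (Suc r)"
  by (simp add: bern_def Suc_diff_le algebra_simps)

lemma bern_nonneg: "x \<in> {0..1} \<Longrightarrow> 0 \<le> bern x t r"
  by (simp add: bern_def)

lemma interlacing_le: "m \<in> interlacing n l \<Longrightarrow> i \<in> {1..n} \<Longrightarrow> m i \<le> l i"
  by (simp add: interlacing_def)

lemma le_interlacing: "m \<in> interlacing n l \<Longrightarrow> i \<in> {1..n} \<Longrightarrow> l (Suc i) \<le> m i"
  by (simp add: interlacing_def)

lemma finite_bounded: "finite {m :: nat \<Rightarrow> nat. (\<forall>i. i \<notin> {1..n} \<longrightarrow> m i = 0) \<and> (\<forall>i\<in>{1..n}. m i \<le> N)}"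
  using finite_set_of_finite_funs[of "{1..n}" "{..N}" 0]
  by (rule finite_subset[rotated]) auto

lemma card_bounded:
  "card {m :: nat \<Rightarrow> nat. (\<forall>i. i \<notin> {1..n} \<longrightarrow> m i = 0) \<and> (\<forall>i\<in>{1..n}. m i \<le> t)} \<le> (t + 1) ^ n"
    (is "card ?S \<le> _")
proof -
  have "inj_on (\<lambda>m. restrict m {1..n}) ?S"
  proof (rule inj_onI, rule ext)
    fix m m' i assume m: "m \<in> ?S" "m' \<in> ?S" and e: "restrict m {1..n} = restrict m' {1..n}"
    show "m i = m' i"
      using m fun_cong[OF e, of i] by (cases "i \<in> {1..n}") simp_all
  qed
  moreover have "(\<lambda>m. restrict m {1..n}) ` ?S \<subseteq> ({1..n} \<rightarrow>\<^sub>E {..t})"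
    by auto
  ultimately have "card ?S \<le> card ({1..n} \<rightarrow>\<^sub>E {..t})"
    by (intro card_inj_on_le) (auto intro: finite_PiE)
  then show ?thesis
    by (simp add: card_PiE)
qed

lemma finite_interlacing: "finite (interlacing n l)"
proof (rule finite_subset[OF _ finite_bounded[of n "boxes n l"]])
  have "l i \<le> boxes n l" if "i \<in> {1..n}" for i
    unfolding boxes_def using that by (intro member_le_sum) auto
  then show "interlacing n l \<subseteq> {m. (\<forall>i. i \<notin> {1..n} \<longrightarrow> m i = 0) \<and> (\<forall>i\<in>{1..n}. m i \<le> boxes n l)}"
    unfolding interlacing_def using order.trans by blast
qed

lemma finite_up: "finite (up n l)"
proof (rule finite_subset[OF _ finite_bounded[of n "Suc (boxes n l)"]])
  have "l i \<le> boxes n l" if "i \<in> {1..n}" for i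
    unfolding boxes_def using that by (intro member_le_sum) auto
  moreover have "l' i \<le> Suc (l i)" if "l' \<in> up n l" for l' i
    using that unfolding up_def by (metis (mono_tags, lifting) le_SucI mem_Collect_eq order_refl)
  ultimately have "l' i \<le> Suc (boxes n l)" if "l' \<in> up n l" "i \<in> {1..n}" for l' i
    using that by (meson Suc_le_mono order.trans)
  then show "up n l \<subseteq> {m. (\<forall>i. i \<notin> {1..n} \<longrightarrow> m i = 0) \<and> (\<forall>i\<in>{1..n}. m i \<le> Suc (boxes n l))}"
    unfolding up_def shapes_def by blast
qed

lemma shapesI:
  assumes "\<And>i. i \<notin> {1..n} \<Longrightarrow> l i = 0" "\<And>i. 1 \<le> i \<Longrightarrow> i < n \<Longrightarrow> l (Suc i) \<le> l i"
  shows "l \<in> shapes n"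
proof -
  have "l (Suc i) \<le> l i" if "1 \<le> i" for i
    using assms(1)[of "Suc i"] assms(2)[OF that] by (cases "i < n") auto
  then show ?thesis
    using assms(1) unfolding shapes_def by blast
qed

lemma interlacing_shapes: "m \<in> interlacing n l \<Longrightarrow> m \<in> shapes n"
proof (rule shapesI)
  fix i assume m: "m \<in> interlacing n l" and i: "1 \<le> i" "i < n"
  then have "m (Suc i) \<le> l (Suc i)" "l (Suc i) \<le> m i"
    by (auto simp: interlacing_def)
  then show "m (Suc i) \<le> m i" by simp
qed (auto simp: interlacing_def)

lemma boxes_Suc: "boxes (Suc n) l = boxes n l + l (Suc n)"
  by (simp add: boxes_def)

lemma boxes_shift: "boxes (Suc n) l = l 1 + (\<Sum>i=1..n. l (Suc i))"
  by (induction n) (simp_all add: boxes_def)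

text \<open>
  The skew diagram of \<open>m\<close> in \<open>l\<close> is a horizontal strip, so it has at most
  \<open>l 1\<close> boxes. This keeps the exponents of \<open>bern\<close> within range.
\<close>
lemma boxes_interlacing:
  assumes "m \<in> interlacing n l"
  shows "boxes n m \<le> boxes (Suc n) l" "boxes (Suc n) l \<le> l 1 + boxes n m"
proof -
  have "boxes n m \<le> boxes n l"
    unfolding boxes_def using assms by (intro sum_mono) (auto simp: interlacing_def)
  then show "boxes n m \<le> boxes (Suc n) l"
    by (simp add: boxes_Suc)
  have "(\<Sum>i=1..n. l (Suc i)) \<le> boxes n m"
    unfolding boxes_def using assms by (intro sum_mono) (auto simp: interlacing_def)
  then show "boxes (Suc n) l \<le> l 1 + boxes n m"
    by (simp add: boxes_shift)
qed

text \<open>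
  Pascal's rule, applied to a sum over subsets that is weighted by a function of their size. As only
  sizes matter, the smaller ground set may be taken to be the larger one without one point.
\<close>
lemma sum_Pow_card_Suc:
  fixes h :: "nat \<Rightarrow> real"
  assumes "finite A" "finite B" "card A = Suc (card B)"
  shows "(\<Sum>F\<in>Pow A. h (card F)) = (\<Sum>F\<in>Pow B. h (card F) + h (Suc (card F)))"
proof -
  obtain a A' where A: "A = insert a A'" "a \<notin> A'" "card A' = card B" "finite A'"
    using assms by (metis card_Suc_eq finite_insert)
  obtain f where f: "bij_betw f A' B"
    using A assms finite_same_card_bij by metis
  have "(\<Sum>F\<in>Pow B. h (card F) + h (Suc (card F)))
      = (\<Sum>F\<in>Pow A'. h (card (f ` F)) + h (Suc (card (f ` F))))"
    by (rule sum.reindex_bij_betw[OF bij_betw_Pow[OF f], symmetric])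
  also have "\<dots> = (\<Sum>F\<in>Pow A'. h (card F) + h (card (insert a F)))"
  proof (intro sum.cong refl)
    fix F assume "F \<in> Pow A'"
    then have "card (f ` F) = card F" "finite F" "a \<notin> F"
      using f A by (auto intro!: card_image intro: inj_on_subset finite_subset simp: bij_betw_def)
    then show "h (card (f ` F)) + h (Suc (card (f ` F))) = h (card F) + h (card (insert a F))"
      by simp
  qed
  also have "\<dots> = (\<Sum>F\<in>Pow A. h (card F))"
    unfolding A(1) by (rule sum_Pow_insert[OF A(4,2), symmetric])
  finally show ?thesis by simp
qed

lemma boxes_add: "F \<subseteq> {1..n} \<Longrightarrow> boxes n (\<lambda>i. l i + of_bool (i \<in> F)) = boxes n l + card F"
  unfolding boxes_def by (simp add: sum.distrib Int_absorb1)

text \<open>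
  The local form of the Pieri rule. On the left one first adds boxes to \<open>l\<close> and then
  passes to an interlacing \<open>m'\<close>; on the right one first passes to an interlacing
  \<open>m\<close> and then adds boxes to reach \<open>m'\<close>. In both sums some rows are forced
  to receive a box, some are forbidden to, and the others are free. The forced rows are the same on
  both sides, the numbers of forbidden rows agree, and the left side has one more free row since it
  has one more row. As only the number of added boxes matters, \<open>sum_Pow_card_Suc\<close> gives the
  identity.
\<close>
lemma interlacing_exchange:
  fixes g :: "nat \<Rightarrow> real"
  assumes l: "l \<in> shapes (Suc n)" and m': "m' \<in> shapes n"
  shows "(\<Sum>l'\<in>{l'\<in>up (Suc n) l. m' \<in> interlacing n l'}. g (boxes (Suc n) l' - boxes (Suc n) l))
       = (\<Sum>m\<in>{m\<in>interlacing n l. m' \<in> up n m}. g (boxes n m' - boxes n m) + g (Suc (boxes n m' - boxes n m)))"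
proof (cases "\<forall>i\<in>{1..n}. l (Suc i) \<le> m' i \<and> m' i \<le> Suc (l i)")
  case False
  then obtain i where i: "i \<in> {1..n}" "\<not> (l (Suc i) \<le> m' i \<and> m' i \<le> Suc (l i))" by blast
  have "m' \<notin> interlacing n l'" if "l' \<in> up (Suc n) l" for l'
  proof
    assume "m' \<in> interlacing n l'"
    then have "l' (Suc i) \<le> m' i" "m' i \<le> l' i" using i(1) by (auto simp: interlacing_def)
    moreover have "l (Suc i) \<le> l' (Suc i)" "l' i \<le> Suc (l i)"
      using that unfolding up_def by (metis (mono_tags, lifting) le_SucI mem_Collect_eq order_refl)+
    ultimately show False using i(2) by simp
  qed
  then have 1: "{l'\<in>up (Suc n) l. m' \<in> interlacing n l'} = {}" by blast
  have "m' \<notin> up n m" if "m \<in> interlacing n l" for m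
  proof
    assume "m' \<in> up n m"
    then have "m' i = m i \<or> m' i = Suc (m i)" by (simp add: up_def)
    moreover have "l (Suc i) \<le> m i" "m i \<le> l i" using that i(1) by (auto simp: interlacing_def)
    ultimately show False using i(2) by auto
  qed
  then have 2: "{m\<in>interlacing n l. m' \<in> up n m} = {}" by blast
  show ?thesis unfolding 1 2 by simp
next
  case True
  \<comment> \<open>Rows in \<open>L\<close> must receive a box in both sums. A row in \<open>V\<close> must not
    receive one when passing from \<open>m\<close> to \<open>m'\<close>; on the other side this becomes
    the row after it.\<close>
  define L where "L = {i\<in>{1..n}. m' i = Suc (l i)}"
  define V where "V = {i\<in>{1..n}. m' i = l (Suc i)}"
  define A where "A = {1..Suc n} - L - Suc ` V"
  define B where "B = {1..n} - L - V"
  let ?add = "\<lambda>F i. l i + of_bool (i \<in> L \<union> F)" and ?sub = "\<lambda>F i. m' i - of_bool (i \<in> L \<union> F)"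
  have LV: "L \<inter> V = {}"
  proof -
    have "l (Suc i) \<le> l i" if "i \<in> {1..n}" for i
      using shapes_Suc_le[OF l] that by simp
    then show ?thesis by (force simp: L_def V_def)
  qed
  have LU: "L \<inter> Suc ` V = {}"
  proof -
    have False if "i \<in> V" "Suc i \<in> L" for i
    proof -
      have "m' (Suc i) \<le> m' i"
        using that shapes_Suc_le[OF m', of i] by (simp add: V_def)
      then show False using that by (simp add: V_def L_def)
    qed
    then show ?thesis by blast
  qed
  have fin: "finite L" "finite V" by (auto simp: L_def V_def)
  have cA: "card A = Suc n - card L - card V"
  proof -
    have "card A = card ({1..Suc n} - (L \<union> Suc ` V))"
      by (simp add: A_def Diff_eq Int_assoc)
    also have "\<dots> = card {1..Suc n} - card (L \<union> Suc ` V)"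
      by (rule card_Diff_subset) (auto simp: L_def V_def)
    also have "card (L \<union> Suc ` V) = card L + card V"
      using LU fin by (simp add: card_Un_disjoint card_image)
    finally show ?thesis by simp
  qed
  have LVn: "card L + card V \<le> n"
  proof -
    have "card L + card V = card (L \<union> V)"
      using card_Un_disjoint[OF fin LV] by simp
    also have "\<dots> \<le> card {1..n}"
      by (rule card_mono) (auto simp: L_def V_def)
    finally show ?thesis by simp
  qed
  have cB: "card B = n - card L - card V"
  proof -
    have "card B = card ({1..n} - (L \<union> V))"
      by (simp add: B_def Diff_eq Int_assoc)
    also have "\<dots> = card {1..n} - card (L \<union> V)"
      by (rule card_Diff_subset) (auto simp: L_def V_def)
    also have "card (L \<union> V) = card L + card V"
      using LV fin by (simp add: card_Un_disjoint)
    finally show ?thesis by simp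
  qed
  have AB: "card A = Suc (card B)"
    using cA cB LVn by simp
  have finAB: "finite A" "finite B" by (auto simp: A_def B_def)
  have Fin: "finite F" "F \<inter> L = {}" if "F \<subseteq> A" for F
    using that finite_subset[OF that finAB(1)] unfolding A_def by blast+
  have FinB: "finite F" "F \<inter> L = {}" if "F \<subseteq> B" for F
    using that finite_subset[OF that finAB(2)] unfolding B_def by blast+
  have "(\<Sum>F\<in>Pow A. g (card L + card F))
      = (\<Sum>l'\<in>{l'\<in>up (Suc n) l. m' \<in> interlacing n l'}. g (boxes (Suc n) l' - boxes (Suc n) l))"
  proof (rule sum.reindex_bij_witness[where j = "\<lambda>F i. l i + of_bool (i \<in> L \<union> F)"
        and i = "\<lambda>l'. {i\<in>A. l' i = Suc (l i)}"])
    fix F assume "F \<in> Pow A"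
    then have F: "F \<subseteq> A" by simp
    show "{i \<in> A. l i + of_bool (i \<in> L \<union> F) = Suc (l i)} = F"
      using F by (auto simp: A_def)
    have sub: "L \<union> F \<subseteq> {1..Suc n}"
      using F by (auto simp: A_def L_def)
    have b: "m' \<in> interlacing n (?add F)"
      unfolding interlacing_def
    proof (intro CollectI conjI allI impI ballI)
      show "m' i = 0" if "i \<notin> {1..n}" for i
        using shapes_zero[OF m' that] .
      fix i assume i: "i \<in> {1..n}"
      show "m' i \<le> l i + of_bool (i \<in> L \<union> F)"
        using True i by (cases "m' i = Suc (l i)") (auto simp: L_def le_Suc_eq)
      show "l (Suc i) + of_bool (Suc i \<in> L \<union> F) \<le> m' i"
      proof (cases "m' i = l (Suc i)")
        case True
        then have "Suc i \<in> Suc ` V" using i by (simp add: V_def)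
        then have "Suc i \<notin> L \<union> F" using LU F by (auto simp: A_def)
        then show ?thesis using True by simp
      next
        case False
        then have "l (Suc i) < m' i" using \<open>\<forall>i\<in>{1..n}. _\<close> i by (simp add: order_less_le)
        then show ?thesis by simp
      qed
    qed
    have "(?add F) \<in> shapes (Suc n)"
    proof (rule shapesI)
      fix i assume "i \<notin> {1..Suc n}"
      then show "l i + of_bool (i \<in> L \<union> F) = 0"
        using shapes_zero[OF l, of i] sub by auto
    next
      fix i assume "1 \<le> i" "i < Suc n"
      then show "l (Suc i) + of_bool (Suc i \<in> L \<union> F) \<le> l i + of_bool (i \<in> L \<union> F)"
        using interlacing_le[OF b, of i] le_interlacing[OF b, of i] by (meson atLeastAtMost_iff less_Suc_eq_le order.trans)
    qed
    then show "(?add F) \<in> {l' \<in> up (Suc n) l. m' \<in> interlacing n l'}"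
      using b by (simp add: up_def)
    have "boxes (Suc n) (?add F) = boxes (Suc n) l + card (L \<union> F)"
      by (rule boxes_add[OF sub])
    also have "card (L \<union> F) = card L + card F"
      using Fin[OF F] fin by (intro card_Un_disjoint) auto
    finally show "g (boxes (Suc n) (?add F) - boxes (Suc n) l) = g (card L + card F)"
      by simp
  next
    fix l' assume "l' \<in> {l' \<in> up (Suc n) l. m' \<in> interlacing n l'}"
    then have l': "l' \<in> shapes (Suc n)" "\<And>i. l' i = l i \<or> l' i = Suc (l i)" and b: "m' \<in> interlacing n l'"
      by (auto simp: up_def)
    show "{i \<in> A. l' i = Suc (l i)} \<in> Pow A" by auto
    show "(\<lambda>i. l i + of_bool (i \<in> L \<union> {i \<in> A. l' i = Suc (l i)})) = l'"
    proof
      fix i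
      consider "i \<in> L" | "i \<in> Suc ` V" | "i \<notin> {1..Suc n}" | "i \<in> A" by (auto simp: A_def)
      then show "l i + of_bool (i \<in> L \<union> {i \<in> A. l' i = Suc (l i)}) = l' i"
      proof cases
        case 1
        then have "m' i \<le> l' i" "m' i = Suc (l i)"
          using interlacing_le[OF b, of i] 1 by (auto simp: L_def)
        then show ?thesis using 1 l'(2)[of i] by auto
      next
        case 2
        then obtain k where k: "i = Suc k" "k \<in> V" by blast
        then have "l' i \<le> m' k" "m' k = l i"
          using le_interlacing[OF b, of k] by (auto simp: V_def)
        then show ?thesis using 2 LU l'(2)[of i] by (auto simp: A_def)
      next
        case 3
        then have "i \<notin> L" "i \<notin> A" by (auto simp: L_def A_def)
        then show ?thesis using shapes_zero[OF l 3] shapes_zero[OF l'(1) 3] by simp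
      next
        case 4
        then show ?thesis using l'(2)[of i] by (auto simp: A_def)
      qed
    qed
  qed
  moreover have "(\<Sum>F\<in>Pow B. g (card L + card F) + g (Suc (card L + card F)))
      = (\<Sum>m\<in>{m\<in>interlacing n l. m' \<in> up n m}. g (boxes n m' - boxes n m) + g (Suc (boxes n m' - boxes n m)))"
  proof (rule sum.reindex_bij_witness[where j = "\<lambda>F i. m' i - of_bool (i \<in> L \<union> F)"
        and i = "\<lambda>m. {i\<in>B. m' i = Suc (m i)}"])
    fix F assume "F \<in> Pow B"
    then have F: "F \<subseteq> B" by simp
    have pos: "0 < m' i" if "i \<in> L \<union> F" for i
      using that F True by (force simp: L_def B_def V_def)
    have sub: "L \<union> F \<subseteq> {1..n}"
      using F by (auto simp: B_def L_def)
    have eq: "(m' i - of_bool (i \<in> L \<union> F)) + of_bool (i \<in> L \<union> F) = m' i" for i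
      using pos[of i] by auto
    show "{i \<in> B. m' i = Suc (m' i - of_bool (i \<in> L \<union> F))} = F"
      using F pos by (auto simp: B_def)
    have b: "(?sub F) \<in> interlacing n l"
      unfolding interlacing_def
    proof (intro CollectI conjI allI impI ballI)
      show "m' i - of_bool (i \<in> L \<union> F) = 0" if "i \<notin> {1..n}" for i
        using shapes_zero[OF m' that] by simp
      fix i assume i: "i \<in> {1..n}"
      show "m' i - of_bool (i \<in> L \<union> F) \<le> l i"
      proof (cases "i \<in> L")
        case False
        then have "m' i \<le> l i"
          using bspec[OF True i] i by (simp add: L_def le_Suc_eq)
        then show ?thesis
          by (meson diff_le_self order.trans)
      qed (simp add: L_def)
      show "l (Suc i) \<le> m' i - of_bool (i \<in> L \<union> F)"
      proof (cases "m' i = l (Suc i)")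
        case True
        then have "i \<in> V" using i by (simp add: V_def)
        then have "i \<notin> L \<union> F" using LV F by (auto simp: B_def)
        then show ?thesis using True by simp
      next
        case False
        then have "l (Suc i) < m' i" using \<open>\<forall>i\<in>{1..n}. _\<close> i by (simp add: order_less_le)
        then show ?thesis by auto
      qed
    qed
    have "m' i = m' i - of_bool (i \<in> L \<union> F) \<or> m' i = Suc (m' i - of_bool (i \<in> L \<union> F))" for i
      using pos[of i] by auto
    then have "m' \<in> up n (?sub F)"
      using m' unfolding up_def by blast
    then show "(?sub F) \<in> {m \<in> interlacing n l. m' \<in> up n m}"
      using b by simp
    have "boxes n m' = boxes n (?sub F) + card (L \<union> F)"
      using boxes_add[OF sub, of "?sub F"] unfolding eq .
    also have "card (L \<union> F) = card L + card F"
      using FinB[OF F] fin by (intro card_Un_disjoint) auto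
    finally have "boxes n m' - boxes n (?sub F) = card L + card F"
      by simp
    then show "g (boxes n m' - boxes n (?sub F)) +
        g (Suc (boxes n m' - boxes n (?sub F))) =
        g (card L + card F) + g (Suc (card L + card F))"
      by simp
  next
    fix m assume "m \<in> {m \<in> interlacing n l. m' \<in> up n m}"
    then have b: "m \<in> interlacing n l" and st: "\<And>i. m' i = m i \<or> m' i = Suc (m i)"
      by (auto simp: up_def)
    show "{i \<in> B. m' i = Suc (m i)} \<in> Pow B" by auto
    show "(\<lambda>i. m' i - of_bool (i \<in> L \<union> {i \<in> B. m' i = Suc (m i)})) = m"
    proof
      fix i
      consider "i \<in> L" | "i \<in> V" | "i \<notin> {1..n}" | "i \<in> B" by (auto simp: B_def)
      then show "m' i - of_bool (i \<in> L \<union> {i \<in> B. m' i = Suc (m i)}) = m i"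
      proof cases
        case 1
        then have "m i \<le> l i" "m' i = Suc (l i)"
          using interlacing_le[OF b, of i] 1 by (auto simp: L_def)
        then show ?thesis using 1 st[of i] by auto
      next
        case 2
        then have "l (Suc i) \<le> m i" "m' i = l (Suc i)"
          using le_interlacing[OF b, of i] 2 by (auto simp: V_def)
        then show ?thesis using 2 LV st[of i] by (auto simp: B_def)
      next
        case 3
        then have "i \<notin> L" "i \<notin> B" by (auto simp: L_def B_def)
        then show ?thesis using shapes_zero[OF m' 3] shapes_zero[OF interlacing_shapes[OF b] 3] by simp
      next
        case 4
        then show ?thesis using st[of i] by (auto simp: B_def)
      qed
    qed
  qed
  moreover have "(\<Sum>F\<in>Pow A. g (card L + card F)) = (\<Sum>F\<in>Pow B. g (card L + card F) + g (Suc (card L + card F)))"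
    using sum_Pow_card_Suc[OF finAB AB, of "\<lambda>k. g (card L + k)"] by simp
  ultimately show ?thesis by simp
qed

lemma weight_nonneg:
  assumes "\<And>i. i \<in> {1..n} \<Longrightarrow> d i \<in> {0..1}"
  shows "0 \<le> weight d n t l"
  using assms
proof (induction n arbitrary: l)
  case (Suc n)
  have "0 \<le> weight d n t m" for m
    using Suc.prems by (intro Suc.IH) auto
  moreover have "0 \<le> bern (d (Suc n)) t r" for r
    using Suc.prems[of "Suc n"] by (intro bern_nonneg) auto
  ultimately show ?case
    by (auto intro!: sum_nonneg mult_nonneg_nonneg)
qed simp

text \<open>
  The weight is a polynomial in the slopes; this is what allows the comparison with perturbed slopes
  to be taken to the limit, including slopes 0 and 1 and coinciding slopes.
\<close>
lemma weight_tendsto: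
  assumes "\<And>i. i \<in> {1..n} \<Longrightarrow> ((\<lambda>x. f x i) \<longlongrightarrow> d i) F"
  shows "((\<lambda>x. weight (f x) n t l) \<longlongrightarrow> weight d n t l) F"
  using assms
proof (induction n arbitrary: l)
  case (Suc n)
  have "((\<lambda>x. weight (f x) n t m) \<longlongrightarrow> weight d n t m) F" for m
    using Suc.prems by (intro Suc.IH) auto
  moreover have "((\<lambda>x. bern (f x (Suc n)) t r) \<longlongrightarrow> bern (d (Suc n)) t r) F" for r
    unfolding bern_def using Suc.prems[of "Suc n"] by (intro tendsto_intros) auto
  ultimately show ?case
    by (auto intro!: tendsto_sum tendsto_mult)
qed simp

lemma shapes_0: "shapes 0 = {\<lambda>_. 0}"
  by (auto simp: shapes_def)

lemma up_0: "l \<in> shapes 0 \<Longrightarrow> up 0 l = {l}"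
  by (auto simp: up_def shapes_0)

lemma up_boxes:
  assumes "l' \<in> up n l"
  shows "boxes n l \<le> boxes n l'"
  unfolding boxes_def using assms by (intro sum_mono) (metis (mono_tags, lifting) le_SucI mem_Collect_eq order_refl up_def)

text \<open>
  Pieri's rule. Expand the weights on the right by branching and sum over the intermediate partition
  \<open>m'\<close> last. The local rule \<open>interlacing_exchange\<close> exchanges the order of branching and adding
  boxes, the two terms that it produces combine by \<open>x + (1 - x) = 1\<close>, and what remains
  is the claim for one row less.
\<close>
lemma weight_harmonic:
  assumes "l \<in> shapes n" "l 1 \<le> t"
  shows "weight d n t l = (\<Sum>l'\<in>up n l. weight d n (Suc t) l')"
  using assms
proof (induction n arbitrary: l)
  case 0
  then show ?case by (simp add: up_0)
next
  case (Suc n)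
  let ?x = "d (Suc n)" and ?U = "\<lambda>m'. {l'\<in>up (Suc n) l. m' \<in> interlacing n l'}" and ?V = "\<lambda>m'. {m\<in>interlacing n l. m' \<in> up n m}"
  \<comment> \<open>A finite set that contains every \<open>m'\<close> of interest, so that sums can be exchanged.\<close>
  define R where "R = (\<Union>l'\<in>up (Suc n) l. interlacing n l') \<union> (\<Union>m\<in>interlacing n l. up n m)"
  have R: "finite R"
    by (auto simp: R_def finite_up finite_interlacing)
  have R_shapes: "m' \<in> shapes n" if "m' \<in> R" for m'
    using that by (auto simp: R_def interlacing_shapes) (auto simp: up_def)
  have "(\<Sum>l'\<in>up (Suc n) l. weight d (Suc n) (Suc t) l')
      = (\<Sum>l'\<in>up (Suc n) l. \<Sum>m'\<in>{m'\<in>R. m' \<in> interlacing n l'}.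
           weight d n (Suc t) m' * bern ?x (Suc t) (boxes (Suc n) l' - boxes n m'))"
    by (auto simp: R_def intro!: sum.cong)
  also have "\<dots> = (\<Sum>m'\<in>R. \<Sum>l'\<in>?U m'.
           weight d n (Suc t) m' * bern ?x (Suc t) (boxes (Suc n) l' - boxes n m'))"
    by (rule sum.swap_restrict) (auto simp: R finite_up)
  also have "\<dots> = (\<Sum>m'\<in>R. weight d n (Suc t) m' * (\<Sum>l'\<in>?U m'.
           bern ?x (Suc t) (boxes (Suc n) l + (boxes (Suc n) l' - boxes (Suc n) l) - boxes n m')))"
    unfolding sum_distrib_left by (intro sum.cong refl) (simp add: up_boxes)
  also have "\<dots> = (\<Sum>m'\<in>R. weight d n (Suc t) m' * (\<Sum>m\<in>?V m'.
           bern ?x t (boxes (Suc n) l - boxes n m)))"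
  proof (intro sum.cong refl)
    fix m' assume "m' \<in> R"
    have "(\<Sum>l'\<in>?U m'.
           bern ?x (Suc t) (boxes (Suc n) l + (boxes (Suc n) l' - boxes (Suc n) l) - boxes n m'))
       = (\<Sum>m\<in>?V m'.
           bern ?x (Suc t) (boxes (Suc n) l + (boxes n m' - boxes n m) - boxes n m')
         + bern ?x (Suc t) (boxes (Suc n) l + Suc (boxes n m' - boxes n m) - boxes n m'))"
      by (rule interlacing_exchange[OF Suc.prems(1) R_shapes[OF \<open>m' \<in> R\<close>],
            where g = "\<lambda>k. bern ?x (Suc t) (boxes (Suc n) l + k - boxes n m')"])
    also have "\<dots> = (\<Sum>m\<in>?V m'. bern ?x t (boxes (Suc n) l - boxes n m))"
    proof (intro sum.cong refl)
      fix m assume "m \<in> {m \<in> interlacing n l. m' \<in> up n m}"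
      then have m: "boxes n m \<le> boxes (Suc n) l" "boxes (Suc n) l \<le> l 1 + boxes n m" "boxes n m \<le> boxes n m'"
        using boxes_interlacing[of m n l] up_boxes[of m' n m] by auto
      then have e: "boxes (Suc n) l + (boxes n m' - boxes n m) - boxes n m' = boxes (Suc n) l - boxes n m"
        "boxes (Suc n) l + Suc (boxes n m' - boxes n m) - boxes n m' = Suc (boxes (Suc n) l - boxes n m)"
        and le: "boxes (Suc n) l - boxes n m \<le> t"
        using Suc.prems(2) by auto
      show "bern ?x (Suc t) (boxes (Suc n) l + (boxes n m' - boxes n m) - boxes n m')
         + bern ?x (Suc t) (boxes (Suc n) l + Suc (boxes n m' - boxes n m) - boxes n m') = bern ?x t (boxes (Suc n) l - boxes n m)"
        unfolding e bern_split[OF le] ..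
    qed
    finally show "weight d n (Suc t) m' * (\<Sum>l'\<in>?U m'.
           bern ?x (Suc t) (boxes (Suc n) l + (boxes (Suc n) l' - boxes (Suc n) l) - boxes n m'))
       = weight d n (Suc t) m' * (\<Sum>m\<in>?V m'. bern ?x t (boxes (Suc n) l - boxes n m))"
      by simp
  qed
  also have "\<dots> = (\<Sum>m'\<in>R. \<Sum>m\<in>?V m'.
           weight d n (Suc t) m' * bern ?x t (boxes (Suc n) l - boxes n m))"
    by (simp add: sum_distrib_left)
  also have "\<dots> = (\<Sum>m\<in>interlacing n l. \<Sum>m'\<in>{m'\<in>R. m' \<in> up n m}.
           weight d n (Suc t) m' * bern ?x t (boxes (Suc n) l - boxes n m))"
    by (rule sum.swap_restrict) (auto simp: R finite_interlacing)
  also have "\<dots> = (\<Sum>m\<in>interlacing n l. (\<Sum>m'\<in>up n m. weight d n (Suc t) m') * bern ?x t (boxes (Suc n) l - boxes n m))"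
    unfolding sum_distrib_right by (auto simp: R_def intro!: sum.cong)
  also have "\<dots> = weight d (Suc n) t l"
    unfolding weight.simps
  proof (intro sum.cong refl)
    fix m assume m: "m \<in> interlacing n l"
    have "m 1 \<le> l 1"
      using m interlacing_le[OF m, of 1] by (cases "n = 0") (auto simp: interlacing_def)
    then show "(\<Sum>m'\<in>up n m. weight d n (Suc t) m') * bern ?x t (boxes (Suc n) l - boxes n m)
        = weight d n t m * bern ?x t (boxes (Suc n) l - boxes n m)"
      using Suc.IH[OF interlacing_shapes[OF m]] Suc.prems(2) by simp
  qed
  finally show ?case by simp
qed

text \<open>
  Moving \<open>k\<close> ones from the trials with the smaller success probability to those with
  the larger one changes the probability by the factor
  \<open>(y * (1 - x))^k / (x * (1 - y))^k\<close>, which is at least 1. The statement avoids the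
  quotient since \<open>x\<close> and \<open>y\<close> may be 0 or 1.
\<close>
lemma bern_exchange:
  assumes "0 \<le> x" "x \<le> y" "y \<le> 1" "m + k \<le> t" "b + k \<le> t"
  shows "bern y t m * bern x t (b + k) \<le> bern y t (m + k) * bern x t b"
proof -
  define C where "C = y ^ m * (1 - y) ^ (t - (m + k)) * x ^ b * (1 - x) ^ (t - (b + k))"
  have "t - m = (t - (m + k)) + k" "t - b = (t - (b + k)) + k"
    using assms by auto
  then have p: "(1 - y) ^ (t - m) = (1 - y) ^ (t - (m + k)) * (1 - y) ^ k"
    "(1 - x) ^ (t - b) = (1 - x) ^ (t - (b + k)) * (1 - x) ^ k"
    by (metis power_add)+
  have "bern y t m * bern x t (b + k) = C * ((1 - y) * x) ^ k"
    unfolding bern_def p C_def power_add power_mult_distrib by simp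
  also have "\<dots> \<le> C * (y * (1 - x)) ^ k"
  proof (rule mult_left_mono)
    have "(1 - y) * x \<le> y * (1 - x)"
      using assms by (simp add: algebra_simps)
    then show "((1 - y) * x) ^ k \<le> (y * (1 - x)) ^ k"
      using assms by (intro power_mono) auto
    show "0 \<le> C"
      using assms by (simp add: C_def)
  qed
  also have "\<dots> = bern y t (m + k) * bern x t b"
    unfolding bern_def p C_def power_add power_mult_distrib by simp
  finally show ?thesis .
qed

lemma prod_bern_exchange:
  assumes "finite I" "0 \<le> x" "a + (\<Sum>i\<in>I. l i - m i) \<le> t"
    and "\<And>i. i \<in> I \<Longrightarrow> x \<le> d i \<and> d i \<le> 1 \<and> m i \<le> l i \<and> l i \<le> t"
  shows "(\<Prod>i\<in>I. bern (d i) t (m i)) * bern x t (a + (\<Sum>i\<in>I. l i - m i))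
      \<le> (\<Prod>i\<in>I. bern (d i) t (l i)) * bern x t a"
  using assms
proof (induction I rule: finite_induct)
  case (insert j I)
  let ?P = "\<lambda>l. \<Prod>i\<in>I. bern (d i) t (l i)" and ?S = "\<Sum>i\<in>I. l i - m i"
  have j: "x \<le> d j" "d j \<le> 1" "m j \<le> l j" "l j \<le> t"
    using insert.prems by auto
  have S: "(\<Sum>i\<in>insert j I. l i - m i) = ?S + (l j - m j)"
    using insert.hyps by simp
  have nn: "0 \<le> bern (d i) t r" if "i \<in> insert j I" for i r
    using insert.prems(3)[OF that] \<open>0 \<le> x\<close> by (intro bern_nonneg) auto
  have "(\<Prod>i\<in>insert j I. bern (d i) t (m i)) * bern x t (a + (\<Sum>i\<in>insert j I. l i - m i))
      = ?P m * (bern (d j) t (m j) * bern x t ((a + ?S) + (l j - m j)))"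
    unfolding S using insert.hyps by (simp add: algebra_simps)
  also have "\<dots> \<le> ?P m * (bern (d j) t (m j + (l j - m j)) * bern x t (a + ?S))"
    using j insert.prems S nn by (intro mult_left_mono bern_exchange prod_nonneg) auto
  also have "\<dots> = bern (d j) t (l j) * (?P m * bern x t (a + ?S))"
    using j by simp
  also have "\<dots> \<le> bern (d j) t (l j) * (?P l * bern x t a)"
  proof (intro mult_left_mono insert.IH)
    show "a + ?S \<le> t"
      using insert.prems(2) unfolding S by simp
  qed (use insert.prems nn in auto)
  also have "\<dots> = (\<Prod>i\<in>insert j I. bern (d i) t (l i)) * bern x t a"
    using insert.hyps by simp
  finally show ?case .
qed simp

lemma card_interlacing_le:
  assumes "\<And>i. i \<in> {1..n} \<Longrightarrow> l i \<le> t"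
  shows "card (interlacing n l) \<le> (t + 1) ^ n"
proof (rule order.trans[OF card_mono[OF finite_bounded] card_bounded])
  have "m i \<le> t" if "m \<in> interlacing n l" "i \<in> {1..n}" for m i
    using interlacing_le[OF that] assms[OF that(2)] by simp
  then show "interlacing n l \<subseteq> {m. (\<forall>i. i \<notin> {1..n} \<longrightarrow> m i = 0) \<and> (\<forall>i\<in>{1..n}. m i \<le> t)}"
    by (auto simp: interlacing_def)
qed

text \<open>
  By branching the weight is a sum over chains of interlacing partitions, of which there are at most
  polynomially many in \<open>t\<close>. In each chain the boxes carrying a later variable can
  be given to the earlier rows in which they lie, where the success probability is larger; this
  only increases the summand and ends at the product on the right.
\<close>
lemma weight_le_prod_bern:
  assumes "\<And>i. i \<in> {1..n} \<Longrightarrow> d i \<in> {0..1}" "\<And>i j. i \<in> {1..n} \<Longrightarrow> j \<in> {1..n} \<Longrightarrow> i \<le> j \<Longrightarrow> d j \<le> d i"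
    and "l \<in> shapes n" "l 1 \<le> t"
  shows "weight d n t l \<le> real ((t + 1) ^ (n * n)) * (\<Prod>i=1..n. bern (d i) t (l i))"
  using assms
proof (induction n arbitrary: l)
  case (Suc n)
  let ?x = "d (Suc n)" and ?P = "\<Prod>i=1..Suc n. bern (d i) t (l i)"
  have lt: "l i \<le> t" if "1 \<le> i" for i
    using shapes_antimono[OF Suc.prems(3), of 1 i] that Suc.prems(4) by simp
  have P: "0 \<le> ?P"
    using Suc.prems(1) by (intro prod_nonneg bern_nonneg) auto
  have x: "0 \<le> ?x"
    using Suc.prems(1)[of "Suc n"] by simp
  have "weight d n t m * bern ?x t (boxes (Suc n) l - boxes n m) \<le> real ((t + 1) ^ (n * n)) * ?P"
    if m: "m \<in> interlacing n l" for m
  proof -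
    have m1: "m 1 \<le> t"
    proof (cases "n = 0")
      case False
      then have "m 1 \<le> l 1"
        by (intro interlacing_le[OF m]) simp
      then show ?thesis using lt[of 1] by simp
    qed (use m in \<open>simp add: interlacing_def\<close>)
    have boxes: "boxes (Suc n) l - boxes n m = l (Suc n) + (\<Sum>i=1..n. l i - m i)"
    proof -
      have "(\<Sum>i=1..n. l i - m i) = boxes n l - boxes n m"
        unfolding boxes_def by (rule sum_subtractf_nat) (rule interlacing_le[OF m])
      moreover have "boxes n m \<le> boxes n l"
        unfolding boxes_def by (rule sum_mono) (rule interlacing_le[OF m])
      ultimately show ?thesis by (simp add: boxes_Suc)
    qed
    have "boxes (Suc n) l - boxes n m \<le> t"
      using boxes_interlacing(2)[OF m] lt[of 1] by simp
    then have st: "l (Suc n) + (\<Sum>i=1..n. l i - m i) \<le> t"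
      by (simp add: boxes)
    have "weight d n t m \<le> real ((t + 1) ^ (n * n)) * (\<Prod>i=1..n. bern (d i) t (m i))"
      using Suc.prems m1 by (intro Suc.IH interlacing_shapes[OF m]) auto
    then have "weight d n t m * bern ?x t (boxes (Suc n) l - boxes n m)
       \<le> real ((t + 1) ^ (n * n)) * (\<Prod>i=1..n. bern (d i) t (m i)) * bern ?x t (boxes (Suc n) l - boxes n m)"
      using Suc.prems(1)[of "Suc n"] by (intro mult_right_mono bern_nonneg) auto
    also have "\<dots> = real ((t + 1) ^ (n * n)) *
        ((\<Prod>i=1..n. bern (d i) t (m i)) * bern ?x t (l (Suc n) + (\<Sum>i=1..n. l i - m i)))"
      by (simp add: boxes)
    also have "\<dots> \<le> real ((t + 1) ^ (n * n)) * ((\<Prod>i=1..n. bern (d i) t (l i)) * bern ?x t (l (Suc n)))"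
      using Suc.prems(1,2) interlacing_le[OF m] lt x st
      by (intro mult_left_mono prod_bern_exchange) auto
    finally show ?thesis by simp
  qed
  then have "weight d (Suc n) t l \<le> (\<Sum>m\<in>interlacing n l. real ((t + 1) ^ (n * n)) * ?P)"
    unfolding weight.simps by (intro sum_mono)
  also have "\<dots> = real (card (interlacing n l)) * (real ((t + 1) ^ (n * n)) * ?P)"
    by simp
  also have "\<dots> \<le> real ((t + 1) ^ n) * (real ((t + 1) ^ (n * n)) * ?P)"
    using P lt card_interlacing_le[of n l t] by (intro mult_right_mono mult_nonneg_nonneg) (auto simp del: of_nat_power)
  also have "\<dots> = real ((t + 1) ^ (n + n * n)) * ?P"
    by (simp add: power_add)
  also have "\<dots> \<le> real ((t + 1) ^ (Suc n * Suc n)) * ?P"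
    using P by (intro mult_right_mono of_nat_mono power_increasing) auto
  finally show ?case .
qed simp

section \<open>Passing between paths and their integer values\<close>

text \<open>
  The piecewise linear interpolation of the integer values \<open>q\<close>, meant for nonnegative
  \<open>s\<close>.
\<close>
definition plin :: "(nat \<Rightarrow> nat) \<Rightarrow> real \<Rightarrow> real" where
  "plin q s = (1 - frac s) * real (q (nat \<lfloor>s\<rfloor>)) + frac s * real (q (Suc (nat \<lfloor>s\<rfloor>)))"

definition interp :: "nat \<Rightarrow> real set \<Rightarrow> (nat \<Rightarrow> nat \<Rightarrow> nat) \<Rightarrow> nat \<Rightarrow> real \<Rightarrow> real" where
  "interp n T p = (\<lambda>i\<in>{1..n}. \<lambda>s\<in>T. plin (\<lambda>j. p j i) s)"

definition discr :: "nat \<Rightarrow> (nat \<Rightarrow> real \<Rightarrow> real) \<Rightarrow> nat \<Rightarrow> nat \<Rightarrow> nat" where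
  "discr n X j i = (if i \<in> {1..n} then nat \<lfloor>X i (real j)\<rfloor> else 0)"

lemma plin_nat [simp]: "plin q (real j) = real (q j)"
  by (simp add: plin_def frac_def)

lemma plin_between:
  assumes "s \<in> {real j..real j + 1}"
  shows "plin q s = real (q j) + (real (q (Suc j)) - real (q j)) * (s - real j)"
proof (cases "s = real (Suc j)")
  case True
  then show ?thesis by (simp only: plin_nat) simp
next
  case False
  then have "\<lfloor>s\<rfloor> = int j"
    using assms by (intro floor_unique) auto
  then show ?thesis
    by (simp add: plin_def frac_def algebra_simps)
qed

text \<open>
  On \<open>{0..N}\<close> continuity follows by gluing finitely many closed pieces; near a given
  point the half-line agrees with such an interval.
\<close>
lemma continuous_on_plin: "continuous_on {0..} (plin q)"
proof -
  have piece: "continuous_on {real j..real j + 1} (plin q)" for j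
    by (subst continuous_on_cong[OF refl plin_between]) (auto intro!: continuous_intros)
  have upto: "continuous_on {0..real N} (plin q)" for N
  proof (induction N)
    case (Suc N)
    have "{0..real (Suc N)} = {0..real N} \<union> {real N..real N + 1}" by auto
    then show ?case
      using continuous_on_closed_Un[OF _ _ Suc piece[of N]] by simp
  qed simp
  show ?thesis
    unfolding continuous_on_eq_continuous_within
  proof
    fix x :: real assume x: "x \<in> {0..}"
    obtain N where N: "x < real N" using reals_Archimedean2 by blast
    have "at x within {0..} = at x within {0..real N}"
      by (rule at_within_nhd[of x "{..<real N}"]) (use N in auto)
    then show "continuous (at x within {0..}) (plin q)"
      using upto[of N] x N by (auto simp: continuous_on_eq_continuous_within)
  qed
qed

lemma plin_mono: "(\<And>j. q j \<le> r j) \<Longrightarrow> plin q s \<le> plin r s"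
  unfolding plin_def by (intro add_mono mult_left_mono) (auto simp: frac_ge_0 less_imp_le[OF frac_lt_1])

lemma interp_ordered:
  assumes p: "p \<in> dtraj n" and T: "0 \<in> T" "T \<subseteq> {0..}"
  shows "interp n T p \<in> ordered_paths n T"
proof -
  have "restrict (plin (\<lambda>j. p j i)) T \<in> bernoulli_paths T" for i
    unfolding bernoulli_paths_def
  proof (intro CollectI conjI allI impI)
    show "continuous_on T (restrict (plin (\<lambda>j. p j i)) T)"
      using continuous_on_subset[OF continuous_on_plin T(2)] by simp
    show "restrict (plin (\<lambda>j. p j i)) T 0 = 0"
      using T plin_nat[of "\<lambda>j. p j i" 0] by (simp add: dtraj_0[OF p])
    fix j assume j: "{real j..real j + 1} \<subseteq> T"
    show "\<exists>c\<in>{0, 1}. \<forall>s\<in>{real j..real j + 1}. restrict (plin (\<lambda>j. p j i)) T s =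
        restrict (plin (\<lambda>j. p j i)) T (real j) + c * (s - real j)"
    proof (rule bexI, rule ballI)
      show "real (p (Suc j) i) - real (p j i) \<in> {0, 1}"
        using dtraj_step[OF p, of j i] by auto
      fix s assume s: "s \<in> {real j..real j + 1}"
      then show "restrict (plin (\<lambda>j. p j i)) T s =
        restrict (plin (\<lambda>j. p j i)) T (real j) + (real (p (Suc j) i) - real (p j i)) * (s - real j)"
        using j subsetD[OF j, of "real j"] by (auto simp: plin_between)
    qed
  qed simp
  then show ?thesis
    unfolding ordered_paths_def interp_def
    by (auto simp: monotone_on_def intro!: plin_mono shapes_antimono[OF dtraj_shapes[OF p]])
qed

lemma ordered_path_component: "X \<in> ordered_paths n T \<Longrightarrow> i \<in> {1..n} \<Longrightarrow> X i \<in> bernoulli_paths T"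
  unfolding ordered_paths_def by (blast dest: PiE_mem)

lemma ordered_path_outside:
  assumes "X \<in> ordered_paths n T"
  shows "i \<notin> {1..n} \<Longrightarrow> X i = undefined"
    and "i \<in> {1..n} \<Longrightarrow> s \<notin> T \<Longrightarrow> X i s = undefined"
proof -
  have "X \<in> {1..n} \<rightarrow>\<^sub>E bernoulli_paths T"
    using assms by (simp add: ordered_paths_def)
  then show "i \<notin> {1..n} \<Longrightarrow> X i = undefined"
    by (rule PiE_arb)
  show "i \<in> {1..n} \<Longrightarrow> s \<notin> T \<Longrightarrow> X i s = undefined"
    using ordered_path_component[OF assms, of i] by (auto simp: bernoulli_paths_def intro: extensional_arb)
qed

text \<open>
  The starting value 0 and the slopes 0 and 1 force integer values at integer times, so that
  a path is the interpolation of its rounded-down values. The domain \<open>T\<close> is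
  \<open>{0..t}\<close> or the half-line in the applications.
\<close>
lemma bernoulli_path_nat:
  assumes f: "f \<in> bernoulli_paths T" and T: "{0..real t} \<subseteq> T"
  shows "\<forall>j\<le>t. f (real j) = real (nat \<lfloor>f (real j)\<rfloor>)"
    and "\<forall>j<t. nat \<lfloor>f (real (Suc j))\<rfloor> = nat \<lfloor>f (real j)\<rfloor> \<or> nat \<lfloor>f (real (Suc j))\<rfloor> = Suc (nat \<lfloor>f (real j)\<rfloor>)"
    and "\<forall>s\<in>{0..real t}. f s = plin (\<lambda>j. nat \<lfloor>f (real (min j t))\<rfloor>) s"
proof -
  have step: "\<exists>c\<in>{0, 1}. \<forall>s\<in>{real j..real j + 1}. f s = f (real j) + c * (s - real j)" if "j < t" for j
  proof -
    have "{real j..real j + 1} \<subseteq> T"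
      using that T by (auto intro!: subsetD[OF T])
    then show ?thesis using f by (simp add: bernoulli_paths_def)
  qed
  have step1: "f (real (Suc j)) = f (real j) \<or> f (real (Suc j)) = f (real j) + 1" if jt: "j < t" for j
  proof -
    obtain c where c: "c \<in> {0, 1}" "\<And>s. s \<in> {real j..real j + 1} \<Longrightarrow> f s = f (real j) + c * (s - real j)"
      using step[OF jt] by blast
    from c(2)[of "real (Suc j)"] c(1) show ?thesis by auto
  qed
  have nat: "f (real j) \<in> \<nat>" if "j \<le> t" for j
    using that
  proof (induction j)
    case 0
    then show ?case using f by (simp add: bernoulli_paths_def)
  next
    case (Suc j)
    then show ?case using step1[of j] by auto
  qed
  show *: "\<forall>j\<le>t. f (real j) = real (nat \<lfloor>f (real j)\<rfloor>)"
  proof (intro allI impI)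
    fix j assume "j \<le> t"
    then obtain k where "f (real j) = of_nat k"
      using nat[of j] by (auto elim: Nats_cases)
    then show "f (real j) = real (nat \<lfloor>f (real j)\<rfloor>)"
      by simp
  qed
  show **: "\<forall>j<t. nat \<lfloor>f (real (Suc j))\<rfloor> = nat \<lfloor>f (real j)\<rfloor> \<or> nat \<lfloor>f (real (Suc j))\<rfloor> = Suc (nat \<lfloor>f (real j)\<rfloor>)"
  proof (intro allI impI)
    fix j assume j: "j < t"
    have "f (real (Suc j)) = real (nat \<lfloor>f (real (Suc j))\<rfloor>)" "f (real j) = real (nat \<lfloor>f (real j)\<rfloor>)"
      by (rule *[rule_format]; use j in simp)+
    then show "nat \<lfloor>f (real (Suc j))\<rfloor> = nat \<lfloor>f (real j)\<rfloor> \<or> nat \<lfloor>f (real (Suc j))\<rfloor> = Suc (nat \<lfloor>f (real j)\<rfloor>)"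
      using step1[OF j] by linarith
  qed
  show "\<forall>s\<in>{0..real t}. f s = plin (\<lambda>j. nat \<lfloor>f (real (min j t))\<rfloor>) s"
  proof
    fix s assume s: "s \<in> {0..real t}"
    show "f s = plin (\<lambda>j. nat \<lfloor>f (real (min j t))\<rfloor>) s"
    proof (cases "s = real t")
      case True
      then show ?thesis using * by (simp only: plin_nat)
    next
      case False
      define j where "j = nat \<lfloor>s\<rfloor>"
      have j: "j < t" "s \<in> {real j..real j + 1}"
        using False s by (auto simp: j_def, linarith+)
      obtain c where c: "\<And>s. s \<in> {real j..real j + 1} \<Longrightarrow> f s = f (real j) + c * (s - real j)"
        using step[OF j(1)] by blast
      have "c = f (real (Suc j)) - f (real j)"
        using c[of "real (Suc j)"] by simp
      moreover have "f (real (Suc j)) = real (nat \<lfloor>f (real (Suc j))\<rfloor>)" "f (real j) = real (nat \<lfloor>f (real j)\<rfloor>)"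
        by (rule *[rule_format]; use j in simp)+
      ultimately show ?thesis
        using c[OF j(2)] j by (subst plin_between[OF j(2)]) (simp add: min_def)
    qed
  qed
qed

definition prefix :: "nat \<Rightarrow> nat \<Rightarrow> (nat \<Rightarrow> real \<Rightarrow> real) \<Rightarrow> nat \<Rightarrow> nat \<Rightarrow> nat" where
  "prefix n t X = (\<lambda>j. discr n X (min j t))"

lemma prefix_dpaths:
  assumes X: "X \<in> ordered_paths n T" and T: "{0..real t} \<subseteq> T"
  shows "prefix n t X \<in> dpaths n t"
proof -
  have b: "X i \<in> bernoulli_paths T" if "i \<in> {1..n}" for i
    using X that by (rule ordered_path_component)
  have shape: "discr n X j \<in> shapes n" if "j \<le> t" for j
  proof (rule shapesI)
    fix i assume i: "1 \<le> i" "i < n"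
    have "real j \<in> T"
      using T that by auto
    then have "antimono_on {1..n} (\<lambda>i. X i (real j))"
      using X by (simp add: ordered_paths_def)
    then have "X (Suc i) (real j) \<le> X i (real j)"
      by (rule monotone_onD) (use i in auto)
    then show "discr n X j (Suc i) \<le> discr n X j i"
      using i by (auto simp: discr_def intro!: nat_mono floor_mono)
  qed (auto simp: discr_def)
  show ?thesis
  proof (rule dpathsI)
    show "prefix n t X 0 = (\<lambda>_. 0)"
    proof
      fix i
      show "prefix n t X 0 i = 0"
        using b[of i] by (cases "i \<in> {1..n}") (simp_all add: prefix_def discr_def bernoulli_paths_def)
    qed
    show "prefix n t X (Suc j) \<in> up n (prefix n t X j)" for j
    proof (cases "j < t")
      case True
      have "discr n X (Suc j) i = discr n X j i \<or> discr n X (Suc j) i = Suc (discr n X j i)" for i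
        using bernoulli_path_nat(2)[OF b T, of i] True by (auto simp: discr_def)
      then have "discr n X (Suc j) \<in> up n (discr n X j)"
        using shape[of "Suc j"] True by (simp add: up_def)
      then show ?thesis
        using True by (simp add: prefix_def min_def not_less less_Suc_eq_le Suc_le_eq)
    qed (use up_refl[OF shape[of t]] in \<open>simp add: prefix_def\<close>)
    show "prefix n t X j = prefix n t X t" if "t \<le> j" for j
      using that by (simp add: prefix_def)
  qed
qed

lemma path_eq_plin_prefix:
  assumes X: "X \<in> ordered_paths n T" and T: "{0..real t} \<subseteq> T" and i: "i \<in> {1..n}" and s: "s \<in> {0..real t}"
  shows "X i s = plin (\<lambda>j. prefix n t X j i) s"
proof -
  have "X i \<in> bernoulli_paths T"
    using X i by (rule ordered_path_component)
  from bernoulli_path_nat(3)[OF this T, rule_format, OF s]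
  have "X i s = plin (\<lambda>j. nat \<lfloor>X i (real (min j t))\<rfloor>) s" .
  also have "(\<lambda>j. nat \<lfloor>X i (real (min j t))\<rfloor>) = (\<lambda>j. prefix n t X j i)"
    using i by (simp add: prefix_def discr_def)
  finally show ?thesis .
qed

lemma discr_dtraj:
  assumes X: "X \<in> ordered_paths n {0..}"
  shows "discr n X \<in> dtraj n"
  unfolding dtraj_def
proof (intro CollectI conjI allI)
  have p: "prefix n t X \<in> dtraj n" for t
    by (rule dpaths_dtraj[OF prefix_dpaths[OF X]]) auto
  show "discr n X 0 = (\<lambda>_. 0)"
    using dtraj_0[OF p[of 0]] by (simp add: prefix_def)
  show "discr n X (Suc j) \<in> up n (discr n X j)" for j
    using dtraj_up[OF p[of "Suc j"], of j] by (simp add: prefix_def)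
qed

lemma path_at_nat:
  assumes X: "X \<in> ordered_paths n T" and T: "{0..real t} \<subseteq> T" and i: "i \<in> {1..n}"
  shows "X i (real t) = real (discr n X t i)"
  using path_eq_plin_prefix[OF X T i, of "real t"] by (simp add: prefix_def)

lemma path_eq_plin_discr:
  assumes X: "X \<in> ordered_paths n {0..}" and i: "i \<in> {1..n}" and s: "0 \<le> s"
  shows "X i s = plin (\<lambda>j. discr n X j i) s"
proof -
  obtain t where t: "s + 1 < real t" using reals_Archimedean2 by blast
  then have *: "nat \<lfloor>s\<rfloor> \<le> t" "Suc (nat \<lfloor>s\<rfloor>) \<le> t" using s by linarith+
  have "X i s = plin (\<lambda>j. prefix n t X j i) s"
    using s t by (intro path_eq_plin_prefix[OF X _ i]) auto
  then show ?thesis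
    using * by (simp add: plin_def prefix_def)
qed

lemma discr_interp:
  assumes p: "p \<in> dtraj n" and "real j \<in> T"
  shows "discr n (interp n T p) j = p j"
  using assms shapes_zero[OF dtraj_shapes[OF p]] by (auto simp: discr_def interp_def)

lemma prefix_interp:
  assumes p: "p \<in> dpaths n t" and T: "{0..real t} \<subseteq> T"
  shows "prefix n t (interp n T p) = p"
proof
  fix j
  have "real (min j t) \<in> T" using T by auto
  then show "prefix n t (interp n T p) j = p j"
    using discr_interp[OF dpaths_dtraj[OF p], of "min j t" T] dpaths_frozen[OF p, of j]
    by (cases "t \<le> j") (simp_all add: prefix_def min_def)
qed

lemma interp_prefix:
  assumes f: "f \<in> ordered_paths n {0..real t}"
  shows "interp n {0..real t} (prefix n t f) = f"
proof (rule ext, rule ext)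
  fix i s
  show "interp n {0..real t} (prefix n t f) i s = f i s"
    using path_eq_plin_prefix[OF f order.refl, of i s] ordered_path_outside(1)[OF f, of i] ordered_path_outside(2)[OF f, of i s]
    by (simp add: interp_def)
qed

lemma bij_betw_interp: "bij_betw (interp n {0..real t}) (dpaths n t) (ordered_paths n {0..real t})"
  by (rule bij_betw_byWitness[where f' = "prefix n t"])
     (auto simp: prefix_interp interp_prefix intro: interp_ordered[OF dpaths_dtraj] prefix_dpaths)

lemma restrict_paths_eq_interp:
  assumes X: "X \<in> ordered_paths n {0..}"
  shows "restrict_paths n {0..real t} X = interp n {0..real t} (prefix n t X)"
  unfolding restrict_paths_def interp_def
  by (intro restrict_ext path_eq_plin_prefix[OF X]) auto

lemma restrict_paths_full:
  assumes X: "X \<in> ordered_paths n {0..}"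
  shows "restrict_paths n {0..} X = X"
proof (rule ext, rule ext)
  fix i s
  show "restrict_paths n {0..} X i s = X i s"
    using ordered_path_outside(1)[OF X, of i] ordered_path_outside(2)[OF X, of i s] by (simp add: restrict_paths_def restrict_def)
qed

lemma finite_ordered_paths: "finite (ordered_paths n {0..real t})"
  using bij_betw_finite[OF bij_betw_interp] finite_dpaths by blast

text \<open>
  Under the bijection between paths on \<open>{0..t}\<close> and prefixes of length \<open>t\<close>,
  the measure becomes the uniform one on the prefixes with endpoint \<open>y\<close>. The endpoint has
  to be attained: otherwise the conditioning event is empty and the measure is zero.
\<close>
lemma measure_nu:
  assumes A: "A \<subseteq> ordered_paths n {0..real t}" and y: "0 < npaths n t y"
    and x: "\<And>i. i \<in> {1..n} \<Longrightarrow> x i = real (y i)" and y0: "y \<in> shapes n"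
  shows "measure (nu n t x) A = real (card {p \<in> dpaths n t. p t = y \<and> interp n {0..real t} p \<in> A}) / real (npaths n t y)"
proof -
  let ?C = "count_space (ordered_paths n {0..real t})"
  let ?E = "{f \<in> ordered_paths n {0..real t}. \<forall>i\<in>{1..n}. f i (real t) = x i}"
  have *: "(\<forall>i\<in>{1..n}. f i (real t) = x i) \<longleftrightarrow> prefix n t f t = y" if f: "f \<in> ordered_paths n {0..real t}" for f
  proof -
    have "prefix n t f t = y \<longleftrightarrow> (\<forall>i\<in>{1..n}. discr n f t i = y i)"
      using shapes_zero[OF y0] by (auto simp: prefix_def discr_def fun_eq_iff)
    also have "\<dots> \<longleftrightarrow> (\<forall>i\<in>{1..n}. f i (real t) = x i)"
      using path_at_nat[OF f order.refl] x by simp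
    finally show ?thesis by simp
  qed
  have card: "card {f \<in> ordered_paths n {0..real t}. prefix n t f t = y \<and> f \<in> B}
      = card {p \<in> dpaths n t. p t = y \<and> interp n {0..real t} p \<in> B}" for B
  proof (rule bij_betw_same_card[of "prefix n t"])
    show "bij_betw (prefix n t) {f \<in> ordered_paths n {0..real t}. prefix n t f t = y \<and> f \<in> B}
        {p \<in> dpaths n t. p t = y \<and> interp n {0..real t} p \<in> B}"
      by (rule bij_betw_byWitness[where f' = "interp n {0..real t}"])
         (auto simp: prefix_interp interp_prefix intro: interp_ordered[OF dpaths_dtraj] prefix_dpaths)
  qed
  have E: "?E = {f \<in> ordered_paths n {0..real t}. prefix n t f t = y \<and> f \<in> UNIV}"
    using * by auto
  have EA: "?E \<inter> A = {f \<in> ordered_paths n {0..real t}. prefix n t f t = y \<and> f \<in> A}"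
    using * by auto
  have cE: "card ?E = npaths n t y"
    unfolding E card npaths_def by simp
  have finE: "finite ?E"
    by (rule finite_subset[OF _ finite_ordered_paths]) auto
  have "measure (nu n t x) A = measure ?C (?E \<inter> A) / measure ?C ?E"
    unfolding nu_def
  proof (rule measure_uniform_measure)
    have "emeasure ?C ?E = of_nat (npaths n t y)"
      unfolding cE[symmetric] using finE by (intro emeasure_count_space_finite) auto
    then show "emeasure ?C ?E \<noteq> 0" "emeasure ?C ?E \<noteq> \<infinity>"
      using y by auto
  qed (use A in auto)
  also have "measure ?C ?E = card ?E"
    using finE by (subst measure_count_space) auto
  also have "measure ?C (?E \<inter> A) = card (?E \<inter> A)"
    using finE by (subst measure_count_space) auto
  finally show ?thesis
    unfolding EA cE card .
qed

section \<open>Cylinder events and the conditional law of a prefix\<close>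

abbreviation paths :: "nat \<Rightarrow> (nat \<Rightarrow> real \<Rightarrow> real) set" where
  "paths n \<equiv> ordered_paths n {0..}"

text \<open>
  The sigma-algebra on the set of infinite paths that is generated by the restriction to
  \<open>{a..}\<close>, that is the one on which the Gibbs property conditions.
\<close>
definition tail_algebra :: "nat \<Rightarrow> nat \<Rightarrow> (nat \<Rightarrow> real \<Rightarrow> real) measure" where
  "tail_algebra n a = vimage_algebra (paths n) (restrict_paths n {real a..}) (eval_algebra n {real a..})"

definition cyl :: "nat \<Rightarrow> nat \<Rightarrow> nat \<Rightarrow> (nat \<Rightarrow> nat \<Rightarrow> nat) \<Rightarrow> (nat \<Rightarrow> real \<Rightarrow> real) set" where
  "cyl n a m p = {X \<in> paths n. \<forall>j\<in>{a..m}. discr n X j = p j}"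

text \<open>
  The empty set makes the family closed under intersections.
\<close>
definition cyls :: "nat \<Rightarrow> nat \<Rightarrow> (nat \<Rightarrow> real \<Rightarrow> real) set set" where
  "cyls n a = insert {} {cyl n a m p | m p. a \<le> m \<and> p \<in> dpaths n m}"

lemma space_eval_algebra: "space (eval_algebra n T) = ({1..n} \<rightarrow>\<^sub>E (T \<rightarrow>\<^sub>E UNIV))"
  by (simp add: eval_algebra_def space_PiM)

lemma measurable_eval: "i \<in> {1..n} \<Longrightarrow> s \<in> T \<Longrightarrow> (\<lambda>X. X i s) \<in> borel_measurable (eval_algebra n T)"
  unfolding eval_algebra_def
  using measurable_compose[OF measurable_component_singleton[of i "{1..n}" "\<lambda>i. PiM T (\<lambda>s. borel :: real measure)"]
      measurable_component_singleton[of s T "\<lambda>s. borel :: real measure"]] by simp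

lemma measurable_restrict_paths:
  assumes "\<And>i s. i \<in> {1..n} \<Longrightarrow> s \<in> T \<Longrightarrow> (\<lambda>X. X i s) \<in> borel_measurable N"
  shows "restrict_paths n T \<in> measurable N (eval_algebra n T)"
proof -
  have "(\<lambda>X. \<lambda>i\<in>{1..n}. \<lambda>s\<in>T. X i s) \<in> measurable N (eval_algebra n T)"
    unfolding eval_algebra_def by (intro measurable_restrict assms)
  then show ?thesis
    by (simp add: restrict_paths_def[abs_def] restrict_def)
qed

lemma restrict_paths_space: "restrict_paths n T X \<in> space (eval_algebra n T)"
  by (auto simp: space_eval_algebra restrict_paths_def)

lemma space_tail [simp]: "space (tail_algebra n a) = paths n"
  by (simp add: tail_algebra_def)

lemma ordered_paths_eval: "ordered_paths n T \<subseteq> space (eval_algebra n T)"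
proof
  fix X assume X: "X \<in> ordered_paths n T"
  have "X \<in> {1..n} \<rightarrow>\<^sub>E bernoulli_paths T"
    using X by (simp add: ordered_paths_def)
  moreover have "bernoulli_paths T \<subseteq> (T \<rightarrow>\<^sub>E UNIV)"
    by (auto simp: bernoulli_paths_def PiE_def)
  ultimately show "X \<in> space (eval_algebra n T)"
    unfolding space_eval_algebra using PiE_mono[of "{1..n}" "\<lambda>_. bernoulli_paths T" "\<lambda>_. T \<rightarrow>\<^sub>E UNIV"] by blast
qed

lemma space_path_space [simp]: "space (path_space n T) = ordered_paths n T"
  using ordered_paths_eval[of n T] by (auto simp: path_space_def space_restrict_space)

lemma sets_path_space_eq_tail: "sets (path_space n {0..}) = sets (tail_algebra n 0)"
proof -
  have "sets (tail_algebra n 0) = {restrict_paths n {0..} -` A \<inter> paths n | A. A \<in> sets (eval_algebra n {0..})}"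
    unfolding tail_algebra_def by (subst sets_vimage_algebra2) (auto simp: restrict_paths_space)
  also have "\<dots> = {paths n \<inter> A | A. A \<in> sets (eval_algebra n {0..})}"
  proof -
    have "restrict_paths n {0..} -` A \<inter> paths n = paths n \<inter> A" for A
      using restrict_paths_full[of _ n] by auto
    then show ?thesis by simp
  qed
  also have "\<dots> = sets (path_space n {0..})"
    by (auto simp: path_space_def sets_restrict_space)
  finally show ?thesis by simp
qed

lemma measurable_tail_eval:
  assumes "i \<in> {1..n}" "real a \<le> s"
  shows "(\<lambda>X. X i s) \<in> borel_measurable (tail_algebra n a)"
proof -
  have "restrict_paths n {real a..} \<in> measurable (tail_algebra n a) (eval_algebra n {real a..})"
    unfolding tail_algebra_def by (rule measurable_vimage_algebra1) (simp add: restrict_paths_space)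
  from measurable_compose[OF this measurable_eval[of i n s]] assms
  show ?thesis by (simp add: restrict_paths_def)
qed

lemma measurable_tail_discr:
  assumes "a \<le> j"
  shows "(\<lambda>X. discr n X j i) \<in> measurable (tail_algebra n a) (count_space UNIV)"
proof (cases "i \<in> {1..n}")
  case True
  then have "(\<lambda>X. nat \<lfloor>X i (real j)\<rfloor>) \<in> measurable (tail_algebra n a) (count_space UNIV)"
    using measurable_tail_eval[of i n a "real j"] assms
    by (intro measurable_compose[OF measurable_compose[OF _ measurable_real_floor] measurable_count_space]) auto
  then show ?thesis using True by (simp add: discr_def)
next
  case False
  then have "(\<lambda>X. discr n X j i) = (\<lambda>_. 0)"
    by (auto simp: discr_def)
  then show ?thesis by simp
qed

lemma discr_eq_iff:
  assumes "l \<in> shapes n"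
  shows "discr n X j = l \<longleftrightarrow> (\<forall>i\<in>{1..n}. discr n X j i = l i)"
  using shapes_zero[OF assms] by (auto simp: fun_eq_iff discr_def)

lemma discr_level_measurable:
  assumes "a \<le> j" "l \<in> shapes n"
  shows "{X \<in> paths n. discr n X j = l} \<in> sets (tail_algebra n a)"
proof -
  have "{X \<in> space (tail_algebra n a). \<forall>i\<in>{1..n}. discr n X j i = l i} \<in> sets (tail_algebra n a)"
    using measurable_tail_discr[OF assms(1)] by measurable
  then show ?thesis
    by (simp add: discr_eq_iff[OF assms(2)])
qed

lemma cyl_measurable:
  assumes "a \<le> m" "p \<in> dtraj n"
  shows "cyl n a m p \<in> sets (tail_algebra n a)"
proof -
  have "cyl n a m p = (\<Inter>j\<in>{a..m}. {X \<in> paths n. discr n X j = p j})"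
    using assms by (auto simp: cyl_def)
  also have "\<dots> \<in> sets (tail_algebra n a)"
    using assms by (intro sets.finite_INT discr_level_measurable dtraj_shapes) auto
  finally show ?thesis .
qed

lemma cyls_subset: "cyls n a \<subseteq> Pow (paths n)"
  by (auto simp: cyls_def cyl_def)

lemma cyl_prefix: "X \<in> paths n \<Longrightarrow> X \<in> cyl n a m (prefix n m X)"
  by (simp add: cyl_def prefix_def)

lemma prefix_inf: "X \<in> paths n \<Longrightarrow> prefix n m X \<in> dpaths n m"
  by (rule prefix_dpaths) auto

text \<open>
  A path after an integer time \<open>a\<close> is a function of its integer values from
  \<open>a\<close> on. As there are only finitely many prefixes of a given length, prescribing one
  such value is a finite union of cylinder events.
\<close>
lemma sets_tail_eq: "sets (tail_algebra n a) = sigma_sets (paths n) (cyls n a)"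
proof (rule equalityI[rotated])
  have sigma_sets_finite_UN: "(\<Union>i\<in>I. A i) \<in> sigma_sets \<Omega> E"
    if "E \<subseteq> Pow \<Omega>" "finite I" "\<And>i. i \<in> I \<Longrightarrow> A i \<in> sigma_sets \<Omega> E" for \<Omega> E and I :: "(nat \<Rightarrow> nat \<Rightarrow> nat) set" and A :: "_ \<Rightarrow> (nat \<Rightarrow> real \<Rightarrow> real) set"
    using sets.finite_UN[of I A "sigma \<Omega> E"] that by simp
  show "sigma_sets (paths n) (cyls n a) \<subseteq> sets (tail_algebra n a)"
  proof -
    have "cyls n a \<subseteq> sets (tail_algebra n a)"
      by (auto simp: cyls_def intro!: cyl_measurable dpaths_dtraj)
    from sets.sigma_sets_subset[OF this] show ?thesis by simp
  qed
  let ?N = "sigma (paths n) (cyls n a)"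
  have space: "space ?N = paths n"
    by (rule space_measure_of[OF cyls_subset])
  have sets: "sets ?N = sigma_sets (paths n) (cyls n a)"
    by (rule sets_measure_of[OF cyls_subset])
  have d: "(\<lambda>X. discr n X j i) \<in> measurable ?N (count_space UNIV)" if "a \<le> j" for j i
  proof -
    have "(\<lambda>X. discr n X j i) -` {v} \<inter> paths n \<in> sets ?N" for v
    proof -
      have "(\<lambda>X. discr n X j i) -` {v} \<inter> paths n = (\<Union>p\<in>{p\<in>dpaths n j. p j i = v}. cyl n a j p)"
        (is "?L = ?R")
      proof
        show "?L \<subseteq> ?R"
        proof
          fix X assume "X \<in> ?L"
          then have "prefix n j X \<in> {p\<in>dpaths n j. p j i = v}" "X \<in> cyl n a j (prefix n j X)"
            by (auto simp: cyl_prefix prefix_inf) (simp add: prefix_def)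
          then show "X \<in> ?R" by blast
        qed
        show "?R \<subseteq> ?L"
          using that by (auto simp: cyl_def)
      qed
      also have "\<dots> \<in> sets ?N"
        unfolding sets using that finite_subset[OF _ finite_dpaths[of n j], of "{p\<in>dpaths n j. p j i = v}"]
        by (intro sigma_sets_finite_UN[OF cyls_subset] sigma_sets.Basic) (auto simp: cyls_def)
      finally show ?thesis .
    qed
    then show ?thesis
      by (simp add: measurable_count_space_eq2_countable space)
  qed
  have "(\<lambda>X. X i s) \<in> borel_measurable ?N" if i: "i \<in> {1..n}" and s: "real a \<le> s" for i s
  proof -
    have le: "a \<le> nat \<lfloor>s\<rfloor>"
      using s by (simp add: le_nat_floor)
    have "(\<lambda>X. (1 - frac s) * real (discr n X (nat \<lfloor>s\<rfloor>) i) + frac s * real (discr n X (Suc (nat \<lfloor>s\<rfloor>)) i))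
        \<in> borel_measurable ?N"
      using d[OF le, of i] d[OF le_SucI[OF le], of i] by measurable
    moreover have "0 \<le> s" using s by simp
    ultimately show ?thesis
      using path_eq_plin_discr[OF _ i] by (subst measurable_cong) (auto simp: plin_def space)
  qed
  then have "restrict_paths n {real a..} \<in> measurable ?N (eval_algebra n {real a..})"
    by (intro measurable_restrict_paths) auto
  from sets_image_in_sets[OF space this] show "sets (tail_algebra n a) \<subseteq> sigma_sets (paths n) (cyls n a)"
    unfolding tail_algebra_def sets .
qed

text \<open>
  Two cylinder events are either disjoint or the one with the longer time range is contained in the other.
\<close>
lemma Int_stable_cyls: "Int_stable (cyls n a)"
proof -
  have *: "cyl n a m p \<inter> cyl n a m' p' \<in> cyls n a"
    if "a \<le> m" "m \<le> m'" "p' \<in> dpaths n m'" for m p m' p'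
  proof (cases "\<forall>j\<in>{a..m}. p j = p' j")
    case True
    then have "cyl n a m p \<inter> cyl n a m' p' = cyl n a m' p'"
      using that(2) by (auto simp: cyl_def)
    then show ?thesis
      using that by (auto simp: cyls_def)
  next
    case False
    then have "cyl n a m p \<inter> cyl n a m' p' = {}"
      using that(2) by (fastforce simp: cyl_def)
    then show ?thesis by (simp add: cyls_def)
  qed
  show ?thesis
  proof (rule Int_stableI)
    fix A B assume A: "A \<in> cyls n a" and B: "B \<in> cyls n a"
    consider "A = {} \<or> B = {}" | m p m' p' where "A = cyl n a m p" "B = cyl n a m' p'" "a \<le> m" "a \<le> m'" "p \<in> dpaths n m" "p' \<in> dpaths n m'"
      using A B by (auto simp: cyls_def)
    then show "A \<inter> B \<in> cyls n a"
    proof cases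
      case 1
      then show ?thesis by (auto simp: cyls_def)
    next
      case 2
      then show ?thesis
        using *[of m m' p' p] *[of m' m p p'] by (cases "m \<le> m'") (simp_all add: Int_commute)
    qed
  qed
qed

lemma restrict_paths_measurable_tail:
  "restrict_paths n {real a..} \<in> measurable (path_space n {0..}) (eval_algebra n {real a..})"
proof -
  have "restrict_paths n {real a..} \<in> measurable (tail_algebra n 0) (eval_algebra n {real a..})"
    by (intro measurable_restrict_paths measurable_tail_eval) auto
  then show ?thesis
    by (simp add: measurable_def sets_path_space_eq_tail)
qed

lemma sets_tail_subset: "sets (tail_algebra n a) \<subseteq> sets (path_space n {0..})"
  unfolding tail_algebra_def
  by (rule sets_image_in_sets[OF _ restrict_paths_measurable_tail]) simp

lemma restrict_paths_measurable_prefix: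
  "restrict_paths n {0..real t} \<in> measurable (path_space n {0..}) (path_space n {0..real t})"
  unfolding path_space_def[of n "{0..real t}"]
proof (rule measurable_restrict_space2)
  show "restrict_paths n {0..real t} \<in> space (path_space n {0..}) \<rightarrow> ordered_paths n {0..real t}"
    by (auto simp: restrict_paths_eq_interp intro!: interp_ordered dpaths_dtraj[OF prefix_inf])
  have "restrict_paths n {0..real t} \<in> measurable (tail_algebra n 0) (eval_algebra n {0..real t})"
    by (intro measurable_restrict_paths measurable_tail_eval) auto
  then show "restrict_paths n {0..real t} \<in> measurable (path_space n {0..}) (eval_algebra n {0..real t})"
    by (simp add: measurable_def sets_path_space_eq_tail)
qed

lemma zero_dpaths: "(\<lambda>_ _. 0) \<in> dpaths n t"
  by (rule dpathsI) (auto simp: up_def shapes_def)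

lemma cyl_0: "p \<in> dtraj n \<Longrightarrow> cyl n 0 0 p = paths n"
  using dtraj_0[OF discr_dtraj] by (auto simp: cyl_def dtraj_0)

text \<open>
  The case \<open>a = 0\<close> of the preceding description: the whole path space is generated by
  prefix events, which form an intersection-stable family.
\<close>
lemma path_measure_eqI:
  assumes "prob_space M" "sets M = sets (path_space n {0..})" "sets N = sets (path_space n {0..})"
    and eq: "\<And>m p. p \<in> dpaths n m \<Longrightarrow> emeasure M (cyl n 0 m p) = emeasure N (cyl n 0 m p)"
  shows "M = N"
proof (rule measure_eqI_generator_eq[OF Int_stable_cyls[of n 0] cyls_subset])
  interpret prob_space M by fact
  show "emeasure M X = emeasure N X" if "X \<in> cyls n 0" for X
    using that eq by (auto simp: cyls_def)
  show "sets M = sigma_sets (paths n) (cyls n 0)" "sets N = sigma_sets (paths n) (cyls n 0)"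
    using assms by (simp_all add: sets_path_space_eq_tail sets_tail_eq)
  show "range (\<lambda>i::nat. paths n) \<subseteq> cyls n 0"
    using cyl_0[OF dpaths_dtraj[OF zero_dpaths[of n 0]]] zero_dpaths[of n 0] by (auto simp: cyls_def)
  show "emeasure M (paths n) \<noteq> \<infinity>" for i :: nat
    by simp
qed simp


lemma singleton_path_measurable:
  assumes f: "f \<in> ordered_paths n {0..real t}"
  shows "{f} \<in> sets (path_space n {0..real t})"
proof -
  have "{g \<in> space (path_space n {0..real t}). \<forall>j\<in>{..t}. \<forall>i\<in>{1..n}. g i (real j) = f i (real j)} \<in> sets (path_space n {0..real t})"
  proof (intro sets.sets_Collect_finite_All)
    fix j i assume "j \<in> {..t}" "i \<in> {1..n}"
    then have [measurable]: "(\<lambda>g. g i (real j)) \<in> borel_measurable (path_space n {0..real t})"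
      unfolding path_space_def by (intro measurable_restrict_space1 measurable_eval) auto
    show "{g \<in> space (path_space n {0..real t}). g i (real j) = f i (real j)} \<in> sets (path_space n {0..real t})"
      by measurable
  qed auto
  also have "{g \<in> space (path_space n {0..real t}). \<forall>j\<in>{..t}. \<forall>i\<in>{1..n}. g i (real j) = f i (real j)} = {f}"
  proof -
    have "g = f" if g: "g \<in> ordered_paths n {0..real t}" and eq: "\<forall>j\<in>{..t}. \<forall>i\<in>{1..n}. g i (real j) = f i (real j)" for g
    proof -
      have "prefix n t g = prefix n t f"
        using eq by (auto simp: prefix_def discr_def fun_eq_iff)
      then show ?thesis
        using interp_prefix[OF g] interp_prefix[OF f] by metis
    qed
    then show ?thesis using f by auto
  qed
  finally show ?thesis .
qed

lemma restrict_eq_interp_iff: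
  assumes X: "X \<in> paths n" and p: "p \<in> dpaths n t"
  shows "restrict_paths n {0..real t} X = interp n {0..real t} p \<longleftrightarrow> X \<in> cyl n 0 t p"
proof -
  have "restrict_paths n {0..real t} X = interp n {0..real t} p \<longleftrightarrow> prefix n t X = p"
    using restrict_paths_eq_interp[OF X, of t] prefix_interp[OF p order.refl]
      prefix_interp[OF prefix_inf[OF X, of t] order.refl] by metis
  also have "\<dots> \<longleftrightarrow> (\<forall>j\<in>{0..t}. discr n X j = p j)"
  proof
    assume r: "\<forall>j\<in>{0..t}. discr n X j = p j"
    show "prefix n t X = p"
      by (rule dpaths_eqI[OF prefix_inf[OF X] p]) (use r in \<open>auto simp: prefix_def\<close>)
  qed (auto simp: prefix_def)
  finally show ?thesis
    using X by (simp add: cyl_def)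
qed

lemma measure_nu_path:
  assumes X: "X \<in> paths n" and A: "A \<subseteq> ordered_paths n {0..real t}"
  shows "measure (nu n t (\<lambda>i. X i (real t))) A =
    real (card {p \<in> dpaths n t. p t = discr n X t \<and> interp n {0..real t} p \<in> A}) / real (npaths n t (discr n X t))"
proof (rule measure_nu[OF A])
  have "prefix n t X \<in> {p \<in> dpaths n t. p t = discr n X t}"
    using prefix_inf[OF X, of t] by (simp add: prefix_def)
  then show "0 < npaths n t (discr n X t)"
    unfolding npaths_def by (subst card_gt_0_iff) (auto intro: finite_subset[OF _ finite_dpaths])
  show "X i (real t) = real (discr n X t i)" if "i \<in> {1..n}" for i
    using path_at_nat[OF X _ that, of t] by auto
  show "discr n X t \<in> shapes n"
    by (rule dtraj_shapes[OF discr_dtraj[OF X]])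
qed

text \<open>
  Integrate the conditional probability of a single path on \<open>{0..t}\<close> over the event that
  the partition at time \<open>t\<close> is the endpoint of that path. This event belongs to the tail
  sigma-algebra, and on it the conditional probability is the constant
  \<open>1 / npaths n t (p t)\<close>.
\<close>
lemma gibbs_prefix_law:
  assumes gibbs: "bernoulli_gibbs n M" and p: "p \<in> dpaths n t"
  shows "measure M (cyl n 0 t p) * real (npaths n t (p t)) = measure M {X \<in> paths n. discr n X t = p t}"
proof (cases "t = 0")
  case True
  have z: "q \<in> dpaths n 0 \<longleftrightarrow> q = (\<lambda>_ _. 0)" for q
    using dpaths_eqI[of q n 0 "\<lambda>_ _. 0"] zero_dpaths[of n 0] dtraj_0[OF dpaths_dtraj, of q n 0] by auto
  then have "{q \<in> dpaths n 0. q 0 = p 0} = {\<lambda>_ _. 0}"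
    using p True by auto
  then have "npaths n 0 (p 0) = 1"
    by (simp add: npaths_def)
  moreover have "{X \<in> paths n. discr n X 0 = p 0} = cyl n 0 0 p"
    by (auto simp: cyl_def)
  ultimately show ?thesis using True by simp
next
  case False
  interpret prob_space M using gibbs by (simp add: bernoulli_gibbs_def)
  have sets: "sets M = sets (path_space n {0..})"
    using gibbs by (simp add: bernoulli_gibbs_def)
  have space: "space M = paths n"
    using sets_eq_imp_space_eq[OF sets] by simp
  define A where "A = {interp n {0..real t} p}"
  have pi: "interp n {0..real t} p \<in> ordered_paths n {0..real t}"
    by (rule interp_ordered[OF dpaths_dtraj[OF p]]) auto
  have A: "A \<in> sets (path_space n {0..real t})"
    unfolding A_def by (rule singleton_path_measurable[OF pi])
  let ?F = "tail_algebra n t" and ?Y = "restrict_paths n {0..real t}"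
  have YA: "?Y -` A \<inter> space M = cyl n 0 t p"
    using restrict_eq_interp_iff[OF _ p] by (auto simp: A_def space cyl_def)
  define B where "B = {X \<in> paths n. discr n X t = p t}"
  have B: "B \<in> sets ?F"
    unfolding B_def by (rule discr_level_measurable) (auto intro: dtraj_shapes[OF dpaths_dtraj[OF p]])
  have subalg: "subalgebra M ?F"
    using sets_tail_subset[of n t] by (auto simp: subalgebra_def space sets)
  interpret finite_measure_subalgebra M ?F
    by unfold_locales (rule subalg)
  have C: "cyl n 0 t p \<in> sets M"
    using cyl_measurable[of 0 t p n] p by (simp add: sets sets_path_space_eq_tail dpaths_dtraj)
  have ae: "AE X in M. real_cond_exp M ?F (indicator (cyl n 0 t p)) X = measure (nu n t (\<lambda>i. X i (real t))) A"
    using gibbs False A unfolding bernoulli_gibbs_def cond_distr_given_def YA[symmetric]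
    by (simp add: tail_algebra_def space)
  have "measure M (cyl n 0 t p) = (\<integral>X\<in>B. indicator (cyl n 0 t p) X \<partial>M)"
  proof -
    have "cyl n 0 t p = B \<inter> cyl n 0 t p"
      by (auto simp: B_def cyl_def)
    then have "(\<lambda>X. indicator B X *\<^sub>R indicator (cyl n 0 t p) X) = (indicator (cyl n 0 t p) :: _ \<Rightarrow> real)"
      by (auto simp: fun_eq_iff split: split_indicator)
    then show ?thesis
      using C by (simp add: set_lebesgue_integral_def)
  qed
  also have "\<dots> = (\<integral>X\<in>B. real_cond_exp M ?F (indicator (cyl n 0 t p)) X \<partial>M)"
    using C B by (intro real_cond_exp_intA) (auto intro!: integrable_real_indicator simp: emeasure_eq_measure)
  also have "\<dots> = (\<integral>X\<in>B. 1 / real (npaths n t (p t)) \<partial>M)"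
    unfolding set_lebesgue_integral_def
  proof (rule integral_cong_AE)
    have BM: "B \<in> sets M"
      using B subalg by (auto simp: subalgebra_def)
    have m: "real_cond_exp M ?F (indicator (cyl n 0 t p)) \<in> borel_measurable M"
      by (rule borel_measurable_cond_exp2)
    show "(\<lambda>X. indicat_real B X *\<^sub>R real_cond_exp M ?F (indicator (cyl n 0 t p)) X) \<in> borel_measurable M"
      using m BM by measurable
    show "(\<lambda>X. indicat_real B X *\<^sub>R (1 / real (npaths n t (p t)))) \<in> borel_measurable M"
      using BM by measurable
    show "AE X in M. indicat_real B X *\<^sub>R real_cond_exp M ?F (indicator (cyl n 0 t p)) X =
        indicat_real B X *\<^sub>R (1 / real (npaths n t (p t)))"
      using ae
    proof eventually_elim
      case (elim X)
      show ?case
      proof (cases "X \<in> B")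
        case True
        then have X: "X \<in> paths n" "discr n X t = p t"
          by (auto simp: B_def)
        have "{q \<in> dpaths n t. q t = p t \<and> interp n {0..real t} q \<in> A} = {p}"
        proof -
          have "q = p" if "q \<in> dpaths n t" "interp n {0..real t} q = interp n {0..real t} p" for q
            using prefix_interp[OF that(1) order.refl] prefix_interp[OF p order.refl] that(2) by metis
          then show ?thesis using p by (auto simp: A_def)
        qed
        then have "measure (nu n t (\<lambda>i. X i (real t))) A = 1 / real (npaths n t (p t))"
          using measure_nu_path[OF X(1), of A t] pi X(2) by (simp add: A_def)
        then show ?thesis using elim by simp
      qed simp
    qed
  qed
  also have "\<dots> = measure M B / real (npaths n t (p t))"
    using B subalg by (subst set_integral_const) (auto simp: subalgebra_def emeasure_eq_measure)
  finally have "measure M (cyl n 0 t p) = measure M B / real (npaths n t (p t))" .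
  moreover have "npaths n t (p t) \<noteq> 0"
    using p finite_subset[OF _ finite_dpaths, of "{q \<in> dpaths n t. q t = p t}" n t] unfolding npaths_def by auto
  ultimately show ?thesis
    by (simp add: B_def)
qed

section \<open>Prefix probabilities that give a Gibbs measure\<close>

lemma join_dpaths:
  assumes p: "p \<in> dpaths n t" and q: "q \<in> dpaths n m" and "t \<le> m" "p t = q t"
  shows "(\<lambda>j. if j \<le> t then p j else q j) \<in> dpaths n m"
proof (rule dpathsI)
  show "(if 0 \<le> t then p 0 else q 0) = (\<lambda>_. 0)"
    using dtraj_0[OF dpaths_dtraj[OF p]] by simp
  show "(if Suc j \<le> t then p (Suc j) else q (Suc j)) \<in> up n (if j \<le> t then p j else q j)" for j
  proof -
    consider "Suc j \<le> t" | "j = t" | "j > t" by linarith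
    then show ?thesis
      using dtraj_up[OF dpaths_dtraj[OF p], of j] dtraj_up[OF dpaths_dtraj[OF q], of j] assms(4) by cases auto
  qed
  show "(if j \<le> t then p j else q j) = (if m \<le> t then p m else q m)" if "m \<le> j" for j
  proof (cases "j \<le> t")
    case True
    then have "j = t" "m = t" using that assms(3) by auto
    then show ?thesis by simp
  next
    case False
    have "q j = q m" by (rule dpaths_frozen[OF q that])
    then show ?thesis using False assms(3,4) by (cases "m = t") auto
  qed
qed

text \<open>
  A condition on the prefix and a prescribed continuation decompose into the full prefixes of length
  \<open>m\<close> obtained by joining the two; all of these end at \<open>q m\<close> and therefore
  have the same probability.
\<close>
lemma measure_prefix_and_tail:
  assumes M: "prob_space M" and sets: "sets M = sets (path_space n {0..})"
    and law: "\<And>t p. p \<in> dpaths n t \<Longrightarrow> measure M (cyl n 0 t p) = w t (p t)"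
    and q: "q \<in> dpaths n m" and tm: "t \<le> m"
  shows "measure M ({X \<in> paths n. prefix n t X \<in> S} \<inter> cyl n t m q)
       = real (card {p \<in> dpaths n t. p t = q t \<and> p \<in> S}) * w m (q m)"
proof -
  interpret prob_space M by fact
  define P where "P = {p \<in> dpaths n t. p t = q t \<and> p \<in> S}"
  define jn where "jn p = (\<lambda>j. if j \<le> t then p j else q j)" for p
  have jn: "jn p \<in> dpaths n m" if "p \<in> P" for p
    unfolding jn_def using that by (intro join_dpaths[OF _ q tm]) (auto simp: P_def)
  have jnm: "jn p m = q m" if "p \<in> P" for p
    using that tm by (auto simp: jn_def P_def)
  have fin: "finite P"
    by (rule finite_subset[OF _ finite_dpaths[of n t]]) (auto simp: P_def)
  have cyl_iff: "X \<in> cyl n 0 m (jn p) \<longleftrightarrow> X \<in> paths n \<and> prefix n t X = p \<and> X \<in> cyl n t m q"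
    if p: "p \<in> P" for X p
  proof -
    have "prefix n t X = p \<longleftrightarrow> (\<forall>j\<le>t. discr n X j = p j)"
    proof
      assume r: "\<forall>j\<le>t. discr n X j = p j"
      show "prefix n t X = p"
      proof
        fix j
        have "prefix n t X j = p (min j t)"
          using r by (simp add: prefix_def)
        also have "\<dots> = p j"
          using dpaths_frozen[of p n t j] p by (cases "j \<le> t") (auto simp: P_def min_def)
        finally show "prefix n t X j = p j" .
      qed
    qed (auto simp: prefix_def)
    moreover have "(\<forall>j\<in>{0..m}. discr n X j = jn p j) \<longleftrightarrow>
        (\<forall>j\<le>t. discr n X j = p j) \<and> (\<forall>j\<in>{t..m}. discr n X j = q j)"
    proof safe
      fix j assume *: "\<forall>j\<in>{0..m}. discr n X j = jn p j"
      show "discr n X j = p j" if "j \<le> t"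
        using * that tm by (simp add: jn_def)
      show "discr n X j = q j" if "j \<in> {t..m}"
        using bspec[OF *, of j] that p by (cases "j = t") (auto simp: jn_def P_def)
    next
      fix j assume "\<forall>j\<le>t. discr n X j = p j" "\<forall>j\<in>{t..m}. discr n X j = q j" "j \<in> {0..m}"
      then show "discr n X j = jn p j"
        by (auto simp: jn_def)
    qed
    ultimately show ?thesis
      by (auto simp: cyl_def)
  qed
  have "{X \<in> paths n. prefix n t X \<in> S} \<inter> cyl n t m q = (\<Union>p\<in>P. cyl n 0 m (jn p))"
  proof (rule set_eqI)
    fix X
    have "X \<in> (\<Union>p\<in>P. cyl n 0 m (jn p)) \<longleftrightarrow> (\<exists>p\<in>P. X \<in> paths n \<and> prefix n t X = p \<and> X \<in> cyl n t m q)"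
      using cyl_iff by auto
    also have "\<dots> \<longleftrightarrow> X \<in> paths n \<and> prefix n t X \<in> P \<and> X \<in> cyl n t m q"
      by auto
    also have "\<dots> \<longleftrightarrow> X \<in> paths n \<and> prefix n t X \<in> S \<and> X \<in> cyl n t m q"
      using prefix_inf[of X n t] tm by (auto simp: P_def cyl_def prefix_def)
    finally show "X \<in> {X \<in> paths n. prefix n t X \<in> S} \<inter> cyl n t m q \<longleftrightarrow> X \<in> (\<Union>p\<in>P. cyl n 0 m (jn p))"
      by auto
  qed
  also have "measure M (\<Union>p\<in>P. cyl n 0 m (jn p)) = (\<Sum>p\<in>P. measure M (cyl n 0 m (jn p)))"
  proof (rule finite_measure_finite_Union[OF fin])
    show "(\<lambda>p. cyl n 0 m (jn p)) ` P \<subseteq> sets M"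
      using cyl_measurable[OF _ dpaths_dtraj[OF jn], of 0 m] by (auto simp: sets sets_path_space_eq_tail)
    show "disjoint_family_on (\<lambda>p. cyl n 0 m (jn p)) P"
      using cyl_iff by (auto simp: disjoint_family_on_def)
  qed
  also have "\<dots> = (\<Sum>p\<in>P. w m (q m))"
    using law[OF jn] jnm by (intro sum.cong) auto
  finally show ?thesis
    by (simp add: P_def)
qed

text \<open>
  It has to be shown that the indicator of a prefix event and the uniform probability of that event
  given the current endpoint have the same integral over every tail event. For tail cylinder events
  this is a count of prefixes, by \<open>measure_prefix_and_tail\<close>, and cylinder events generate.
\<close>
lemma gibbs_of_law:
  assumes M: "prob_space M" and sets: "sets M = sets (path_space n {0..})"
    and law: "\<And>t p. p \<in> dpaths n t \<Longrightarrow> measure M (cyl n 0 t p) = w t (p t)"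
  shows "bernoulli_gibbs n M"
proof -
  interpret prob_space M by fact
  have space: "space M = paths n"
    using sets_eq_imp_space_eq[OF sets] by simp
  have "cond_distr_given M (path_space n {0..real t}) (restrict_paths n {0..real t})
          (eval_algebra n {real t..}) (restrict_paths n {real t..}) (\<lambda>X. nu n t (\<lambda>i. X i (real t)))" for t
    unfolding cond_distr_given_def
  proof (intro conjI ballI)
    let ?F = "tail_algebra n t" and ?Y = "restrict_paths n {0..real t}"
    show Y: "?Y \<in> measurable M (path_space n {0..real t})"
      using restrict_paths_measurable_prefix[of n t] by (simp add: measurable_def sets space)
    show "restrict_paths n {real t..} \<in> measurable M (eval_algebra n {real t..})"
      using restrict_paths_measurable_tail[of n t] by (simp add: measurable_def sets space)
    fix A assume A: "A \<in> sets (path_space n {0..real t})"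
    then have Asub: "A \<subseteq> ordered_paths n {0..real t}"
      using sets.sets_into_space by fastforce
    define S where "S = {p \<in> dpaths n t. interp n {0..real t} p \<in> A}"
    define E where "E = {X \<in> paths n. prefix n t X \<in> S}"
    define h where "h y = real (card {p \<in> dpaths n t. p t = y \<and> p \<in> S}) / real (npaths n t y)" for y
    have subalg: "subalgebra M ?F"
      using sets_tail_subset[of n t] by (auto simp: subalgebra_def space sets)
    interpret finite_measure_subalgebra M ?F
      by unfold_locales (rule subalg)
    have E: "?Y -` A \<inter> space M = E"
      unfolding E_def S_def space using prefix_inf[of _ n t] by (auto simp: restrict_paths_eq_interp)
    have EM: "E \<in> sets M"
      using measurable_sets[OF Y A] by (simp add: E)
    have nu: "measure (nu n t (\<lambda>i. X i (real t))) A = h (discr n X t)" if "X \<in> space M" for X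
    proof -
      have "{p \<in> dpaths n t. p t = discr n X t \<and> interp n {0..real t} p \<in> A} = {p \<in> dpaths n t. p t = discr n X t \<and> p \<in> S}"
        by (auto simp: S_def)
      then show ?thesis
        using measure_nu_path[OF _ Asub, of X] that by (simp add: h_def space)
    qed
    have h01: "0 \<le> h y" "h y \<le> 1" for y
    proof -
      have "card {p \<in> dpaths n t. p t = y \<and> p \<in> S} \<le> npaths n t y"
        unfolding npaths_def by (rule card_mono) (auto intro: finite_subset[OF _ finite_dpaths[of n t]])
      then show "0 \<le> h y" "h y \<le> 1"
        by (auto simp: h_def divide_le_eq_1)
    qed
    have hF: "(\<lambda>X. h (discr n X t)) \<in> borel_measurable ?F"
    proof -
      have "(\<lambda>X. \<Sum>y\<in>(\<lambda>p. p t) ` dpaths n t. indicator {X \<in> paths n. discr n X t = y} X * h y) \<in> borel_measurable ?F"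
        by (intro borel_measurable_sum borel_measurable_times borel_measurable_const borel_measurable_indicator
              discr_level_measurable) (auto intro: dtraj_shapes dpaths_dtraj)
      also have "?this \<longleftrightarrow> ?thesis"
      proof (rule measurable_cong)
        fix X assume "X \<in> space ?F"
        then have X: "X \<in> paths n" by simp
        then have "discr n X t \<in> (\<lambda>p. p t) ` dpaths n t"
          using prefix_inf[OF X, of t] by (auto simp: prefix_def intro!: image_eqI[of _ _ "prefix n t X"])
        then have "(\<Sum>y\<in>(\<lambda>p. p t) ` dpaths n t. indicator {X \<in> paths n. discr n X t = y} X * h y)
            = (\<Sum>y\<in>{discr n X t}. h y)"
          using X by (intro sum.mono_neutral_cong_right) (auto simp: finite_dpaths)
        then show "(\<Sum>y\<in>(\<lambda>p. p t) ` dpaths n t. indicator {X \<in> paths n. discr n X t = y} X * h y) = h (discr n X t)"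
          by simp
      qed
      finally show ?thesis .
    qed
    have hM: "(\<lambda>X. h (discr n X t)) \<in> borel_measurable M"
      by (rule measurable_from_subalg[OF subalg hF])
    have int_h: "integrable M (\<lambda>X. h (discr n X t))"
      by (rule integrable_const_bound[of _ 1]) (use hM h01 in auto)
    have int_E: "integrable M (indicat_real E)"
      using EM by (intro integrable_real_indicator) (auto simp: emeasure_eq_measure)
    \<comment> \<open>As measures on the tail sigma-algebra, the two candidates for the integrals can be compared on a
      generator.\<close>
    define D1 where "D1 = restr_to_subalg (density M (indicator E)) ?F"
    define D2 where "D2 = restr_to_subalg (density M (\<lambda>X. ennreal (h (discr n X t)))) ?F"
    have sub1: "subalgebra (density M (indicator E)) ?F" and sub2: "subalgebra (density M (\<lambda>X. ennreal (h (discr n X t)))) ?F"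
      using subalg by (auto simp: subalgebra_def)
    have FM: "B \<in> sets M" if "B \<in> sets ?F" for B
      using that subalg by (auto simp: subalgebra_def)
    have D1: "emeasure D1 B = ennreal (measure M (E \<inter> B))" if "B \<in> sets ?F" for B
    proof -
      have "emeasure D1 B = (\<integral>\<^sup>+X. indicator E X * indicator B X \<partial>M)"
        unfolding D1_def emeasure_restr_to_subalg[OF sub1 that]
        using EM FM[OF that] by (intro emeasure_density) auto
      also have "\<dots> = emeasure M (E \<inter> B)"
        using EM FM[OF that] by (simp add: indicator_inter_arith[symmetric])
      finally show ?thesis by (simp add: emeasure_eq_measure)
    qed
    have D2: "emeasure D2 B = ennreal (\<integral>X\<in>B. h (discr n X t) \<partial>M)" if "B \<in> sets ?F" for B
    proof -
      have "emeasure D2 B = (\<integral>\<^sup>+X. ennreal (h (discr n X t)) * indicator B X \<partial>M)"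
        unfolding D2_def emeasure_restr_to_subalg[OF sub2 that]
        using hM FM[OF that] by (intro emeasure_density) auto
      also have "\<dots> = (\<integral>\<^sup>+X. ennreal (indicator B X * h (discr n X t)) \<partial>M)"
        by (intro nn_integral_cong) (auto split: split_indicator)
      also have "\<dots> = ennreal (\<integral>X. indicator B X * h (discr n X t) \<partial>M)"
        using integrable_mult_indicator[OF FM[OF that] int_h] h01
        by (intro nn_integral_eq_integral) (auto split: split_indicator)
      finally show ?thesis by (simp add: set_lebesgue_integral_def)
    qed
    have basic: "emeasure D1 (cyl n t m q) = emeasure D2 (cyl n t m q)" if m: "t \<le> m" and q: "q \<in> dpaths n m" for m q
    proof -
      have C: "cyl n t m q \<in> sets ?F"
        by (rule cyl_measurable[OF m dpaths_dtraj[OF q]])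
      have *: "measure M (E \<inter> cyl n t m q) = real (card {p \<in> dpaths n t. p t = q t \<and> p \<in> S}) * w m (q m)"
        unfolding E_def by (rule measure_prefix_and_tail[OF M sets law q m])
      have **: "measure M (cyl n t m q) = real (npaths n t (q t)) * w m (q m)"
      proof -
        have "{X \<in> paths n. prefix n t X \<in> UNIV} \<inter> cyl n t m q = cyl n t m q"
          by (auto simp: cyl_def)
        then show ?thesis
          using measure_prefix_and_tail[OF M sets law q m, of UNIV] by (simp add: npaths_def)
      qed
      have np: "npaths n t (q t) \<noteq> 0"
      proof -
        have "(\<lambda>j. q (min j t)) \<in> {p \<in> dpaths n t. p t = q t}"
          using dtraj_stop[OF dpaths_dtraj[OF q]] by simp
        then show ?thesis
          unfolding npaths_def by (subst card_0_eq) (auto intro: finite_subset[OF _ finite_dpaths])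
      qed
      have "(\<integral>X\<in>cyl n t m q. h (discr n X t) \<partial>M) = (\<integral>X\<in>cyl n t m q. h (q t) \<partial>M)"
      proof (rule set_lebesgue_integral_cong[OF FM[OF C]], intro allI impI)
        fix X assume "X \<in> cyl n t m q"
        then have "discr n X t = q t"
          using m by (simp add: cyl_def)
        then show "h (discr n X t) = h (q t)" by simp
      qed
      also have "\<dots> = measure M (cyl n t m q) * h (q t)"
        using FM[OF C] by (subst set_integral_const) (auto simp: emeasure_eq_measure)
      also have "\<dots> = measure M (E \<inter> cyl n t m q)"
        using np unfolding * ** h_def by simp
      finally show ?thesis
        using D1[OF C] D2[OF C] by simp
    qed
    have "D1 = D2"
    proof (rule measure_eqI_generator_eq_countable[OF Int_stable_cyls[of n t] cyls_subset])
      show "emeasure D1 X = emeasure D2 X" if "X \<in> cyls n t" for X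
        using that basic by (auto simp: cyls_def)
      show "sets D1 = sigma_sets (paths n) (cyls n t)" "sets D2 = sigma_sets (paths n) (cyls n t)"
        using sets_restr_to_subalg[OF sub1] sets_restr_to_subalg[OF sub2] by (simp_all add: D1_def D2_def sets_tail_eq)
      show "(\<lambda>p. cyl n t t p) ` dpaths n t \<subseteq> cyls n t"
        by (auto simp: cyls_def)
      show "\<Union> ((\<lambda>p. cyl n t t p) ` dpaths n t) = paths n"
        using cyl_prefix[of _ n t t] prefix_inf[of _ n t] by (auto simp: cyl_def)
      show "countable ((\<lambda>p. cyl n t t p) ` dpaths n t)"
        by (intro countable_finite finite_imageI finite_dpaths)
      show "emeasure D1 a \<noteq> \<infinity>" if "a \<in> (\<lambda>p. cyl n t t p) ` dpaths n t" for a
        using that D1[OF cyl_measurable[OF order.refl dpaths_dtraj]] by auto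
    qed
    have "AE X in M. real_cond_exp M ?F (indicator E) X = h (discr n X t)"
    proof (rule real_cond_exp_charact)
      fix B assume B: "B \<in> sets ?F"
      have "ennreal (measure M (E \<inter> B)) = ennreal (\<integral>X\<in>B. h (discr n X t) \<partial>M)"
        using D1[OF B] D2[OF B] \<open>D1 = D2\<close> by simp
      moreover have "0 \<le> (\<integral>X\<in>B. h (discr n X t) \<partial>M)"
        unfolding set_lebesgue_integral_def using h01 by (intro integral_nonneg_AE) auto
      ultimately have "(\<integral>X\<in>B. h (discr n X t) \<partial>M) = measure M (E \<inter> B)"
        by simp
      also have "\<dots> = (\<integral>X\<in>B. indicator E X \<partial>M)"
      proof -
        have "(\<lambda>X. indicator B X *\<^sub>R indicator E X) = (indicator (E \<inter> B) :: _ \<Rightarrow> real)"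
          by (auto simp: fun_eq_iff split: split_indicator)
        then show ?thesis
          using EM FM[OF B] by (simp add: set_lebesgue_integral_def)
      qed
      finally show "(\<integral>X\<in>B. indicator E X \<partial>M) = (\<integral>X\<in>B. h (discr n X t) \<partial>M)" by simp
    qed (use int_h int_E hF in auto)
    then show "AE X in M. real_cond_exp M (vimage_algebra (space M) (restrict_paths n {real t..}) (eval_algebra n {real t..}))
        (indicator (?Y -` A \<inter> space M)) X = measure (nu n t (\<lambda>i. X i (real t))) A"
      unfolding E using nu by (auto simp: space tail_algebra_def)
  qed
  then show ?thesis
    using M sets by (simp add: bernoulli_gibbs_def)
qed

section \<open>From harmonic weights to a path measure\<close>

text \<open>
  The Ionescu-Tulcea theorem for the transition kernels \<open>K\<close>. All subsets of the
  state space are taken to be measurable; this is harmless since every transition law is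
  discrete.
\<close>
lemma markov_chain_exists:
  fixes K :: "nat \<Rightarrow> 's \<Rightarrow> 's pmf" and s0 :: 's
  shows "\<exists>L. prob_space L \<and> sets L = sets (PiM (UNIV :: nat set) (\<lambda>_. count_space (UNIV :: 's set))) \<and>
    (\<forall>t p. p 0 = s0 \<longrightarrow> emeasure L {\<omega>. \<forall>j\<le>t. \<omega> j = p j} = (\<Prod>j<t. ennreal (pmf (K j (p j)) (p (Suc j)))))"
proof -
  define Q :: "nat \<Rightarrow> (nat \<Rightarrow> 's) \<Rightarrow> 's pmf" where
    "Q i \<omega> = (case i of 0 \<Rightarrow> return_pmf s0 | Suc m \<Rightarrow> K m (\<omega> m))" for i \<omega>
  let ?M = "\<lambda>_::nat. count_space (UNIV :: 's set)"
  have meas: "(\<lambda>\<omega>. measure_pmf (Q i \<omega>)) \<in> measurable (PiM {0..<i} ?M) (subprob_algebra (count_space UNIV))" for i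
  proof (cases i)
    case 0
    then show ?thesis
      using measure_pmf_in_subprob_algebra by (auto simp: Q_def)
  next
    case (Suc m)
    have "(\<lambda>\<omega>. measure_pmf (K m (\<omega> m))) \<in> measurable (PiM {0..<i} ?M) (subprob_algebra (count_space UNIV))"
      by (rule measurable_compose[OF measurable_component_singleton[of m "{0..<i}" ?M] measurable_measure_pmf])
         (simp add: Suc)
    then show ?thesis by (simp add: Q_def Suc)
  qed
  interpret IT: Ionescu_Tulcea "\<lambda>i \<omega>. measure_pmf (Q i \<omega>)" ?M
    by unfold_locales (auto simp: meas measure_pmf.prob_space_axioms)
  let ?u = "\<lambda>_::nat. undefined :: 's"
  have u: "?u \<in> space (PiM {0..<0} ?M)"
    by (simp add: space_PiM)
  have sing: "{restrict p {0..<k}} \<in> sets (PiM {0..<k} ?M)" for p k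
  proof -
    have "PiE {0..<k} (\<lambda>j. {restrict p {0..<k} j}) \<in> sets (PiM {0..<k} ?M)"
      by (rule sets_PiM_I_finite) auto
    then show ?thesis by (subst (asm) PiE_singleton) auto
  qed
  have C: "emeasure (IT.C 0 k ?u) {restrict p {0..<k}} = (\<Prod>j<k. ennreal (pmf (Q j p) (p j)))" for p k
  proof (induction k)
    case 0
    then show ?case
      using sing[of p 0] by (simp add: restrict_def[of _ "{}"])
  next
    case (Suc k)
    have "emeasure (IT.C 0 (Suc k) ?u) {restrict p {0..<Suc k}}
        = (\<integral>\<^sup>+\<omega>. emeasure (IT.eP k \<omega>) {restrict p {0..<Suc k}} \<partial>IT.C 0 k ?u)"
      using sing[of p "Suc k"] IT.prob_space_C[OF u, of k] IT.measurable_eP[of k] IT.sets_C[OF u, of k]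
      by (simp, intro emeasure_bind) (auto dest: prob_space.not_empty simp: measurable_cong_sets[OF IT.sets_C[OF u] refl])
    also have "\<dots> = (\<integral>\<^sup>+\<omega>. ennreal (pmf (Q k p) (p k)) * indicator {restrict p {0..<k}} \<omega> \<partial>IT.C 0 k ?u)"
    proof (rule nn_integral_cong)
      fix \<omega> assume "\<omega> \<in> space (IT.C 0 k ?u)"
      then have w: "\<omega> \<in> space (PiM {0..<k} ?M)"
        using IT.space_C[OF u, of k] by simp
      have "emeasure (IT.eP k \<omega>) {restrict p {0..<Suc k}}
          = emeasure (measure_pmf (Q k \<omega>)) ((fun_upd \<omega> k) -` {restrict p {0..<Suc k}} \<inter> space (?M k))"
        by (rule IT.emeasure_eP[OF w sing])
      also have "(fun_upd \<omega> k) -` {restrict p {0..<Suc k}} \<inter> space (?M k)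
          = (if \<omega> = restrict p {0..<k} then {p k} else {})"
      proof -
        have "fun_upd \<omega> k x = restrict p {0..<Suc k} \<longleftrightarrow> \<omega> = restrict p {0..<k} \<and> x = p k" for x
        proof
          assume eq: "fun_upd \<omega> k x = restrict p {0..<Suc k}"
          have "\<omega> j = restrict p {0..<k} j" for j
          proof (cases "j < k")
            case True
            then show ?thesis using fun_cong[OF eq, of j] by simp
          next
            case False
            have "\<omega> \<in> extensional {0..<k}"
              using w by (simp add: space_PiM PiE_def)
            from extensional_arb[OF this, of j] show ?thesis
              using False by simp
          qed
          then have "\<omega> = restrict p {0..<k}"
            by (rule ext)
          moreover have "x = p k"
            using fun_cong[OF eq, of k] by simp
          ultimately show "\<omega> = restrict p {0..<k} \<and> x = p k" ..
        next
          assume a: "\<omega> = restrict p {0..<k} \<and> x = p k"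
          show "fun_upd \<omega> k x = restrict p {0..<Suc k}"
          proof
            fix j
            show "fun_upd \<omega> k x j = restrict p {0..<Suc k} j"
              unfolding conjunct1[OF a] conjunct2[OF a] by (cases "j < k") (auto simp: less_Suc_eq)
          qed
        qed
        then have "(fun_upd \<omega> k) -` {restrict p {0..<Suc k}} = {x. \<omega> = restrict p {0..<k} \<and> x = p k}"
          unfolding vimage_def by simp
        then show ?thesis
          by (cases "\<omega> = restrict p {0..<k}") simp_all
      qed
      also have "emeasure (measure_pmf (Q k \<omega>)) (if \<omega> = restrict p {0..<k} then {p k} else {})
          = ennreal (pmf (Q k p) (p k)) * indicator {restrict p {0..<k}} \<omega>"
      proof (cases "\<omega> = restrict p {0..<k}")
        case True
        then have "Q k \<omega> = Q k p"
          by (cases k) (simp_all add: Q_def)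
        then show ?thesis using True by (simp add: emeasure_pmf_single)
      qed simp
      finally show "emeasure (IT.eP k \<omega>) {restrict p {0..<Suc k}}
          = ennreal (pmf (Q k p) (p k)) * indicator {restrict p {0..<k}} \<omega>" .
    qed
    also have "\<dots> = ennreal (pmf (Q k p) (p k)) * emeasure (IT.C 0 k ?u) {restrict p {0..<k}}"
      using sing[of p k] IT.sets_C[OF u, of k] by (intro nn_integral_cmult_indicator) simp
    finally show ?case
      by (simp only: Suc prod.lessThan_Suc mult.commute)
  qed
  have lim: "emeasure IT.PF.lim {\<omega>. \<forall>j\<le>t. \<omega> j = p j} = (\<Prod>j<Suc t. ennreal (pmf (Q j p) (p j)))" for t p
  proof -
    let ?J = "{0..<Suc t}"
    have "{\<omega>. \<forall>j\<le>t. \<omega> j = p j} = IT.PF.emb UNIV ?J {restrict p ?J}"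
    proof (rule set_eqI)
      fix \<omega> :: "nat \<Rightarrow> 's"
      have "restrict \<omega> ?J = restrict p ?J \<longleftrightarrow> (\<forall>j\<le>t. \<omega> j = p j)"
      proof (intro iffI allI impI)
        fix j assume e: "restrict \<omega> ?J = restrict p ?J" and j: "j \<le> t"
        show "\<omega> j = p j"
          using fun_cong[OF e, of j] j by simp
      qed (intro restrict_ext, simp)
      then show "\<omega> \<in> {\<omega>. \<forall>j\<le>t. \<omega> j = p j} \<longleftrightarrow> \<omega> \<in> IT.PF.emb UNIV ?J {restrict p ?J}"
        by (simp only: prod_emb_def space_PiM) simp
    qed
    then have "emeasure IT.PF.lim {\<omega>. \<forall>j\<le>t. \<omega> j = p j} = emeasure IT.PF.lim (IT.PF.emb UNIV ?J {restrict p ?J})"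
      by (rule arg_cong)
    also have "\<dots> = emeasure (IT.CI ?J) {restrict p ?J}"
      by (rule IT.lim[OF finite_atLeastLessThan sing])
    also have "\<dots> = emeasure (IT.C 0 (Suc t) ?u) (IT.PF.emb ?J ?J {restrict p ?J})"
      by (rule IT.emeasure_CI[OF order.refl sing])
    also have "IT.PF.emb ?J ?J {restrict p ?J} = {restrict p ?J}"
      by (rule prod_emb_id) auto
    finally show ?thesis
      unfolding C .
  qed
  have prob: "prob_space IT.PF.lim"
  proof (rule prob_space_distrD)
    show "(\<lambda>x. restrict x {}) \<in> measurable IT.PF.lim (PiM {} ?M)"
      unfolding measurable_cong_sets[OF IT.PF.sets_lim refl] by (rule measurable_restrict_subset) simp
    show "prob_space (distr IT.PF.lim (PiM {} ?M) (\<lambda>x. restrict x {}))"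
      unfolding IT.distr_lim[OF finite.emptyI] by (rule IT.PF.prob_space_P) auto
  qed
  have "(\<Prod>j<Suc t. ennreal (pmf (Q j p) (p j))) = (\<Prod>j<t. ennreal (pmf (K j (p j)) (p (Suc j))))"
    if "p 0 = s0" for t p
    using that by (subst prod.lessThan_Suc_shift) (simp add: Q_def)
  then show ?thesis
    using lim prob IT.PF.sets_lim by (intro exI[of _ IT.PF.lim]) auto
qed

text \<open>
  The sequence of states corrected so that it always is a legal sequence of partitions: an illegal
  state is ignored. Every outcome of the Markov chain then gives a path, and legal outcomes
  are not changed.
\<close>
definition follow :: "nat \<Rightarrow> (nat \<Rightarrow> nat \<Rightarrow> nat) \<Rightarrow> nat \<Rightarrow> nat \<Rightarrow> nat" where
  "follow n \<omega> = rec_nat (\<lambda>_. 0) (\<lambda>j l. if \<omega> (Suc j) \<in> up n l then \<omega> (Suc j) else l)"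

lemma follow_simps [simp]:
  "follow n \<omega> 0 = (\<lambda>_. 0)"
  "follow n \<omega> (Suc j) = (if \<omega> (Suc j) \<in> up n (follow n \<omega> j) then \<omega> (Suc j) else follow n \<omega> j)"
  by (simp_all add: follow_def)

lemma follow_shapes: "follow n \<omega> j \<in> shapes n"
  by (induction j) (auto simp: shapes_def up_def)

lemma follow_dtraj: "follow n \<omega> \<in> dtraj n"
  using up_refl[OF follow_shapes] by (auto simp: dtraj_def)

lemma follow_eq:
  assumes p: "p \<in> dtraj n"
  shows "\<forall>j\<le>t. \<omega> j = p j \<Longrightarrow> j \<le> t \<Longrightarrow> follow n \<omega> j = p j"
proof (induction j)
  case 0
  then show ?case using dtraj_0[OF p] by simp
next
  case (Suc j)
  then show ?case using dtraj_up[OF p, of j] by simp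
qed

text \<open>
  The state space is uncountable as a type, but the corrected sequence takes only
  finitely many values at each time.
\<close>
lemma measurable_follow:
  "(\<lambda>\<omega>. follow n \<omega> j) \<in> measurable (PiM UNIV (\<lambda>_. count_space UNIV)) (count_space UNIV)"
proof (induction j)
  case (Suc j)
  note [measurable] = Suc
  have fin: "finite (range (\<lambda>p::nat \<Rightarrow> nat \<Rightarrow> nat. follow n p j))"
  proof (rule finite_subset)
    show "range (\<lambda>p. follow n p j) \<subseteq> (\<lambda>p. p j) ` dpaths n j"
      using dtraj_stop[OF follow_dtraj, of n _ j] by (auto intro!: image_eqI[of _ _ "\<lambda>i. follow n _ (min i j)"])
  qed (simp add: finite_dpaths)
  have c: "(\<lambda>\<omega>. \<omega> (Suc j)) \<in> measurable (PiM UNIV (\<lambda>_. count_space UNIV)) (count_space (UNIV :: (nat \<Rightarrow> nat) set))"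
    by (rule measurable_component_singleton) simp
  have "(\<lambda>\<omega>. (\<lambda>l. if \<omega> (Suc j) \<in> up n l then \<omega> (Suc j) else l) (follow n \<omega> j))
      \<in> measurable (PiM UNIV (\<lambda>_. count_space UNIV)) (count_space UNIV)"
  proof (rule measurable_compose_countable'[where I = "range (\<lambda>p. follow n p j)" and g = "\<lambda>\<omega>. follow n \<omega> j"])
    show "(\<lambda>\<omega>. if \<omega> (Suc j) \<in> up n l then \<omega> (Suc j) else l) \<in> measurable (PiM UNIV (\<lambda>_. count_space UNIV)) (count_space UNIV)" for l
      by (rule measurable_compose[OF c]) simp
    show "(\<lambda>\<omega>. follow n \<omega> j) \<in> measurable (PiM UNIV (\<lambda>_. count_space UNIV)) (count_space (range (\<lambda>p. follow n p j)))"
      using Suc by (auto simp: measurable_def)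
  qed (use fin in \<open>simp add: countable_finite\<close>)
  then show ?case by simp
qed simp

text \<open>
  A prefix of length \<open>t + 1\<close> is a prefix of length \<open>t\<close> together with a last
  step.
\<close>
lemma sum_dpaths_Suc:
  fixes f :: "(nat \<Rightarrow> nat) \<Rightarrow> real"
  shows "(\<Sum>p\<in>dpaths n (Suc t). f (p (Suc t))) = (\<Sum>p\<in>dpaths n t. \<Sum>l\<in>up n (p t). f l)"
proof -
  let ?ext = "\<lambda>x. case x of (p, l) \<Rightarrow> \<lambda>j. if j \<le> t then p j else l"
  have "(\<Sum>p\<in>dpaths n t. \<Sum>l\<in>up n (p t). f l) = (\<Sum>(p, l)\<in>Sigma (dpaths n t) (\<lambda>p. up n (p t)). f l)"
    by (rule sum.Sigma) (auto simp: finite_dpaths finite_up)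
  also have "\<dots> = (\<Sum>p\<in>dpaths n (Suc t). f (p (Suc t)))"
  proof (rule sum.reindex_bij_witness[where i = "\<lambda>p. (\<lambda>j. p (min j t), p (Suc t))"
        and j = "\<lambda>(p, l) j. if j \<le> t then p j else l"])
    fix x assume x: "x \<in> Sigma (dpaths n t) (\<lambda>p. up n (p t))"
    obtain p l where xe: "x = (p, l)" by (cases x)
    then have p: "p \<in> dpaths n t" and l: "l \<in> up n (p t)" using x by auto
    have "p (min j t) = p j" for j
      using dpaths_frozen[OF p, of j] by (cases "t \<le> j") (simp_all add: min_def)
    then show "(\<lambda>j. ?ext x (min j t),
        ?ext x (Suc t)) = x"
      by (simp add: xe)
    have "(\<lambda>j. if j \<le> t then p j else l) \<in> dpaths n (Suc t)"
    proof (rule dpathsI)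
      show "(if 0 \<le> t then p 0 else l) = (\<lambda>_. 0)"
        using dtraj_0[OF dpaths_dtraj[OF p]] by simp
      show "(if Suc j \<le> t then p (Suc j) else l) \<in> up n (if j \<le> t then p j else l)" for j
      proof -
        consider "Suc j \<le> t" | "j = t" | "j > t" by linarith
        then show ?thesis
          using dtraj_up[OF dpaths_dtraj[OF p], of j] l up_refl[of l n] by cases (auto simp: up_def)
      qed
    qed simp
    then show "?ext x \<in> dpaths n (Suc t)"
      by (simp add: xe)
    show "f (?ext x (Suc t)) = (case x of (p, l) \<Rightarrow> f l)"
      by (simp add: xe)
  next
    fix p assume p: "p \<in> dpaths n (Suc t)"
    show "(\<lambda>j. p (min j t), p (Suc t)) \<in> Sigma (dpaths n t) (\<lambda>p. up n (p t))"
      using dtraj_stop[OF dpaths_dtraj[OF p], of t] dtraj_up[OF dpaths_dtraj[OF p], of t] by simp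
    show "(case (\<lambda>j. p (min j t), p (Suc t)) of (p, l) \<Rightarrow> \<lambda>j. if j \<le> t then p j else l) = p"
    proof
      fix j
      show "(case (\<lambda>j. p (min j t), p (Suc t)) of (p, l) \<Rightarrow> \<lambda>j. if j \<le> t then p j else l) j = p j"
        using dpaths_frozen[OF p, of j] by (cases "j \<le> t") auto
    qed
  qed
  finally show ?thesis by simp
qed

text \<open>
  The Markov chain with transition probabilities \<open>w (Suc t) l' / w t l\<close> has the
  required prefix probabilities by telescoping. For a prefix with positive weight this is immediate;
  the weight zero is absorbing, so for the other prefixes there is at least an inequality. It is
  enough to prove that each prefix has probability at least \<open>w t (p t)\<close>, since both sides
  add up to 1 over all prefixes of length \<open>t\<close>.
\<close>
lemma harmonic_measure_exists:
  fixes w :: "nat \<Rightarrow> (nat \<Rightarrow> nat) \<Rightarrow> real"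
  assumes w0: "w 0 (\<lambda>_. 0) = 1" and nn: "\<And>t l. 0 \<le> w t l"
    and harm: "\<And>t l. l \<in> shapes n \<Longrightarrow> l 1 \<le> t \<Longrightarrow> w t l = (\<Sum>l'\<in>up n l. w (Suc t) l')"
  shows "\<exists>M. prob_space M \<and> sets M = sets (path_space n {0..}) \<and>
    (\<forall>t p. p \<in> dpaths n t \<longrightarrow> measure M (cyl n 0 t p) = w t (p t))"
proof -
  define good where "good t l \<longleftrightarrow> l \<in> shapes n \<and> l 1 \<le> t \<and> 0 < w t l" for t l
  define k where "k t l l' = (if l' \<in> up n l then w (Suc t) l' / w t l else 0)" for t l l'
  \<comment> \<open>Where the quotient is not a probability distribution, the chain stays put.\<close>
  define K where "K t l = (if good t l then embed_pmf (k t l) else return_pmf l)" for t l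
  have pmf_K: "pmf (K t l) l' = k t l l'" if "good t l" for t l l'
  proof -
    have "pmf (embed_pmf (k t l)) l' = k t l l'"
    proof (rule pmf_embed_pmf)
      show "0 \<le> k t l l'" for l'
        using nn by (simp add: k_def)
      have "(\<integral>\<^sup>+l'. ennreal (k t l l') \<partial>count_space UNIV) = (\<Sum>l'\<in>up n l. ennreal (k t l l'))"
        by (rule nn_integral_count_space'[OF finite_up]) (auto simp: k_def)
      also have "\<dots> = ennreal (\<Sum>l'\<in>up n l. w (Suc t) l' / w t l)"
        using nn by (subst sum_ennreal[symmetric]) (auto simp: k_def)
      also have "(\<Sum>l'\<in>up n l. w (Suc t) l' / w t l) = 1"
        using that harm[of l t] by (simp add: sum_divide_distrib[symmetric] good_def)
      finally show "(\<integral>\<^sup>+l'. ennreal (k t l l') \<partial>count_space UNIV) = 1" by simp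
    qed
    then show ?thesis using that by (simp add: K_def)
  qed
  have prod: "w t (p t) \<le> (\<Prod>j<t. pmf (K j (p j)) (p (Suc j)))" if p: "p \<in> dtraj n" for t p
  proof (induction t)
    case 0
    then show ?case using w0 dtraj_0[OF p] by simp
  next
    case (Suc t)
    have sh: "p t \<in> shapes n" "p t 1 \<le> t"
      using dtraj_shapes[OF p] dtraj_le[OF p] by auto
    show ?case
    proof (cases "good t (p t)")
      case True
      then have "w (Suc t) (p (Suc t)) = w t (p t) * pmf (K t (p t)) (p (Suc t))"
        using dtraj_up[OF p, of t] by (simp add: pmf_K k_def good_def)
      also have "\<dots> \<le> (\<Prod>j<Suc t. pmf (K j (p j)) (p (Suc j)))"
        using Suc by (simp add: mult_right_mono)
      finally show ?thesis .
    next
      case False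
      then have "w t (p t) = 0"
        using sh nn[of t "p t"] by (auto simp: good_def)
      then have "(\<Sum>l'\<in>up n (p t). w (Suc t) l') = 0"
        using harm[OF sh] by simp
      then have "w (Suc t) (p (Suc t)) = 0"
        using nn dtraj_up[OF p, of t] by (subst (asm) sum_nonneg_eq_0_iff) (auto simp: finite_up)
      then show ?thesis by (simp add: prod_nonneg)
    qed
  qed
  obtain L where L: "prob_space L" "sets L = sets (PiM (UNIV :: nat set) (\<lambda>_. count_space (UNIV :: (nat \<Rightarrow> nat) set)))"
    and law: "\<And>t p. p 0 = (\<lambda>_. 0) \<Longrightarrow> emeasure L {\<omega>. \<forall>j\<le>t. \<omega> j = p j} = (\<Prod>j<t. ennreal (pmf (K j (p j)) (p (Suc j))))"
    using markov_chain_exists[of "\<lambda>_. 0" K] by blast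
  interpret L: prob_space L by fact
  have spL: "space L = UNIV"
    using sets_eq_imp_space_eq[OF L(2)] by (simp add: space_PiM)
  define \<Phi> where "\<Phi> \<omega> = interp n {0..} (follow n \<omega>)" for \<omega>
  have \<Phi>_in: "\<Phi> \<omega> \<in> paths n" for \<omega>
    unfolding \<Phi>_def by (rule interp_ordered[OF follow_dtraj]) auto
  have \<Phi>_discr: "discr n (\<Phi> \<omega>) j = follow n \<omega> j" for \<omega> j
    unfolding \<Phi>_def by (rule discr_interp[OF follow_dtraj]) simp
  have foll[measurable]: "(\<lambda>\<omega>. follow n \<omega> j) \<in> measurable L (count_space UNIV)" for j
    using measurable_follow[of n j] by (simp add: measurable_cong_sets[OF L(2) refl])
  have \<Phi>: "\<Phi> \<in> measurable L (path_space n {0..})"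
    unfolding path_space_def
  proof (rule measurable_restrict_space2)
    show "\<Phi> \<in> space L \<rightarrow> paths n"
      using \<Phi>_in by auto
    have r: "(\<lambda>\<omega>. real (follow n \<omega> j i)) \<in> borel_measurable L" for j i
      by (rule measurable_compose[OF foll]) simp
    have "(\<lambda>\<omega>. \<lambda>i\<in>{1..n}. \<lambda>s\<in>{0..}. plin (\<lambda>j. follow n \<omega> j i) s) \<in> measurable L (eval_algebra n {0..})"
      unfolding eval_algebra_def plin_def
      by (intro measurable_restrict borel_measurable_add borel_measurable_times borel_measurable_const r)
    then show "\<Phi> \<in> measurable L (eval_algebra n {0..})"
      by (simp add: \<Phi>_def[abs_def] interp_def)
  qed
  define M where "M = distr L (path_space n {0..}) \<Phi>"
  have M: "prob_space M" "sets M = sets (path_space n {0..})"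
    unfolding M_def using L.prob_space_distr[OF \<Phi>] by auto
  interpret M: prob_space M by (rule M(1))
  have cylM: "cyl n 0 t p \<in> sets M" if "p \<in> dpaths n t" for t p
    using cyl_measurable[OF _ dpaths_dtraj[OF that], of 0 t] by (simp add: M sets_path_space_eq_tail)
  have ge: "w t (p t) \<le> measure M (cyl n 0 t p)" if p: "p \<in> dpaths n t" for t p
  proof -
    have pd: "p \<in> dtraj n" by (rule dpaths_dtraj[OF p])
    have sub: "{\<omega>. \<forall>j\<le>t. \<omega> j = p j} \<subseteq> \<Phi> -` cyl n 0 t p \<inter> space L"
      using follow_eq[OF pd] \<Phi>_in by (auto simp: cyl_def \<Phi>_discr spL)
    \<comment> \<open>Only an inclusion of events: outcomes that need correction can also give the prefix \<open>p\<close>.\<close>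
    have "ennreal (w t (p t)) \<le> ennreal (\<Prod>j<t. pmf (K j (p j)) (p (Suc j)))"
      by (rule ennreal_leI[OF prod[OF pd]])
    also have "\<dots> = emeasure L {\<omega>. \<forall>j\<le>t. \<omega> j = p j}"
      using law[of p t] dtraj_0[OF pd] by (simp add: prod_ennreal)
    also have "\<dots> \<le> emeasure L (\<Phi> -` cyl n 0 t p \<inter> space L)"
      using measurable_sets[OF \<Phi>, of "cyl n 0 t p"] cylM[OF p] by (intro emeasure_mono[OF sub]) (simp add: M)
    also have "\<dots> = emeasure M (cyl n 0 t p)"
      unfolding M_def using cylM[OF p] by (intro emeasure_distr[symmetric, OF \<Phi>]) (simp add: M)
    finally show ?thesis
      using nn by (simp add: M.emeasure_eq_measure)
  qed
  have total_w: "(\<Sum>p\<in>dpaths n t. w t (p t)) = 1" for t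
  proof (induction t)
    case 0
    have "dpaths n 0 = {\<lambda>_ _. 0}"
    proof -
      have "q = (\<lambda>_ _. 0)" if "q \<in> dpaths n 0" for q
        using dpaths_eqI[OF that zero_dpaths] dtraj_0[OF dpaths_dtraj[OF that]] by simp
      then show ?thesis using zero_dpaths[of n 0] by blast
    qed
    then show ?case using w0 by simp
  next
    case (Suc t)
    have "(\<Sum>p\<in>dpaths n (Suc t). w (Suc t) (p (Suc t))) = (\<Sum>p\<in>dpaths n t. w t (p t))"
      unfolding sum_dpaths_Suc
    proof (intro sum.cong refl)
      fix p assume "p \<in> dpaths n t"
      then have "p \<in> dtraj n" by (rule dpaths_dtraj)
      then show "(\<Sum>l\<in>up n (p t). w (Suc t) l) = w t (p t)"
        by (intro harm[symmetric] dtraj_shapes dtraj_le)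
    qed
    then show ?case using Suc by simp
  qed
  have total_M: "(\<Sum>p\<in>dpaths n t. measure M (cyl n 0 t p)) = 1" for t
  proof -
    have "(\<Sum>p\<in>dpaths n t. measure M (cyl n 0 t p)) = measure M (\<Union>p\<in>dpaths n t. cyl n 0 t p)"
    proof (rule M.finite_measure_finite_Union[symmetric, OF finite_dpaths])
      show "cyl n 0 t ` dpaths n t \<subseteq> sets M"
        using cylM by auto
      show "disjoint_family_on (cyl n 0 t) (dpaths n t)"
        unfolding disjoint_family_on_def
      proof (intro ballI impI)
        fix p q assume pq: "p \<in> dpaths n t" "q \<in> dpaths n t" "p \<noteq> q"
        then obtain j i where "j \<le> t" "p j i \<noteq> q j i"
          using dpaths_eqI[OF pq(1,2)] by blast
        then show "cyl n 0 t p \<inter> cyl n 0 t q = {}"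
          by (force simp: cyl_def)
      qed
    qed
    also have "(\<Union>p\<in>dpaths n t. cyl n 0 t p) = space M"
      using cyl_prefix[of _ n 0 t] prefix_inf[of _ n t] sets_eq_imp_space_eq[OF M(2)] by (auto simp: cyl_def)
    finally show ?thesis by (simp add: M.prob_space)
  qed
  have "measure M (cyl n 0 t p) = w t (p t)" if p: "p \<in> dpaths n t" for t p
  proof (rule ccontr)
    assume "measure M (cyl n 0 t p) \<noteq> w t (p t)"
    then have "(\<Sum>p\<in>dpaths n t. w t (p t)) < (\<Sum>p\<in>dpaths n t. measure M (cyl n 0 t p))"
      using ge[OF p] p ge by (intro sum_strict_mono_ex1) (auto simp: finite_dpaths less_le intro!: bexI[of _ p])
    then show False
      by (simp add: total_w total_M)
  qed
  then show ?thesis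
    using M by blast
qed

section \<open>The law of large numbers\<close>

definition ends :: "nat \<Rightarrow> nat \<Rightarrow> (nat \<Rightarrow> nat) set" where
  "ends n t = (\<lambda>p. p t) ` dpaths n t"

abbreviation level :: "nat \<Rightarrow> nat \<Rightarrow> (nat \<Rightarrow> nat) \<Rightarrow> (nat \<Rightarrow> real \<Rightarrow> real) set" where
  "level n t l \<equiv> {X \<in> paths n. discr n X t = l}"

lemma finite_ends: "finite (ends n t)"
  by (simp add: ends_def finite_dpaths)

lemma ends_shapes: "l \<in> ends n t \<Longrightarrow> l \<in> shapes n"
  by (auto simp: ends_def intro: dtraj_shapes dpaths_dtraj)

lemma ends_le: "l \<in> ends n t \<Longrightarrow> l i \<le> t"
  by (auto simp: ends_def intro: dtraj_le dpaths_dtraj)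

lemma discr_ends: "X \<in> paths n \<Longrightarrow> discr n X t \<in> ends n t"
  using prefix_inf[of X n t] by (auto simp: ends_def prefix_def intro!: image_eqI[of _ _ "prefix n t X"])

lemma card_ends: "card (ends n t) \<le> (t + 1) ^ n"
proof -
  have "ends n t \<subseteq> {m. (\<forall>i. i \<notin> {1..n} \<longrightarrow> m i = 0) \<and> (\<forall>i\<in>{1..n}. m i \<le> t)}"
    using ends_shapes shapes_zero ends_le by blast
  from card_mono[OF finite_bounded this] card_bounded show ?thesis
    by (rule order.trans)
qed

lemma npaths_pos: "l \<in> ends n t \<Longrightarrow> 0 < npaths n t l"
  unfolding npaths_def ends_def by (subst card_gt_0_iff) (auto intro: finite_subset[OF _ finite_dpaths[of n t]])

locale path_measure = prob_space M for M :: "(nat \<Rightarrow> real \<Rightarrow> real) measure" +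
  fixes n :: nat
  assumes sets_M: "sets M = sets (path_space n {0..})"
begin

lemma space_M: "space M = paths n"
  using sets_eq_imp_space_eq[OF sets_M] by simp

lemma level_sets: "l \<in> shapes n \<Longrightarrow> level n t l \<in> sets M"
  using discr_level_measurable[of 0 t l n] by (simp add: sets_M sets_path_space_eq_tail)

lemma cyl_sets: "p \<in> dpaths n t \<Longrightarrow> cyl n 0 t p \<in> sets M"
  using cyl_measurable[OF _ dpaths_dtraj, of 0 t p n] by (simp add: sets_M sets_path_space_eq_tail)

lemma measure_by_level:
  "measure M {X \<in> paths n. P (discr n X t)} = (\<Sum>l\<in>{l \<in> ends n t. P l}. measure M (level n t l))"
proof -
  have "{X \<in> paths n. P (discr n X t)} = (\<Union>l\<in>{l \<in> ends n t. P l}. level n t l)"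
    using discr_ends by auto
  also have "measure M \<dots> = (\<Sum>l\<in>{l \<in> ends n t. P l}. measure M (level n t l))"
    using level_sets ends_shapes
    by (intro finite_measure_finite_Union) (auto simp: finite_ends disjoint_family_on_def)
  finally show ?thesis .
qed

lemma discr_event_sets: "{X \<in> paths n. P (discr n X t)} \<in> sets M"
proof -
  have "{X \<in> paths n. P (discr n X t)} = (\<Union>l\<in>{l \<in> ends n t. P l}. level n t l)"
    using discr_ends by auto
  also have "\<dots> \<in> sets M"
    using level_sets ends_shapes finite_ends by (intro sets.finite_UN) auto
  finally show ?thesis .
qed

lemma measure_by_prefix:
  "measure M {X \<in> paths n. P (prefix n t X)} = (\<Sum>p\<in>{p \<in> dpaths n t. P p}. measure M (cyl n 0 t p))"
proof -
  have iff: "X \<in> cyl n 0 t p \<longleftrightarrow> X \<in> paths n \<and> prefix n t X = p" if p: "p \<in> dpaths n t" for X p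
  proof
    assume X: "X \<in> cyl n 0 t p"
    then have Xi: "X \<in> paths n" by (simp add: cyl_def)
    have "prefix n t X = p"
      by (rule dpaths_eqI[OF prefix_inf[OF Xi] p]) (use X in \<open>simp add: cyl_def prefix_def\<close>)
    then show "X \<in> paths n \<and> prefix n t X = p" using Xi by simp
  qed (auto simp: cyl_prefix)
  have "{X \<in> paths n. P (prefix n t X)} = (\<Union>p\<in>{p \<in> dpaths n t. P p}. cyl n 0 t p)"
    using prefix_inf iff by auto
  also have "measure M \<dots> = (\<Sum>p\<in>{p \<in> dpaths n t. P p}. measure M (cyl n 0 t p))"
    using cyl_sets iff
    by (intro finite_measure_finite_Union) (auto simp: finite_dpaths disjoint_family_on_def)
  finally show ?thesis .
qed

end

lemma weight_0: "weight d n 0 (\<lambda>_. 0) = 1"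
proof (induction n)
  case (Suc n)
  have "m = (\<lambda>_. 0)" if m: "m \<in> interlacing n (\<lambda>_. 0)" for m
  proof
    fix i
    show "m i = 0"
      using m interlacing_le[OF m, of i] by (cases "i \<in> {1..n}") (simp_all add: interlacing_def)
  qed
  moreover have "(\<lambda>_. 0) \<in> interlacing n (\<lambda>_. 0)"
    by (simp add: interlacing_def)
  ultimately have "interlacing n (\<lambda>_. 0) = {\<lambda>_. 0}"
    by blast
  then show ?case
    using Suc by (simp add: boxes_def bern_def)
qed simp

text \<open>
  Half of the exponential decay absorbs the polynomial factor.
\<close>
lemma summable_poly_exp:
  assumes "c > 0"
  shows "summable (\<lambda>t::nat. real ((t + 1) ^ N) * exp (- c * real t))"
proof (rule summable_comparison_test_bigo)
  have "summable (\<lambda>t. exp (- c / 2) ^ t)"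
    using assms by (intro summable_geometric) simp
  then show "summable (\<lambda>t::nat. norm (exp (- c / 2 * real t)))"
    by (simp add: exp_of_nat_mult[symmetric] mult.commute)
  show "(\<lambda>t::nat. real ((t + 1) ^ N) * exp (- c * real t)) \<in> O(\<lambda>t. exp (- c / 2 * real t))"
    using assms by real_asymp
qed

locale slope_weights =
  fixes n :: nat and d :: "nat \<Rightarrow> real"
  assumes d01: "\<And>i. i \<in> {1..n} \<Longrightarrow> d i \<in> {0..1}"
    and d_anti: "\<And>i j. i \<in> {1..n} \<Longrightarrow> j \<in> {1..n} \<Longrightarrow> i \<le> j \<Longrightarrow> d j \<le> d i"

text \<open>
  The measure whose prefix probabilities are the Schur weights of the given slopes.
\<close>
locale slope_measure = slope_weights n d + path_measure M n for n d M +
  assumes law: "\<And>t p. p \<in> dpaths n t \<Longrightarrow> measure M (cyl n 0 t p) = weight d n t (p t)"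
begin

lemma level_law: "measure M (level n t l) = real (npaths n t l) * weight d n t l"
proof -
  have "level n t l = {X \<in> paths n. prefix n t X t = l}"
    by (simp add: prefix_def)
  then have "measure M (level n t l) = (\<Sum>p\<in>{p \<in> dpaths n t. p t = l}. measure M (cyl n 0 t p))"
    using measure_by_prefix[of "\<lambda>p. p t = l" t] by simp
  also have "\<dots> = (\<Sum>p\<in>{p \<in> dpaths n t. p t = l}. weight d n t l)"
    using law by (intro sum.cong) auto
  finally show ?thesis by (simp add: npaths_def)
qed

text \<open>
  The numbers \<open>t choose l j\<close> that bound the number of paths and the factors
  \<open>bern\<close> that bound the weight combine to binomial probabilities; all but one of them are
  bounded by 1.
\<close>
lemma level_le:
  assumes l: "l \<in> ends n t" and i: "i \<in> {1..n}"
  shows "measure M (level n t l) \<le> real ((t + 1) ^ (n * n)) * pmf (binomial_pmf t (d i)) (l i)"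
proof -
  have pmf: "real (t choose l j) * bern (d j) t (l j) = pmf (binomial_pmf t (d j)) (l j)" if "j \<in> {1..n}" for j
    using d01[OF that] by (simp add: bern_def)
  have nn: "0 \<le> (\<Prod>j=1..n. bern (d j) t (l j))"
    using d01 by (intro prod_nonneg bern_nonneg) auto
  have "measure M (level n t l) \<le> real (\<Prod>j\<in>{1..n}. t choose l j) * (real ((t + 1) ^ (n * n)) * (\<Prod>j=1..n. bern (d j) t (l j)))"
    unfolding level_law
    by (intro mult_mono of_nat_mono npaths_le_prod_binomial weight_nonneg weight_le_prod_bern d01 d_anti
          ends_shapes[OF l] ends_le[OF l] of_nat_0_le_iff)
  also have "\<dots> = real ((t + 1) ^ (n * n)) * (\<Prod>j=1..n. real (t choose l j) * bern (d j) t (l j))"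
    by (simp add: prod.distrib)
  also have "(\<Prod>j=1..n. real (t choose l j) * bern (d j) t (l j)) = (\<Prod>j=1..n. pmf (binomial_pmf t (d j)) (l j))"
    by (intro prod.cong refl pmf)
  also have "\<dots> = pmf (binomial_pmf t (d i)) (l i) * (\<Prod>j\<in>{1..n} - {i}. pmf (binomial_pmf t (d j)) (l j))"
    using i by (intro prod.remove) auto
  also have "\<dots> \<le> pmf (binomial_pmf t (d i)) (l i) * 1"
    by (intro mult_left_mono prod_le_1) (auto simp: pmf_le_1)
  finally show ?thesis
    by (simp add: mult_left_mono)
qed

text \<open>
  There are at most \<open>(t + 1)^n\<close> possible endpoints, so summing the bound over the
  endpoints costs only a further polynomial factor.
\<close>
lemma component_le_binomial:
  assumes i: "i \<in> {1..n}"
  shows "measure M {X \<in> paths n. discr n X t i \<in> B}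
       \<le> real ((t + 1) ^ (n * n + n)) * measure_pmf.prob (binomial_pmf t (d i)) B"
proof -
  let ?b = "measure_pmf.prob (binomial_pmf t (d i)) B"
  have "measure M {X \<in> paths n. discr n X t i \<in> B} = (\<Sum>l\<in>{l \<in> ends n t. l i \<in> B}. measure M (level n t l))"
    by (rule measure_by_level[of "\<lambda>l. l i \<in> B"])
  also have "\<dots> \<le> (\<Sum>l\<in>{l \<in> ends n t. l i \<in> B}. real ((t + 1) ^ (n * n)) * ?b)"
  proof (rule sum_mono)
    fix l assume l: "l \<in> {l \<in> ends n t. l i \<in> B}"
    have "pmf (binomial_pmf t (d i)) (l i) \<le> ?b"
      unfolding measure_pmf_single[symmetric] using l by (intro measure_pmf.finite_measure_mono) auto
    then show "measure M (level n t l) \<le> real ((t + 1) ^ (n * n)) * ?b"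
      using l i by (intro order.trans[OF level_le mult_left_mono]) auto
  qed
  also have "\<dots> = real (card {l \<in> ends n t. l i \<in> B}) * (real ((t + 1) ^ (n * n)) * ?b)"
    by simp
  also have "\<dots> \<le> real ((t + 1) ^ n) * (real ((t + 1) ^ (n * n)) * ?b)"
  proof (intro mult_right_mono of_nat_mono)
    show "card {l \<in> ends n t. l i \<in> B} \<le> (t + 1) ^ n"
      using card_mono[OF finite_ends[of n t], of "{l \<in> ends n t. l i \<in> B}"] card_ends[of n t] by auto
  qed auto
  also have "\<dots> = real ((t + 1) ^ (n * n + n)) * ?b"
    by (simp add: power_add)
  finally show ?thesis .
qed

text \<open>
  At the extreme slopes 0 and 1 the binomial law is a point mass, and a polynomial factor times zero
  is zero.
\<close>
lemma discr_extreme: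
  assumes i: "i \<in> {1..n}"
  shows "d i = 1 \<Longrightarrow> measure M {X \<in> paths n. discr n X t i \<noteq> t} = 0"
    and "d i = 0 \<Longrightarrow> measure M {X \<in> paths n. discr n X t i \<noteq> 0} = 0"
proof -
  have "measure M {X \<in> paths n. discr n X t i \<noteq> c} = 0"
    if "set_pmf (binomial_pmf t (d i)) = {c}" for c
  proof -
    have "measure_pmf.prob (binomial_pmf t (d i)) (- {c}) = 0"
      unfolding measure_pmf_zero_iff using that by simp
    then show ?thesis
      using component_le_binomial[OF i, of t "- {c}"] by (simp add: measure_le_0_iff)
  qed
  then show "d i = 1 \<Longrightarrow> measure M {X \<in> paths n. discr n X t i \<noteq> t} = 0"
    "d i = 0 \<Longrightarrow> measure M {X \<in> paths n. discr n X t i \<noteq> 0} = 0"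
    by simp_all
qed

lemma deviation_le:
  assumes i: "i \<in> {1..n}" and e: "e > 0"
  shows "measure M {X \<in> paths n. \<bar>real (discr n X t i) - real t * d i\<bar> \<ge> e * real t}
       \<le> 2 * (real ((t + 1) ^ (n * n + n)) * exp (- (2 * e\<^sup>2) * real t))"
proof (cases "t = 0")
  case True
  show ?thesis by (rule order.trans[OF prob_le_1]) (simp add: True)
next
  case False
  interpret B: binomial_distribution t "d i"
    using d01[OF i] by unfold_locales
  let ?B = "{x::nat. \<bar>real x - real t * d i\<bar> \<ge> e * real t}"
  have "measure_pmf.prob (binomial_pmf t (d i)) ?B \<le> 2 * exp (- 2 * (e * real t)\<^sup>2 / real t)"
    by (rule B.prob_abs_ge) (use False e in auto)
  also have "- 2 * (e * real t)\<^sup>2 / real t = - (2 * e\<^sup>2) * real t"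
    using False by (simp add: power2_eq_square)
  finally have "real ((t + 1) ^ (n * n + n)) * measure_pmf.prob (binomial_pmf t (d i)) ?B
      \<le> real ((t + 1) ^ (n * n + n)) * (2 * exp (- (2 * e\<^sup>2) * real t))"
    by (intro mult_left_mono) auto
  from order.trans[OF component_le_binomial[OF i, of t ?B] this] show ?thesis
    by (simp add: mult.left_commute)
qed

lemma AE_discr_slope:
  assumes i: "i \<in> {1..n}"
  shows "AE X in M. (\<lambda>t. real (discr n X t i) / real t) \<longlonglongrightarrow> d i"
proof -
  define A where "A e t = {X \<in> paths n. \<bar>real (discr n X t i) - real t * d i\<bar> \<ge> e * real t}" for e :: real and t
  have "AE X in M. eventually (\<lambda>t. X \<in> space M - A e t) sequentially" if e: "e > 0" for e
  proof (rule borel_cantelli_AE1)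
    show "A e t \<in> sets M" for t
      unfolding A_def by (rule discr_event_sets[of "\<lambda>l. \<bar>real (l i) - real t * d i\<bar> \<ge> e * real t"])
    show "emeasure M (A e t) < \<infinity>" for t
      by (simp add: emeasure_eq_measure)
    have "summable (\<lambda>t. 2 * (real ((t + 1) ^ (n * n + n)) * exp (- (2 * e\<^sup>2) * real t)))"
      using e by (intro summable_mult summable_poly_exp) simp
    then show "summable (\<lambda>t. measure M (A e t))"
      by (rule summable_comparison_test'[where N = 0]) (use deviation_le[OF i e] in \<open>simp add: A_def\<close>)
  qed
  then have "AE X in M. \<forall>k. eventually (\<lambda>t. X \<in> space M - A (inverse (real (Suc k))) t) sequentially"
    by (subst AE_all_countable) auto
  then show ?thesis
  proof eventually_elim
    case (elim X)
    show ?case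
    proof (rule LIMSEQ_I)
      fix r :: real assume "r > 0"
      then obtain k where k: "inverse (real (Suc k)) < r"
        using reals_Archimedean by blast
      have "eventually (\<lambda>t. X \<in> space M - A (inverse (real (Suc k))) t \<and> 0 < t) sequentially"
        using elim[rule_format, of k] eventually_gt_at_top[of 0] by (rule eventually_conj)
      then have "eventually (\<lambda>t. norm (real (discr n X t i) / real t - d i) < r) sequentially"
      proof eventually_elim
        case (elim t)
        then have t: "0 < real t" by simp
        have "\<bar>real (discr n X t i) - real t * d i\<bar> < inverse (real (Suc k)) * real t"
          using elim by (auto simp: A_def space_M)
        also have "\<dots> < r * real t"
          by (rule mult_strict_right_mono[OF k t])
        finally have "\<bar>real (discr n X t i) - real t * d i\<bar> / real t < r"
          using t by (simp add: divide_less_eq)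
        moreover have "real (discr n X t i) / real t - d i = (real (discr n X t i) - real t * d i) / real t"
          using t by (simp add: field_simps)
        ultimately show ?case
          using t by (simp add: abs_divide)
      qed
      then show "\<exists>no. \<forall>t\<ge>no. norm (real (discr n X t i) / real t - d i) < r"
        by (simp add: eventually_sequentially)
    qed
  qed
qed

end

text \<open>
  Between integer times a path changes by at most 1.
\<close>
lemma slope_from_integers:
  assumes X: "X \<in> paths n" and i: "i \<in> {1..n}"
    and lim: "(\<lambda>t. real (discr n X t i) / real t) \<longlonglongrightarrow> c"
  shows "((\<lambda>s. X i s / s) \<longlongrightarrow> c) at_top"
proof -
  let ?k = "\<lambda>s::real. nat \<lfloor>s\<rfloor>"
  have k: "filterlim ?k at_top at_top"
    by (rule filterlim_compose[OF filterlim_nat_sequentially filterlim_floor_sequentially])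
  have q: "((\<lambda>s. real (discr n X (?k s) i) / real (?k s)) \<longlongrightarrow> c) at_top"
    by (rule filterlim_compose[OF lim k])
  have r: "((\<lambda>s. real (?k s) / s) \<longlongrightarrow> 1) at_top"
    by real_asymp
  have inv: "((\<lambda>s::real. 1 / s) \<longlongrightarrow> 0) at_top"
    by real_asymp
  have "((\<lambda>s. (X i s - real (discr n X (?k s) i)) / s) \<longlongrightarrow> 0) at_top"
  proof (rule Lim_null_comparison[OF _ inv])
    show "\<forall>\<^sub>F s in at_top. norm ((X i s - real (discr n X (?k s) i)) / s) \<le> 1 / s"
      using eventually_gt_at_top[of 0]
    proof eventually_elim
      case (elim s)
      have "X i s - real (discr n X (?k s) i) = frac s * (real (discr n X (Suc (?k s)) i) - real (discr n X (?k s) i))"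
        using path_eq_plin_discr[OF X i, of s] elim by (simp add: plin_def algebra_simps)
      moreover have "real (discr n X (Suc (?k s)) i) - real (discr n X (?k s) i) \<in> {0, 1}"
        using dtraj_step[OF discr_dtraj[OF X], of "?k s" i] by auto
      ultimately have "\<bar>X i s - real (discr n X (?k s) i)\<bar> \<le> 1"
        using frac_ge_0[of s] frac_lt_1[of s] by auto
      then show ?case
        using elim by (simp add: abs_divide divide_right_mono)
    qed
  qed
  from tendsto_add[OF tendsto_mult[OF q r] this]
  have "((\<lambda>s. real (discr n X (?k s) i) / real (?k s) * (real (?k s) / s) + (X i s - real (discr n X (?k s) i)) / s) \<longlongrightarrow> c) at_top"
    by simp
  then show ?thesis
  proof (rule Lim_transform_eventually)
    show "\<forall>\<^sub>F s in at_top. real (discr n X (?k s) i) / real (?k s) * (real (?k s) / s) + (X i s - real (discr n X (?k s) i)) / s = X i s / s"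
      using eventually_ge_at_top[of 1]
    proof eventually_elim
      case (elim s)
      then have "1 \<le> \<lfloor>s\<rfloor>" by simp
      then have "real (?k s) \<noteq> 0" by linarith
      moreover have "a / b * (b / s) = a / s" if "b \<noteq> 0" for a b :: real
        using that by simp
      ultimately have "real (discr n X (?k s) i) / real (?k s) * (real (?k s) / s) = real (discr n X (?k s) i) / s"
        by blast
      then show ?case
        by (simp only: diff_divide_distrib)
    qed
  qed
qed

context slope_weights
begin

lemma slope_measure_exists: "\<exists>M. slope_measure n d M"
proof -
  obtain M where "prob_space M" "sets M = sets (path_space n {0..})"
    "\<And>t p. p \<in> dpaths n t \<Longrightarrow> measure M (cyl n 0 t p) = weight d n t (p t)"
    using harmonic_measure_exists[of "weight d n" n] weight_0[of d n] weight_nonneg[OF d01] weight_harmonic[of _ n _ d] by auto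
  then have "slope_measure n d M"
    by (intro slope_measure.intro path_measure.intro path_measure_axioms.intro slope_measure_axioms.intro slope_weights_axioms)
  then show ?thesis ..
qed

end

lemma (in slope_measure) slope_gibbs:
  "bernoulli_gibbs n M" "AE X in M. \<forall>i\<in>{1..n}. ((\<lambda>t. X i t / t) \<longlongrightarrow> d i) at_top"
proof -
  show "bernoulli_gibbs n M"
    by (rule gibbs_of_law[OF prob_space_axioms sets_M law])
  have "AE X in M. \<forall>i\<in>{1..n}. (\<lambda>t. real (discr n X t i) / real t) \<longlonglongrightarrow> d i"
    by (rule AE_finite_allI) (auto intro: AE_discr_slope)
  then show "AE X in M. \<forall>i\<in>{1..n}. ((\<lambda>t. X i t / t) \<longlongrightarrow> d i) at_top"
    using AE_space by eventually_elim (auto simp: space_M intro!: slope_from_integers)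
qed

section \<open>Comparison of Gibbs measures and uniqueness\<close>

text \<open>
  The probability of \<open>l \<le> p s\<close> under the uniform law on prefixes ending at
  \<open>x\<close>.
\<close>
definition up_frac :: "nat \<Rightarrow> nat \<Rightarrow> nat \<Rightarrow> (nat \<Rightarrow> nat) \<Rightarrow> (nat \<Rightarrow> nat) \<Rightarrow> real" where
  "up_frac n t s l x = real (card {p \<in> dpaths n t. p t = x \<and> l \<le> p s}) / real (npaths n t x)"

lemma up_frac_mono:
  assumes "x \<in> ends n t" "y \<in> ends n t" "x \<le> y"
  shows "up_frac n t s l x \<le> up_frac n t s l y"
proof -
  have "real (card {p \<in> dpaths n t. p t = x \<and> l \<le> p s}) * real (npaths n t y)
      \<le> real (card {p \<in> dpaths n t. p t = y \<and> l \<le> p s}) * real (npaths n t x)"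
    using of_nat_mono[OF paths_stochastically_increasing[OF assms(3), of n t l s], where 'a = real]
    by (simp only: of_nat_mult)
  moreover have "a / x \<le> c / y" if "a * y \<le> c * x" "0 < x" "0 < y" for a c x y :: real
    using that by (simp add: field_simps)
  ultimately show ?thesis
    using npaths_pos[OF assms(1)] npaths_pos[OF assms(2)] unfolding up_frac_def by simp
qed

lemma up_frac_01: "x \<in> ends n t \<Longrightarrow> 0 \<le> up_frac n t s l x \<and> up_frac n t s l x \<le> 1"
proof -
  assume x: "x \<in> ends n t"
  have "card {p \<in> dpaths n t. p t = x \<and> l \<le> p s} \<le> npaths n t x"
    unfolding npaths_def by (rule card_mono) (auto intro: finite_subset[OF _ finite_dpaths[of n t]])
  then show ?thesis
    using npaths_pos[OF x] by (simp add: up_frac_def divide_le_eq_1)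
qed

abbreviation containing :: "nat \<Rightarrow> nat \<Rightarrow> (nat \<Rightarrow> nat) \<Rightarrow> (nat \<Rightarrow> real \<Rightarrow> real) set" where
  "containing n s l \<equiv> {X \<in> paths n. l \<le> discr n X s}"

lemma (in path_measure) gibbs_event_up:
  assumes gibbs: "bernoulli_gibbs n M" and st: "s \<le> t"
  shows "measure M (containing n s l) = (\<Sum>x\<in>ends n t. measure M (level n t x) * up_frac n t s l x)"
proof -
  let ?P = "{p \<in> dpaths n t. l \<le> p s}" and ?q = "\<lambda>p. measure M (level n t (p t)) / real (npaths n t (p t))"
  have "containing n s l = {X \<in> paths n. l \<le> prefix n t X s}"
    using st by (simp add: prefix_def)
  then have "measure M (containing n s l) = (\<Sum>p\<in>?P. measure M (cyl n 0 t p))"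
    using measure_by_prefix[of "\<lambda>p. l \<le> p s" t] by simp
  also have "\<dots> = (\<Sum>p\<in>?P. ?q p)"
  proof (intro sum.cong refl)
    fix p assume "p \<in> ?P"
    then have p: "p \<in> dpaths n t" by simp
    then have "0 < npaths n t (p t)"
      by (intro npaths_pos) (simp add: ends_def)
    then show "measure M (cyl n 0 t p) = ?q p"
      using gibbs_prefix_law[OF gibbs p] by (simp add: field_simps)
  qed
  also have "\<dots> = (\<Sum>x\<in>ends n t. \<Sum>p\<in>{p. p \<in> ?P \<and> p t = x}. ?q p)"
    by (rule sum.group[symmetric]) (auto simp: finite_dpaths finite_ends ends_def)
  also have "\<dots> = (\<Sum>x\<in>ends n t. measure M (level n t x) * up_frac n t s l x)"
  proof (intro sum.cong refl)
    fix x
    have "(\<Sum>p\<in>{p. p \<in> ?P \<and> p t = x}. ?q p)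
        = (\<Sum>p\<in>{p \<in> dpaths n t. p t = x \<and> l \<le> p s}. measure M (level n t x) / real (npaths n t x))"
      by (rule sum.cong) auto
    then show "(\<Sum>p\<in>{p. p \<in> ?P \<and> p t = x}. ?q p)
        = measure M (level n t x) * up_frac n t s l x"
      by (simp add: up_frac_def)
  qed
  finally show ?thesis .
qed

text \<open>
  At time \<open>t\<close> the conditional probability of the event \<open>l \<le> discr n X s\<close> is
  an increasing function of the endpoint, for both measures the same one. If the endpoint lies below
  the threshold \<open>a\<close> under \<open>M\<close> and above it under \<open>N\<close>, then it
  is at most \<open>H\<close> in the first case and at least \<open>H\<close> in the second, where
  \<open>H\<close> is its maximum below the threshold. The exceptional events contribute at
  most their probabilities.
\<close>
lemma gibbs_compare_at:
  fixes a :: "nat \<Rightarrow> real"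
  assumes M: "path_measure M n" "bernoulli_gibbs n M" and N: "path_measure N n" "bernoulli_gibbs n N" and st: "s \<le> t"
  shows "measure M (containing n s l) \<le> measure N (containing n s l)
    + measure M {X \<in> paths n. \<exists>i\<in>{1..n}. a i < real (discr n X t i)}
    + measure N {X \<in> paths n. \<exists>i\<in>{1..n}. real (discr n X t i) < a i}"
proof -
  interpret M: path_measure M n by (rule M(1))
  interpret N: path_measure N n by (rule N(1))
  let ?E = "ends n t" and ?h = "up_frac n t s l"
  define lo where "lo x \<longleftrightarrow> (\<forall>i\<in>{1..n}. real (x i) \<le> a i)" for x :: "nat \<Rightarrow> nat"
  define hi where "hi x \<longleftrightarrow> (\<forall>i\<in>{1..n}. a i \<le> real (x i))" for x :: "nat \<Rightarrow> nat"
  \<comment> \<open>The value 0 is included because no endpoint need lie below the threshold.\<close>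
  define H where "H = Max (insert 0 (?h ` {x \<in> ?E. lo x}))"
  have fin: "finite (insert 0 (?h ` {x \<in> ?E. lo x}))"
    by (simp add: finite_ends)
  have H01: "0 \<le> H" "H \<le> 1"
    unfolding H_def using fin up_frac_01 by (auto simp: Max_ge_iff)
  have lo_le: "?h x \<le> H" if "x \<in> ?E" "lo x" for x
    unfolding H_def using fin that by (intro Max_ge) auto
  have hi_ge: "H \<le> ?h y" if y: "y \<in> ?E" "hi y" for y
    unfolding H_def
  proof (subst Max_le_iff[OF fin], simp, intro ballI)
    fix v assume "v \<in> insert 0 (?h ` {x \<in> ?E. lo x})"
    then consider "v = 0" | x where "x \<in> ?E" "lo x" "v = ?h x" by blast
    then show "v \<le> ?h y"
    proof cases
      case 1
      then show ?thesis using up_frac_01[OF y(1)] by simp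
    next
      case 2
      have "x i \<le> y i" for i
      proof (cases "i \<in> {1..n}")
        case True
        then have "real (x i) \<le> real (y i)"
          using 2(2) y(2) unfolding lo_def hi_def by (meson order.trans)
        then show ?thesis by simp
      next
        case False
        then show ?thesis using shapes_zero[OF ends_shapes[OF 2(1)]] by simp
      qed
      then show ?thesis
        using up_frac_mono[OF 2(1) y(1)] 2(3) by (simp add: le_fun_def)
    qed
  qed
  have bad: "{X \<in> paths n. \<exists>i\<in>{1..n}. a i < real (discr n X t i)} = {X \<in> paths n. \<not> lo (discr n X t)}"
    "{X \<in> paths n. \<exists>i\<in>{1..n}. real (discr n X t i) < a i} = {X \<in> paths n. \<not> hi (discr n X t)}"
    by (auto simp: lo_def hi_def not_le)
  have tot: "(\<Sum>x\<in>?E. measure M (level n t x)) = 1" "(\<Sum>x\<in>?E. measure N (level n t x)) = 1"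
    using M.measure_by_level[of "\<lambda>_. True" t] N.measure_by_level[of "\<lambda>_. True" t] M.prob_space N.prob_space
    by (simp_all add: M.space_M N.space_M)
  have "measure M (containing n s l) = (\<Sum>x\<in>?E. measure M (level n t x) * ?h x)"
    by (rule M.gibbs_event_up[OF M(2) st])
  also have "\<dots> \<le> (\<Sum>x\<in>?E. measure M (level n t x) * H + (if \<not> lo x then measure M (level n t x) else 0))"
  proof (rule sum_mono)
    fix x assume x: "x \<in> ?E"
    show "measure M (level n t x) * ?h x \<le> measure M (level n t x) * H + (if \<not> lo x then measure M (level n t x) else 0)"
    proof (cases "lo x")
      case True
      then show ?thesis using lo_le[OF x] by (simp add: mult_left_mono)
    next
      case False
      have "measure M (level n t x) * ?h x \<le> measure M (level n t x) * 1"
        using up_frac_01[OF x] by (intro mult_left_mono) auto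
      moreover have "0 \<le> measure M (level n t x) * H"
        using H01 by simp
      ultimately show ?thesis using False by simp
    qed
  qed
  also have "\<dots> = H + measure M {X \<in> paths n. \<not> lo (discr n X t)}"
    using M.measure_by_level[of "\<lambda>x. \<not> lo x" t] tot(1)
    by (simp add: sum.distrib sum_distrib_right[symmetric] sum.inter_filter[symmetric] finite_ends)
  finally have 1: "measure M (containing n s l) \<le> H + measure M {X \<in> paths n. \<not> lo (discr n X t)}" .
  have "H - measure N {X \<in> paths n. \<not> hi (discr n X t)}
      = (\<Sum>x\<in>?E. measure N (level n t x) * H - (if \<not> hi x then measure N (level n t x) else 0))"
    using N.measure_by_level[of "\<lambda>x. \<not> hi x" t] tot(2)
    by (simp add: sum_subtractf sum_distrib_right[symmetric] sum.inter_filter[symmetric] finite_ends)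
  also have "\<dots> \<le> (\<Sum>x\<in>?E. measure N (level n t x) * ?h x)"
  proof (rule sum_mono)
    fix x assume x: "x \<in> ?E"
    show "measure N (level n t x) * H - (if \<not> hi x then measure N (level n t x) else 0) \<le> measure N (level n t x) * ?h x"
    proof (cases "hi x")
      case True
      then show ?thesis using hi_ge[OF x] by (simp add: mult_left_mono)
    next
      case False
      have "measure N (level n t x) * H \<le> measure N (level n t x) * 1"
        using H01 by (intro mult_left_mono) auto
      moreover have "0 \<le> measure N (level n t x) * ?h x"
        using up_frac_01[OF x] by simp
      ultimately show ?thesis using False by simp
    qed
  qed
  also have "\<dots> = measure N (containing n s l)"
    by (rule N.gibbs_event_up[OF N(2) st, symmetric])
  finally show ?thesis
    using 1 unfolding bad by linarith
qed

lemma gibbs_compare: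
  fixes a :: "nat \<Rightarrow> nat \<Rightarrow> real"
  assumes M: "path_measure M n" "bernoulli_gibbs n M" and N: "path_measure N n" "bernoulli_gibbs n N"
    and limM: "\<And>i. i \<in> {1..n} \<Longrightarrow> (\<lambda>t. measure M {X \<in> paths n. a t i < real (discr n X t i)}) \<longlonglongrightarrow> 0"
    and limN: "\<And>i. i \<in> {1..n} \<Longrightarrow> (\<lambda>t. measure N {X \<in> paths n. real (discr n X t i) < a t i}) \<longlonglongrightarrow> 0"
  shows "measure M (containing n s l) \<le> measure N (containing n s l)"
proof -
  let ?A = "\<lambda>t i. {X \<in> paths n. a t i < real (discr n X t i)}"
    and ?B = "\<lambda>t i. {X \<in> paths n. real (discr n X t i) < a t i}"
  interpret M: path_measure M n by (rule M(1))
  interpret N: path_measure N n by (rule N(1))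
  let ?m = "measure M (containing n s l)" and ?n = "measure N (containing n s l)"
  have le: "?m \<le> ?n + (\<Sum>i=1..n. measure M (?A t i))
     + (\<Sum>i=1..n. measure N (?B t i))" if t: "s \<le> t" for t
  proof -
    have "{X \<in> paths n. \<exists>i\<in>{1..n}. a t i < real (discr n X t i)} = (\<Union>i\<in>{1..n}. (?A t i))"
      by auto
    also have "measure M \<dots> \<le> (\<Sum>i=1..n. measure M (?A t i))"
      using M.discr_event_sets[of "\<lambda>l. a t _ < real (l _)" t] by (intro M.finite_measure_subadditive_finite) auto
    finally have 1: "measure M {X \<in> paths n. \<exists>i\<in>{1..n}. a t i < real (discr n X t i)}
        \<le> (\<Sum>i=1..n. measure M (?A t i))" .
    have "{X \<in> paths n. \<exists>i\<in>{1..n}. real (discr n X t i) < a t i} = (\<Union>i\<in>{1..n}. (?B t i))"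
      by auto
    also have "measure N \<dots> \<le> (\<Sum>i=1..n. measure N (?B t i))"
      using N.discr_event_sets[of "\<lambda>l. real (l _) < a t _" t] by (intro N.finite_measure_subadditive_finite) auto
    finally have 2: "measure N {X \<in> paths n. \<exists>i\<in>{1..n}. real (discr n X t i) < a t i}
        \<le> (\<Sum>i=1..n. measure N (?B t i))" .
    show ?thesis
      using gibbs_compare_at[OF M N t, of l "a t"] 1 2 by linarith
  qed
  have "(\<lambda>t. ?n + (\<Sum>i=1..n. measure M (?A t i))
     + (\<Sum>i=1..n. measure N (?B t i))) \<longlonglongrightarrow> ?n + (\<Sum>i=1..n. 0) + (\<Sum>i=1..n. 0)"
    by (intro tendsto_intros limM limN)
  then have "(\<lambda>t. ?n + (\<Sum>i=1..n. measure M (?A t i))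
     + (\<Sum>i=1..n. measure N (?B t i))) \<longlonglongrightarrow> ?n"
    by simp
  then show ?thesis
    by (rule LIMSEQ_le_const) (use le in blast)
qed

lemma (in prob_space) prob_tendsto_0:
  assumes A: "\<And>t. A t \<in> events" and ae: "AE x in M. eventually (\<lambda>t. x \<notin> A t) sequentially"
  shows "(\<lambda>t::nat. prob (A t)) \<longlonglongrightarrow> 0"
proof -
  have "(\<lambda>t. integral\<^sup>L M (indicat_real (A t))) \<longlonglongrightarrow> integral\<^sup>L M (\<lambda>_. 0)"
  proof (rule integral_dominated_convergence[where w = "\<lambda>_. 1"])
    show "AE x in M. (\<lambda>t. indicat_real (A t) x) \<longlonglongrightarrow> 0"
      using ae
    proof eventually_elim
      case (elim x)
      then show ?case
        by (intro tendsto_eventually) (auto elim: eventually_mono)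
    qed
  qed (use A in auto)
  then show ?thesis
    using A by simp
qed

text \<open>
  Convergence in probability of the slopes follows from almost sure convergence. The two one-sided
  deviations are separated since a comparison uses one of them for each measure.
\<close>
lemma (in path_measure) slope_deviation:
  assumes lim: "AE X in M. (\<lambda>t. real (discr n X t i) / real t) \<longlonglongrightarrow> c" and e: "e > 0"
  shows "(\<lambda>t. measure M {X \<in> paths n. (c + e) * real t < real (discr n X t i)}) \<longlonglongrightarrow> 0"
    and "(\<lambda>t. measure M {X \<in> paths n. real (discr n X t i) < (c - e) * real t}) \<longlonglongrightarrow> 0"
proof -
  let ?A = "\<lambda>t. {X \<in> paths n. (c + e) * real t < real (discr n X t i)}"
    and ?B = "\<lambda>t. {X \<in> paths n. real (discr n X t i) < (c - e) * real t}"
  have ae: "AE X in M. eventually (\<lambda>t. real (discr n X t i) \<le> (c + e) * real t \<and> (c - e) * real t \<le> real (discr n X t i)) sequentially"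
    using lim
  proof eventually_elim
    case (elim X)
    have "eventually (\<lambda>t. c - e < real (discr n X t i) / real t) sequentially" "eventually (\<lambda>t. real (discr n X t i) / real t < c + e) sequentially"
      using order_tendstoD[OF elim] e by auto
    then show ?case
      using eventually_gt_at_top[of 0]
    proof eventually_elim
      case (elim t)
      then show ?case by (simp add: field_simps)
    qed
  qed
  show "(\<lambda>t. measure M (?A t)) \<longlonglongrightarrow> 0"
  proof (rule prob_tendsto_0)
    show "(?A t) \<in> events" for t
      by (rule discr_event_sets[of "\<lambda>l. (c + e) * real t < real (l i)"])
    show "AE X in M. eventually (\<lambda>t. X \<notin> (?A t)) sequentially"
      using ae by eventually_elim (auto elim!: eventually_mono)
  qed
  show "(\<lambda>t. measure M (?B t)) \<longlonglongrightarrow> 0"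
  proof (rule prob_tendsto_0)
    show "(?B t) \<in> events" for t
      by (rule discr_event_sets[of "\<lambda>l. real (l i) < (c - e) * real t"])
    show "AE X in M. eventually (\<lambda>t. X \<notin> (?B t)) sequentially"
      using ae by eventually_elim (auto elim!: eventually_mono)
  qed
qed

lemma (in path_measure) AE_discr_of_slope:
  assumes "AE X in M. ((\<lambda>t. X i t / t) \<longlongrightarrow> c) at_top" and i: "i \<in> {1..n}"
  shows "AE X in M. (\<lambda>t. real (discr n X t i) / real t) \<longlonglongrightarrow> c"
  using assms(1) AE_space
proof eventually_elim
  case (elim X)
  then have X: "X \<in> paths n" by (simp add: space_M)
  have "(\<lambda>t. X i (real t) / real t) \<longlonglongrightarrow> c"
    using filterlim_compose[OF elim(1) filterlim_real_sequentially] .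
  moreover have "X i (real t) = real (discr n X t i)" for t
    using path_at_nat[OF X _ i, of t] by auto
  ultimately show ?case by simp
qed

text \<open>
  The probability that the partition at time \<open>s\<close> contains \<open>l\<close>, as a function
  of the slopes of the constructed measure.
\<close>
definition up_weight :: "nat \<Rightarrow> nat \<Rightarrow> (nat \<Rightarrow> nat) \<Rightarrow> (nat \<Rightarrow> real) \<Rightarrow> real" where
  "up_weight n s l d = (\<Sum>p\<in>{p \<in> dpaths n s. l \<le> p s}. weight d n s (p s))"

lemma (in slope_measure) measure_up: "measure M (containing n s l) = up_weight n s l d"
proof -
  have "containing n s l = {X \<in> paths n. l \<le> prefix n s X s}"
    by (simp add: prefix_def)
  then show ?thesis
    using measure_by_prefix[of "\<lambda>p. l \<le> p s" s] law by (simp add: up_weight_def)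
qed

lemma up_weight_tendsto:
  assumes "\<And>i. i \<in> {1..n} \<Longrightarrow> ((\<lambda>x. f x i) \<longlongrightarrow> d i) F"
  shows "((\<lambda>x. up_weight n s l (f x)) \<longlongrightarrow> up_weight n s l d) F"
  unfolding up_weight_def by (intro tendsto_sum weight_tendsto assms)

context slope_weights
begin

text \<open>
  Compare with the measure constructed for slopes larger by \<open>2 * e\<close>, with the threshold
  halfway between. A slope that would exceed 1 is replaced by 1; then the component of the larger
  measure is equal to \<open>t\<close> almost surely, which is why the threshold is capped at \<open>t\<close>.
\<close>
lemma gibbs_up_le:
  assumes N: "path_measure N n" "bernoulli_gibbs n N"
    and slope: "\<And>i. i \<in> {1..n} \<Longrightarrow> AE X in N. (\<lambda>t. real (discr n X t i) / real t) \<longlonglongrightarrow> d i"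
    and e: "e > 0"
  shows "measure N (containing n s l) \<le> up_weight n s l (\<lambda>i. min 1 (d i + 2 * e))"
proof -
  let ?A = "\<lambda>t i. {X \<in> paths n. min (real t) ((d i + e) * real t) < real (discr n X t i)}"
    and ?B = "\<lambda>t i. {X \<in> paths n. real (discr n X t i) < min (real t) ((d i + e) * real t)}"
  interpret N: path_measure N n by (rule N(1))
  let ?d = "\<lambda>i. min 1 (d i + 2 * e)"
  have w: "slope_weights n ?d"
    using d01 d_anti e by unfold_locales (auto simp: min.coboundedI2 intro!: min.mono)
  obtain M where M: "slope_measure n ?d M"
    using slope_weights.slope_measure_exists[OF w] by blast
  interpret M: slope_measure n ?d M by (rule M)
  have "measure N (containing n s l) \<le> measure M (containing n s l)"
  proof (rule gibbs_compare[OF N M.path_measure_axioms M.slope_gibbs(1), where a = "\<lambda>t i. min (real t) ((d i + e) * real t)"])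
    fix i assume i: "i \<in> {1..n}"
    have "(?A t i)
        = {X \<in> paths n. (d i + e) * real t < real (discr n X t i)}" for t
      using dtraj_le[OF discr_dtraj, of _ n t i] by (auto simp: min_less_iff_disj not_less[symmetric])
    then show "(\<lambda>t. measure N (?A t i)) \<longlonglongrightarrow> 0"
      using N.slope_deviation(1)[OF slope[OF i] e] by simp
    show "(\<lambda>t. measure M (?B t i)) \<longlonglongrightarrow> 0"
    proof (cases "d i + 2 * e \<le> 1")
      case True
      then have "?d i - e = d i + e" by simp
      then have "measure M (?B t i)
          \<le> measure M {X \<in> paths n. real (discr n X t i) < (?d i - e) * real t}" for t
        by (simp only:) (intro M.finite_measure_mono M.discr_event_sets[of "\<lambda>l. real (l i) < (d i + e) * real t"], auto)
      then show ?thesis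
        by (intro tendsto_sandwich[OF _ _ tendsto_const M.slope_deviation(2)[OF M.AE_discr_slope[OF i] e]]) auto
    next
      case False
      then have d1: "?d i = 1" by simp
      have le: "measure M (?B t i)
          \<le> measure M {X \<in> paths n. discr n X t i \<noteq> t}" for t
        by (intro M.finite_measure_mono M.discr_event_sets[of "\<lambda>l. l i \<noteq> t"]) auto
      have "measure M (?B t i) = 0" for t
        by (rule antisym[OF order.trans[OF le eq_refl[OF M.discr_extreme(1)[OF i d1, of t]]] measure_nonneg])
      then show ?thesis by simp
    qed
  qed
  then show ?thesis
    by (simp add: M.measure_up)
qed

text \<open>
  The mirror image: a slope that would be negative is replaced by 0, and then the component of the
  smaller measure vanishes almost surely.
\<close>
lemma gibbs_up_ge:
  assumes N: "path_measure N n" "bernoulli_gibbs n N"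
    and slope: "\<And>i. i \<in> {1..n} \<Longrightarrow> AE X in N. (\<lambda>t. real (discr n X t i) / real t) \<longlonglongrightarrow> d i"
    and e: "e > 0"
  shows "up_weight n s l (\<lambda>i. max 0 (d i - 2 * e)) \<le> measure N (containing n s l)"
proof -
  let ?A = "\<lambda>t i. {X \<in> paths n. real (discr n X t i) < max 0 ((d i - e) * real t)}"
    and ?B = "\<lambda>t i. {X \<in> paths n. max 0 ((d i - e) * real t) < real (discr n X t i)}"
  interpret N: path_measure N n by (rule N(1))
  let ?d = "\<lambda>i. max 0 (d i - 2 * e)"
  have w: "slope_weights n ?d"
    using d01 d_anti e by unfold_locales (force intro!: max.mono)+
  obtain M where M: "slope_measure n ?d M"
    using slope_weights.slope_measure_exists[OF w] by blast
  interpret M: slope_measure n ?d M by (rule M)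
  have "measure M (containing n s l) \<le> measure N (containing n s l)"
  proof (rule gibbs_compare[OF M.path_measure_axioms M.slope_gibbs(1) N, where a = "\<lambda>t i. max 0 ((d i - e) * real t)"])
    fix i assume i: "i \<in> {1..n}"
    have "(?A t i)
        = {X \<in> paths n. real (discr n X t i) < (d i - e) * real t}" for t
      by (auto simp: less_max_iff_disj)
    then show "(\<lambda>t. measure N (?A t i)) \<longlonglongrightarrow> 0"
      using N.slope_deviation(2)[OF slope[OF i] e] by simp
    show "(\<lambda>t. measure M (?B t i)) \<longlonglongrightarrow> 0"
    proof (cases "0 \<le> d i - 2 * e")
      case True
      have "measure M (?B t i)
          \<le> measure M {X \<in> paths n. (?d i + e) * real t < real (discr n X t i)}" for t
        using True by (intro M.finite_measure_mono M.discr_event_sets[of "\<lambda>l. (?d i + e) * real t < real (l i)"]) auto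
      then show ?thesis
        by (intro tendsto_sandwich[OF _ _ tendsto_const M.slope_deviation(1)[OF M.AE_discr_slope[OF i] e]]) auto
    next
      case False
      then have d0: "?d i = 0" by simp
      have le: "measure M (?B t i)
          \<le> measure M {X \<in> paths n. discr n X t i \<noteq> 0}" for t
        by (intro M.finite_measure_mono M.discr_event_sets[of "\<lambda>l. l i \<noteq> 0"]) auto
      have "measure M (?B t i) = 0" for t
        by (rule antisym[OF order.trans[OF le eq_refl[OF M.discr_extreme(2)[OF i d0, of t]]] measure_nonneg])
      then show ?thesis by simp
    qed
  qed
  then show ?thesis
    by (simp add: M.measure_up)
qed

lemma gibbs_up_eq:
  assumes N: "path_measure N n" "bernoulli_gibbs n N"
    and slope: "\<And>i. i \<in> {1..n} \<Longrightarrow> AE X in N. (\<lambda>t. real (discr n X t i) / real t) \<longlonglongrightarrow> d i"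
  shows "measure N (containing n s l) = up_weight n s l d"
proof (rule antisym)
  have "((\<lambda>e. min 1 (d i + 2 * e)) \<longlongrightarrow> d i) (at_right 0)" if "i \<in> {1..n}" for i
  proof -
    have "((\<lambda>e. min 1 (d i + 2 * e)) \<longlongrightarrow> min 1 (d i + 2 * 0)) (at_right 0)"
      by (intro tendsto_intros)
    then show ?thesis using d01[OF that] by simp
  qed
  then have "((\<lambda>e. up_weight n s l (\<lambda>i. min 1 (d i + 2 * e))) \<longlongrightarrow> up_weight n s l d) (at_right 0)"
    by (rule up_weight_tendsto)
  then show "measure N (containing n s l) \<le> up_weight n s l d"
  proof (rule tendsto_lowerbound)
    show "\<forall>\<^sub>F e in at_right 0. measure N (containing n s l) \<le> up_weight n s l (\<lambda>i. min 1 (d i + 2 * e))"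
      using eventually_at_right_less[of 0] by eventually_elim (rule gibbs_up_le[OF N slope])
  qed simp
  have "((\<lambda>e. max 0 (d i - 2 * e)) \<longlongrightarrow> d i) (at_right 0)" if "i \<in> {1..n}" for i
  proof -
    have "((\<lambda>e. max 0 (d i - 2 * e)) \<longlongrightarrow> max 0 (d i - 2 * 0)) (at_right 0)"
      by (intro tendsto_intros)
    then show ?thesis using d01[OF that] by simp
  qed
  then have "((\<lambda>e. up_weight n s l (\<lambda>i. max 0 (d i - 2 * e))) \<longlongrightarrow> up_weight n s l d) (at_right 0)"
    by (rule up_weight_tendsto)
  then show "up_weight n s l d \<le> measure N (containing n s l)"
  proof (rule tendsto_upperbound)
    show "\<forall>\<^sub>F e in at_right 0. up_weight n s l (\<lambda>i. max 0 (d i - 2 * e)) \<le> measure N (containing n s l)"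
      using eventually_at_right_less[of 0] by eventually_elim (rule gibbs_up_ge[OF N slope])
  qed simp
qed

end

text \<open>
  A maximal point at which the functions differ contributes the only difference to its upper sum.
\<close>
lemma eq_if_upper_sums_eq:
  fixes f g :: "'a::order \<Rightarrow> real"
  assumes fin: "finite E" and eq: "\<And>l. l \<in> E \<Longrightarrow> (\<Sum>x\<in>{x\<in>E. l \<le> x}. f x) = (\<Sum>x\<in>{x\<in>E. l \<le> x}. g x)"
    and "x \<in> E"
  shows "f x = g x"
proof (rule ccontr)
  assume "f x \<noteq> g x"
  then have "x \<in> {x \<in> E. f x \<noteq> g x}" using assms(3) by simp
  then obtain m where m: "m \<in> {x \<in> E. f x \<noteq> g x}" and max: "\<And>y. y \<in> {x \<in> E. f x \<noteq> g x} \<Longrightarrow> m \<le> y \<Longrightarrow> m = y"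
    using finite_has_maximal[of "{x \<in> E. f x \<noteq> g x}"] fin by (auto 4 4)
  have split: "(\<Sum>x\<in>{x\<in>E. m \<le> x}. h x) = h m + (\<Sum>x\<in>{x\<in>E. m < x}. h x)" for h :: "'a \<Rightarrow> real"
  proof -
    have "{x\<in>E. m \<le> x} = insert m {x\<in>E. m < x}"
      using m by (auto simp: order_le_less)
    then show ?thesis using fin by simp
  qed
  have "(\<Sum>x\<in>{x\<in>E. m < x}. f x) = (\<Sum>x\<in>{x\<in>E. m < x}. g x)"
    using max by (intro sum.cong) (auto simp: order_less_le)
  then show False
    using eq[of m] m unfolding split by simp
qed

text \<open>
  The probabilities of the events \<open>l \<le> discr n X s\<close> determine the law of the
  partition at time \<open>s\<close>, and by the Gibbs property the law of the partition
  at time \<open>s\<close> determines the law of the prefix of length \<open>s\<close>.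
\<close>
lemma gibbs_eqI:
  assumes M: "path_measure M n" "bernoulli_gibbs n M" and N: "path_measure N n" "bernoulli_gibbs n N"
    and up: "\<And>s l. measure M (containing n s l) = measure N (containing n s l)"
  shows "M = N"
proof -
  interpret M: path_measure M n by (rule M(1))
  interpret N: path_measure N n by (rule N(1))
  have level: "measure M (level n s l) = measure N (level n s l)" if "l \<in> ends n s" for s l
  proof (rule eq_if_upper_sums_eq[OF finite_ends _ that])
    fix l
    show "(\<Sum>x\<in>{x \<in> ends n s. l \<le> x}. measure M (level n s x)) = (\<Sum>x\<in>{x \<in> ends n s. l \<le> x}. measure N (level n s x))"
      using up[of l s] M.measure_by_level[of "\<lambda>x. l \<le> x" s] N.measure_by_level[of "\<lambda>x. l \<le> x" s] by simp
  qed
  show ?thesis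
  proof (rule path_measure_eqI[OF M.prob_space_axioms M.sets_M N.sets_M])
    fix t p assume p: "p \<in> dpaths n t"
    then have e: "p t \<in> ends n t" by (simp add: ends_def)
    have "measure M (cyl n 0 t p) * real (npaths n t (p t)) = measure N (cyl n 0 t p) * real (npaths n t (p t))"
      using gibbs_prefix_law[OF M(2) p] gibbs_prefix_law[OF N(2) p] level[OF e] by simp
    then show "emeasure M (cyl n 0 t p) = emeasure N (cyl n 0 t p)"
      using npaths_pos[OF e] by (simp add: M.emeasure_eq_measure N.emeasure_eq_measure)
  qed
qed

theorem theorem7p2:
  fixes n :: nat and d :: "nat \<Rightarrow> real"
  assumes "\<And>i. i \<in> {1..n} \<Longrightarrow> d i \<in> {0..1}"
    and "antimono_on {1..n} d"
  shows "\<exists>!M. bernoulli_gibbs n M \<and>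
           (AE X in M. \<forall>i\<in>{1..n}. ((\<lambda>t. X i t / t) \<longlongrightarrow> d i) at_top)"
proof -
  interpret slope_weights n d
    using assms(1) monotone_onD[OF assms(2)] by unfold_locales
  obtain M where "slope_measure n d M"
    using slope_measure_exists by blast
  then interpret M: slope_measure n d M .
  have up: "measure N (containing n s l) = up_weight n s l d"
    and path: "path_measure N n"
    if N: "bernoulli_gibbs n N" and slope: "AE X in N. \<forall>i\<in>{1..n}. ((\<lambda>t. X i t / t) \<longlongrightarrow> d i) at_top" for N l s
  proof -
    show N': "path_measure N n"
      using N by (simp add: bernoulli_gibbs_def path_measure_def path_measure_axioms_def)
    interpret N: path_measure N n by (rule N')
    have "AE X in N. (\<lambda>t. real (discr n X t i) / real t) \<longlonglongrightarrow> d i" if i: "i \<in> {1..n}" for i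
    proof (rule N.AE_discr_of_slope[OF _ i])
      show "AE X in N. ((\<lambda>t. X i t / t) \<longlongrightarrow> d i) at_top"
        using slope by eventually_elim (use i in blast)
    qed
    then show "measure N (containing n s l) = up_weight n s l d"
      by (rule gibbs_up_eq[OF N' N])
  qed
  show ?thesis
  proof (rule ex1I[of _ M])
    show "bernoulli_gibbs n M \<and> (AE X in M. \<forall>i\<in>{1..n}. ((\<lambda>t. X i t / t) \<longlongrightarrow> d i) at_top)"
      using M.slope_gibbs by blast
    fix N assume N: "bernoulli_gibbs n N \<and> (AE X in N. \<forall>i\<in>{1..n}. ((\<lambda>t. X i t / t) \<longlongrightarrow> d i) at_top)"
    show "N = M"
    proof (rule gibbs_eqI)
      show "path_measure N n" "bernoulli_gibbs n N" "path_measure M n" "bernoulli_gibbs n M"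
        using path N M.slope_gibbs(1) M.path_measure_axioms by auto
      show "measure N (containing n s l) = measure M (containing n s l)" for s l
        using up N by (simp add: M.measure_up)
    qed
  qed
qed

end
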